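(* Let $R(z)=Y_N(z)\begin{pmatrix}1&0\\0&0\end{pmatrix}Y_N^{-1}(z)$, $z\in\mathbb C\setminus[0,1]$, be the matrix built from the monic Jacobi orthogonal polynomials. Then, at $z=\infty$, one has the Taylor expansion $$R(z)=T^{-1}R^{[\infty]}(z)T,\qquad|z|>1,$$ where $T$ is the constant matrix and $R^{[\infty]}(z)$ the matrix-valued power series in $z^{-1}$ given in the context. At $z=0$ one has the Poincaré asymptotic expansion $$R(z)\sim T^{-1}R^{[0]}(z)T,$$ uniformly within the sector $0<\arg z<2\pi$, where $R^{[0]}(z)$ is the matrix-valued (formal) power series in $z$ given in the context.
   Context: $N\ge1$ integer, $\mathrm{Re}\,\alpha,\mathrm{Re}\,\beta>-1$, $\alpha+\beta+2N\ne1$. $P_\ell$ are the monic polynomials with $\int_0^1P_\ell(x)P_m(x)x^\alpha(1-x)^\beta\mathrm dx=h_\ell\delta_{\ell,m}$, where $h_\ell=\frac{\ell!\,\Gamma(\alpha+\ell+1)\Gamma(\beta+\ell+1)\Gamma(\alpha+\beta+\ell+1)}{\Gamma(\alpha+\beta+2\ell+1)\Gamma(\alpha+\beta+2\ell+2)}$; $\widehat P_\ell(z)=\frac1{2\pi\mathrm i}\int_0^1P_\ell(x)x^\alpha(1-x)^\beta\frac{\mathrm dx}{x-z}$; and $$Y_N(z)=\begin{pmatrix}P_N(z)&\widehat P_N(z)\\-\frac{2\pi\mathrm i}{h_{N-1}}P_{N-1}(z)&-\frac{2\pi\mathrm i}{h_{N-1}}\widehat P_{N-1}(z)\end{pmatrix},\qquad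 T=\begin{pmatrix}1&0\\0&\frac{h_{N-1}}{2\pi\mathrm i}\frac1{(\alpha+\beta+2N)(\alpha+\beta+2N-1)}\end{pmatrix}.$$ Matrix series: $$R^{[\infty]}(z)=\begin{pmatrix}1&0\\0&0\end{pmatrix}+\sum_{\ell\ge0}\frac{z^{-\ell-1}}{\alpha+\beta+2N}\begin{pmatrix}\ell A_\ell(N)&N(\alpha+N)(\beta+N)(\alpha+\beta+N)B_\ell(N+1)\\-B_\ell(N)&-\ell A_\ell(N)\end{pmatrix},$$ $$R^{[0]}(z)=\begin{pmatrix}1&0\\0&0\end{pmatrix}+\sum_{\ell\ge0}\frac{z^\ell}{\alpha+\beta+2N}\begin{pmatrix}(\ell+1)\widetilde A_\ell(N)&-N(\alpha+N)(\beta+N)(\alpha+\beta+N)\widetilde B_\ell(N+1)\\\widetilde B_\ell(N)&-(\ell+1)\widetilde A_\ell(N)\end{pmatrix},$$ where, with rising factorials $(s)_k=s(s+1)\cdots(s+k-1)$ and ${}_4F_3$ the generalized hypergeometric function (here terminating), $A_0(N)=\frac{N(\beta+N)}{\alpha+\beta+2N}$; $A_\ell(N)=\frac{N(\alpha+N)(\beta+N)(\alpha+\beta+N)(\alpha+2)_{\ell-1}}{(\alpha+\beta+2N-1)_{\ell+2}}\,{}_4F_3\!\left(\begin{smallmatrix}1-\ell,\ \ell+2,\ 1-\beta-N,\ 1-N\\2,\ \alpha+2,\ 2-\alpha-\beta-2N\end{smallmatrix}\Big|1\right)$ for $\ell\ge1$; $B_\ell(N)=\frac{(\alpha+1)_\ell}{(\alpha+\beta+2N-1)_{\ell+1}}\,{}_4F_3\!\left(\begin{smallmatrix}-\ell,\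 \ell+1,\ 1-\beta-N,\ 1-N\\1,\ \alpha+1,\ 2-\alpha-\beta-2N\end{smallmatrix}\Big|1\right)$ for $\ell\ge0$; $\widetilde A_\ell(N)=\frac{(\alpha+\beta+2N-\ell)_{2\ell+1}}{(\alpha-\ell)_{2\ell+1}}A_\ell(N)$ and $\widetilde B_\ell(N)=\frac{(\alpha+\beta+2N-1-\ell)_{2\ell+1}}{(\alpha-\ell)_{2\ell+1}}B_\ell(N)$ for $\ell\ge0$.
   Formalization: At z=0 the asymptotic expansion is asserted only up to orders z^n with n < Re α: R(z) contains a term of exact order z^α, so it fails at higher orders (e.g. N=1, α=-1/2, β=0), and for integer α the coefficients with ℓ ≥ α are undefined. *)

theory Defs
  imports "HOL-Analysis.Analysis" "HOL-Library.Landau_Symbols"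
begin

definition mat22 :: "complex \<Rightarrow> complex \<Rightarrow> complex \<Rightarrow> complex \<Rightarrow> complex^2^2" where
  "mat22 a b c d = vector [vector [a, b], vector [c, d]]"

definition scale_mat :: "complex \<Rightarrow> complex^2^2 \<Rightarrow> complex^2^2" where
  "scale_mat c A = (\<chi> i j. c * A $ i $ j)"

definition E11 :: "complex^2^2" where
  "E11 = mat22 1 0 0 0"


definition jacobi_weight :: "complex \<Rightarrow> complex \<Rightarrow> real \<Rightarrow> complex" where
  "jacobi_weight \<alpha> \<beta> x = of_real x powr \<alpha> * of_real (1 - x) powr \<beta>"

text \<open>
  For \<open>l = 0\<close> the factors \<open>\<Gamma>(\<alpha> + \<beta> + l + 1)\<close> and \<open>\<Gamma>(\<alpha> + \<beta> + 2 l + 1)\<close> of the norming constant are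
  equal and cancel. They are cancelled explicitly because \<open>Gamma\<close> is 0 at its poles, so at
  \<open>\<alpha> + \<beta> = -1\<close> their quotient would be \<open>0 / 0 = 0\<close> instead of 1.
\<close>
definition jacobi_h :: "complex \<Rightarrow> complex \<Rightarrow> nat \<Rightarrow> complex" where
  "jacobi_h \<alpha> \<beta> l =
     fact l * Gamma (\<alpha> + of_nat l + 1) * Gamma (\<beta> + of_nat l + 1) *
     (if l = 0 then 1
      else Gamma (\<alpha> + \<beta> + of_nat l + 1) / Gamma (\<alpha> + \<beta> + 2 * of_nat l + 1)) /
     Gamma (\<alpha> + \<beta> + 2 * of_nat l + 2)"

definition monic_jacobi :: "complex \<Rightarrow> complex \<Rightarrow> (nat \<Rightarrow> complex poly) \<Rightarrow> bool" where
  "monic_jacobi \<alpha> \<beta> P \<longleftrightarrow>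
     (\<forall>l. degree (P l) = l \<and> lead_coeff (P l) = 1) \<and>
     (\<forall>l m. ((\<lambda>x. poly (P l) (of_real x) * poly (P m) (of_real x) * jacobi_weight \<alpha> \<beta> x)
               has_integral (if l = m then jacobi_h \<alpha> \<beta> l else 0)) {0..1})"

definition cauchy_transform :: "complex \<Rightarrow> complex \<Rightarrow> complex poly \<Rightarrow> complex \<Rightarrow> complex" where
  "cauchy_transform \<alpha> \<beta> p z =
     1 / (2 * of_real pi * \<i>) *
     integral {0..1} (\<lambda>x. poly p (of_real x) * jacobi_weight \<alpha> \<beta> x / (of_real x - z))"

definition jacobi_Y ::
    "complex \<Rightarrow> complex \<Rightarrow> (nat \<Rightarrow> complex poly) \<Rightarrow> nat \<Rightarrow> complex \<Rightarrow> complex^2^2" where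
  "jacobi_Y \<alpha> \<beta> P N z =
     (let c = - (2 * of_real pi * \<i>) / jacobi_h \<alpha> \<beta> (N - 1) in
      mat22 (poly (P N) z) (cauchy_transform \<alpha> \<beta> (P N) z)
            (c * poly (P (N - 1)) z) (c * cauchy_transform \<alpha> \<beta> (P (N - 1)) z))"

definition jacobi_R ::
    "complex \<Rightarrow> complex \<Rightarrow> (nat \<Rightarrow> complex poly) \<Rightarrow> nat \<Rightarrow> complex \<Rightarrow> complex^2^2" where
  "jacobi_R \<alpha> \<beta> P N z = jacobi_Y \<alpha> \<beta> P N z ** E11 ** matrix_inv (jacobi_Y \<alpha> \<beta> P N z)"

definition jacobi_T :: "complex \<Rightarrow> complex \<Rightarrow> nat \<Rightarrow> complex^2^2" where
  "jacobi_T \<alpha> \<beta> N =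
     mat22 1 0
           0 (jacobi_h \<alpha> \<beta> (N - 1) / (2 * of_real pi * \<i>) *
              (1 / ((\<alpha> + \<beta> + 2 * of_nat N) * (\<alpha> + \<beta> + 2 * of_nat N - 1))))"


text \<open>
  All the series \<open>\<^sub>4F\<^sub>3\<close> below terminate, since \<open>1 - N\<close> is an upper parameter. No factor of a
  denominator vanishes before termination; after it the summands are 0 by \<open>0 / x = 0\<close>.
\<close>
definition hypergeo_4F3 :: "complex list \<Rightarrow> complex list \<Rightarrow> complex \<Rightarrow> complex" where
  "hypergeo_4F3 as bs z = eval_fps (fps_hypergeo as bs 1) z"

definition jacobi_A :: "complex \<Rightarrow> complex \<Rightarrow> nat \<Rightarrow> nat \<Rightarrow> complex" where
  "jacobi_A \<alpha> \<beta> N l =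
     (if l = 0 then of_nat N * (\<beta> + of_nat N) / (\<alpha> + \<beta> + 2 * of_nat N)
      else of_nat N * (\<alpha> + of_nat N) * (\<beta> + of_nat N) * (\<alpha> + \<beta> + of_nat N) *
           pochhammer (\<alpha> + 2) (l - 1) / pochhammer (\<alpha> + \<beta> + 2 * of_nat N - 1) (l + 2) *
           hypergeo_4F3 [1 - of_nat l, of_nat l + 2, 1 - \<beta> - of_nat N, 1 - of_nat N]
                        [2, \<alpha> + 2, 2 - \<alpha> - \<beta> - 2 * of_nat N] 1)"

definition jacobi_B :: "complex \<Rightarrow> complex \<Rightarrow> nat \<Rightarrow> nat \<Rightarrow> complex" where
  "jacobi_B \<alpha> \<beta> N l =
     pochhammer (\<alpha> + 1) l / pochhammer (\<alpha> + \<beta> + 2 * of_nat N - 1) (l + 1) *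
     hypergeo_4F3 [- of_nat l, of_nat l + 1, 1 - \<beta> - of_nat N, 1 - of_nat N]
                  [1, \<alpha> + 1, 2 - \<alpha> - \<beta> - 2 * of_nat N] 1"

definition jacobi_A_tilde :: "complex \<Rightarrow> complex \<Rightarrow> nat \<Rightarrow> nat \<Rightarrow> complex" where
  "jacobi_A_tilde \<alpha> \<beta> N l =
     pochhammer (\<alpha> + \<beta> + 2 * of_nat N - of_nat l) (2 * l + 1) /
     pochhammer (\<alpha> - of_nat l) (2 * l + 1) * jacobi_A \<alpha> \<beta> N l"

definition jacobi_B_tilde :: "complex \<Rightarrow> complex \<Rightarrow> nat \<Rightarrow> nat \<Rightarrow> complex" where
  "jacobi_B_tilde \<alpha> \<beta> N l =
     pochhammer (\<alpha> + \<beta> + 2 * of_nat N - 1 - of_nat l) (2 * l + 1) /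
     pochhammer (\<alpha> - of_nat l) (2 * l + 1) * jacobi_B \<alpha> \<beta> N l"

definition R_inf_coeff :: "complex \<Rightarrow> complex \<Rightarrow> nat \<Rightarrow> nat \<Rightarrow> complex^2^2" where
  "R_inf_coeff \<alpha> \<beta> N l =
     scale_mat (1 / (\<alpha> + \<beta> + 2 * of_nat N))
       (mat22 (of_nat l * jacobi_A \<alpha> \<beta> N l)
              (of_nat N * (\<alpha> + of_nat N) * (\<beta> + of_nat N) * (\<alpha> + \<beta> + of_nat N) *
               jacobi_B \<alpha> \<beta> (N + 1) l)
              (- jacobi_B \<alpha> \<beta> N l)
              (- (of_nat l * jacobi_A \<alpha> \<beta> N l)))"

definition R_zero_coeff :: "complex \<Rightarrow> complex \<Rightarrow> nat \<Rightarrow> nat \<Rightarrow> complex^2^2" where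
  "R_zero_coeff \<alpha> \<beta> N l =
     scale_mat (1 / (\<alpha> + \<beta> + 2 * of_nat N))
       (mat22 (of_nat (l + 1) * jacobi_A_tilde \<alpha> \<beta> N l)
              (- (of_nat N * (\<alpha> + of_nat N) * (\<beta> + of_nat N) * (\<alpha> + \<beta> + of_nat N) *
                  jacobi_B_tilde \<alpha> \<beta> (N + 1) l))
              (jacobi_B_tilde \<alpha> \<beta> N l)
              (- (of_nat (l + 1) * jacobi_A_tilde \<alpha> \<beta> N l)))"

definition R_inf_term :: "complex \<Rightarrow> complex \<Rightarrow> nat \<Rightarrow> complex \<Rightarrow> nat \<Rightarrow> complex^2^2" where
  "R_inf_term \<alpha> \<beta> N z l = scale_mat (1 / z ^ (l + 1)) (R_inf_coeff \<alpha> \<beta> N l)"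

definition R_inf :: "complex \<Rightarrow> complex \<Rightarrow> nat \<Rightarrow> complex \<Rightarrow> complex^2^2" where
  "R_inf \<alpha> \<beta> N z = E11 + (\<Sum>l. R_inf_term \<alpha> \<beta> N z l)"

text \<open>
  The formal series at 0, truncated after the power \<open>z ^ n\<close>. Its coefficients have
  \<open>(\<alpha> - l)\<^sub>2\<^sub>l\<^sub>+\<^sub>1\<close> in the denominator, which does not vanish for \<open>l \<le> n < Re \<alpha>\<close>.
\<close>
definition R_zero_trunc :: "complex \<Rightarrow> complex \<Rightarrow> nat \<Rightarrow> nat \<Rightarrow> complex \<Rightarrow> complex^2^2" where
  "R_zero_trunc \<alpha> \<beta> N n z = E11 + (\<Sum>l\<le>n. scale_mat (z ^ l) (R_zero_coeff \<alpha> \<beta> N l))"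

text \<open>
  The Poincare expansion \<open>R \<sim> T\<^sup>-\<^sup>1 R\<^sup>[\<^sup>0\<^sup>] T\<close>, to order \<open>n\<close>, uniformly in the full sector. Near
  0 the Cauchy transforms also contain a non-analytic part of exact order \<open>z powr \<alpha>\<close> (with a
  logarithm if \<open>\<alpha>\<close> is an integer), so that this holds precisely at the orders \<open>n < Re \<alpha>\<close>.
\<close>
definition poincare_at_zero ::
    "complex \<Rightarrow> complex \<Rightarrow> (nat \<Rightarrow> complex poly) \<Rightarrow> nat \<Rightarrow> nat \<Rightarrow> bool" where
  "poincare_at_zero \<alpha> \<beta> P N n \<longleftrightarrow>
     (\<lambda>z. norm (jacobi_R \<alpha> \<beta> P N z -
                matrix_inv (jacobi_T \<alpha> \<beta> N) ** R_zero_trunc \<alpha> \<beta> N n z ** jacobi_T \<alpha> \<beta> N))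
       \<in> o[at 0 within {z. 0 < Arg2pi z \<and> Arg2pi z < 2 * pi}](\<lambda>z. norm z ^ n)"

end

theory Submission
  imports Defs
begin

text \<open>
  Dividing by \<open>x - z\<close> and using orthogonality, one finds that the entries of \<open>R(z)\<close> are, up to
  constants, the Cauchy transforms of \<open>P\<^sub>N\<^sup>2 w\<close>, \<open>P\<^sub>N P\<^sub>N\<^sub>-\<^sub>1 w\<close> and \<open>P\<^sub>N\<^sub>-\<^sub>1\<^sup>2 w\<close>,
  where \<open>w = x\<^sup>\<alpha> (1 - x)\<^sup>\<beta>\<close>. Expanding \<open>1 / (x - z)\<close> turns the coefficients at infinity into
  the moments of these densities with exponent \<open>l\<close> and those at 0 into the moments with exponent
  \<open>- l - 1\<close>. The moment of \<open>P\<^sub>n\<^sup>2 w\<close> with exponent \<open>k\<close> is a quotient of Gamma functions times a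
  polynomial in \<open>k\<close> of degree \<open>2 n\<close>. The differential equation for \<open>P\<^sub>n\<close> yields a three-term
  recurrence in \<open>k\<close> for this polynomial, which is the difference equation of the Wilson
  polynomials. Hence it is the stated hypergeometric sum, which is invariant under
  \<open>k \<mapsto> - 1 - k\<close>; this invariance relates the two expansions. The moments of \<open>P\<^sub>N P\<^sub>N\<^sub>-\<^sub>1 w\<close>
  reduce to those of \<open>P\<^sub>N\<^sup>2 w\<close> since \<open>x (1 - x) P\<^sub>N'\<close> is a combination of \<open>P\<^sub>N\<close>, \<open>x P\<^sub>N\<close>
  and \<open>P\<^sub>N\<^sub>-\<^sub>1\<close>.
\<close>

subsection \<open>Wilson polynomials\<close>

text \<open>For complex exponents the pairing of polynomials has no positivity. Its nondegeneracy
  comes from the norms \<open>jacobi_h\<close>, none of which vanishes, and this replaces positivity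
  in the proofs of the differential equation and of the structure relation. What carries the result
  from infinity to 0 is that the moment formula is an identity of polynomials in the exponent
  \<open>k\<close>: it is established from finitely many \<open>k \<ge> 0\<close> and the leading
  coefficient, and then evaluated at negative integers. The Beta integral is likewise obtained from
  the norm of the constant polynomial by integer shifts of the exponent. The analytic difficulty is
  uniformity up to the cut: for \<open>n < Re \<alpha>\<close> the remainder at 0 is
  \<open>z ^ (n + 1)\<close> times a Cauchy transform whose exponent at 0 is only known to have real
  part above -1, so it may be unbounded. A bound of \<open>z\<close> times this transform that
  depends on \<open>norm z\<close> alone avoids any analysis of its non-analytic part.\<close>

definition wilson_basis :: "nat \<Rightarrow> complex \<Rightarrow> complex" where
  "wilson_basis i k = pochhammer (- k) i * pochhammer (k + 1) i"

lemma wilson_basis_0 [simp]: "wilson_basis 0 k = 1"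
  by (simp add: wilson_basis_def)

lemma wilson_basis_Suc: "wilson_basis (Suc i) k = - ((k - of_nat i) * (k + of_nat i + 1)) * wilson_basis i k"
  by (simp add: wilson_basis_def pochhammer_Suc algebra_simps)

lemma wilson_basis_Suc_plus1:
  "wilson_basis (Suc i) (k + 1) = - ((k + of_nat i + 1) * (k + of_nat i + 2)) * wilson_basis i k"
proof -
  have a: "pochhammer (- (k + 1)) (Suc i) = - (k + 1) * pochhammer (- k) i"
    by (simp add: pochhammer_rec)
  have b: "(k + 1) * pochhammer (k + 2) i = pochhammer (k + 1) i * (k + 1 + of_nat i)"
    using pochhammer_rec[of "k + 1" i] pochhammer_Suc[of "k + 1" i] by (simp add: add.assoc)
  have c: "pochhammer (k + 1 + 1) (Suc i) = pochhammer (k + 2) i * (k + 2 + of_nat i)"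
    by (simp add: pochhammer_Suc add.assoc)
  show ?thesis unfolding wilson_basis_def a c using b by algebra
qed

lemma wilson_basis_reflect: "wilson_basis i (- 1 - k) = wilson_basis i k"
  by (simp add: wilson_basis_def mult.commute add.commute)

lemma wilson_basis_Suc_minus1:
  "wilson_basis (Suc i) (k - 1) = - ((k - of_nat i - 1) * (k - of_nat i)) * wilson_basis i k"
  using wilson_basis_Suc_plus1[of i "- 1 - k"] wilson_basis_reflect[of "Suc i" "k - 1"]
  by (simp add: wilson_basis_reflect algebra_simps)

text \<open>The part of the \<open>i\<close>-th summand of the series in \<open>jacobi_B\<close> at
  \<open>Suc n\<close> that is free of the exponent; the lower parameter 1 and the factorial
  together give \<open>fact i ^ 2\<close>.\<close>

definition wilson_coeff :: "complex \<Rightarrow> complex \<Rightarrow> nat \<Rightarrow> nat \<Rightarrow> complex" where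
  "wilson_coeff \<alpha> \<beta> n i =
     pochhammer (- \<beta> - of_nat n) i * pochhammer (- of_nat n) i /
     (fact i ^ 2 * pochhammer (\<alpha> + 1) i * pochhammer (- \<alpha> - \<beta> - 2 * of_nat n) i)"

text \<open>The series of \<open>jacobi_B\<close> at \<open>Suc n\<close> with the integer
  \<open>l\<close> replaced by a complex \<open>k\<close>: a polynomial in
  \<open>k * (k + 1)\<close>, hence defined at negative exponents too.\<close>

definition wilson :: "complex \<Rightarrow> complex \<Rightarrow> nat \<Rightarrow> complex \<Rightarrow> complex" where
  "wilson \<alpha> \<beta> n k = (\<Sum>i\<le>n. wilson_coeff \<alpha> \<beta> n i * wilson_basis i k)"

lemma wilson_reflect: "wilson \<alpha> \<beta> n (- 1 - k) = wilson \<alpha> \<beta> n k"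
  by (simp add: wilson_def wilson_basis_reflect)

lemma add_of_nat_neq_0:
  fixes a :: complex
  assumes "Re a > - 1" "i > 0"
  shows "a + of_nat i \<noteq> 0"
proof
  assume "a + of_nat i = 0"
  hence "Re a + real i = 0" by (metis Re_complex_of_real of_real_of_nat_eq plus_complex.sel(1) zero_complex.sel(1))
  thus False using assms by auto
qed

lemma wilson_coeff_Suc:
  assumes "Re \<alpha> > - 1" "Re \<beta> > - 1" "i < n"
    and "\<alpha> + \<beta> + 2 * of_nat n \<noteq> of_nat i"
  shows "wilson_coeff \<alpha> \<beta> n (Suc i) *
           (of_nat (Suc i) ^ 2 * (\<alpha> + of_nat (Suc i)) * (of_nat i - (\<alpha> + \<beta> + 2 * of_nat n))) =
         wilson_coeff \<alpha> \<beta> n i * ((of_nat i - \<beta> - of_nat n) * (of_nat i - of_nat n))"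
proof -
  have 1: "\<alpha> + of_nat (Suc i) \<noteq> 0" using add_of_nat_neq_0[of \<alpha> "Suc i"] assms by simp
  have 2: "of_nat i - (\<alpha> + \<beta> + 2 * of_nat n) \<noteq> 0" using assms(4) by auto
  have 3: "(of_nat (Suc i) :: complex) \<noteq> 0" by (simp del: of_nat_Suc)
  have e: "wilson_coeff \<alpha> \<beta> n (Suc i) =
     wilson_coeff \<alpha> \<beta> n i * ((of_nat i - \<beta> - of_nat n) * (of_nat i - of_nat n)) /
     (of_nat (Suc i) ^ 2 * (\<alpha> + of_nat (Suc i)) * (of_nat i - (\<alpha> + \<beta> + 2 * of_nat n)))"
  proof -
    have "- \<beta> - of_nat n + of_nat i = of_nat i - \<beta> - of_nat n" "- of_nat n + of_nat i = (of_nat i - of_nat n :: complex)"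
      "\<alpha> + 1 + of_nat i = \<alpha> + of_nat (Suc i)"
      "- \<alpha> - \<beta> - 2 * of_nat n + of_nat i = of_nat i - (\<alpha> + \<beta> + 2 * of_nat n)"
      by simp_all
    thus ?thesis unfolding wilson_coeff_def pochhammer_Suc fact_Suc power_mult_distrib of_nat_mult of_nat_fact
      by (simp only: times_divide_times_eq times_divide_eq_left times_divide_eq_right divide_divide_eq_left mult_ac)
  qed
  show ?thesis unfolding e using 1 2 3 by simp
qed

text \<open>For \<open>n \<ge> 2\<close> the real part of the left side exceeds
  \<open>2 * n - 2 \<ge> n\<close>, so a coincidence is possible only for
  \<open>n = 1\<close>.\<close>

lemma wilson_param_neq:
  assumes "Re \<alpha> > - 1" "Re \<beta> > - 1" "i \<le> n" "n = 1 \<longrightarrow> \<alpha> + \<beta> + 2 * of_nat n \<noteq> of_nat i" "n > 0"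
  shows "\<alpha> + \<beta> + 2 * of_nat n \<noteq> of_nat i"
proof (cases "n = 1")
  case False
  show ?thesis
  proof
    assume "\<alpha> + \<beta> + 2 * of_nat n = of_nat i"
    hence "Re (\<alpha> + \<beta> + 2 * of_nat n) = Re (of_nat i)" by simp
    hence "Re \<alpha> + Re \<beta> + 2 * real n = real i" by simp
    moreover have "real i \<le> 2 * real n - 2" using assms False by linarith
    ultimately show False using assms by linarith
  qed
qed (use assms in auto)

text \<open>The middle coefficient that \<open>jacobi_square_recurrence\<close> produces when the
  moments containing derivatives are eliminated.\<close>

definition wilson_middle :: "complex \<Rightarrow> complex \<Rightarrow> nat \<Rightarrow> complex \<Rightarrow> complex" where
  "wilson_middle \<alpha> \<beta> n k =
     2 * (of_nat n * (of_nat n + \<alpha> + \<beta> + 1)) * (2 * k + 1) -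
     ((k - \<alpha>) * k * (k + 1 + \<alpha> + \<beta>) + (k - \<alpha> - \<beta>) * (k + 1) * (k + 1 + \<alpha>))"

text \<open>The recurrence of \<open>jacobi_square_recurrence\<close> after the Gamma quotient is
  divided out of the moments. With \<sigma> = \<alpha> + \<beta> + 2 n + 1 this replaces the factor
  k + \<alpha> of the first coefficient by k + \<sigma>, and k + 1 + \<sigma> of the last by k + 1 +
  \<alpha>.\<close>

definition wilson_op :: "complex \<Rightarrow> complex \<Rightarrow> nat \<Rightarrow> (complex \<Rightarrow> complex) \<Rightarrow> complex \<Rightarrow> complex" where
  "wilson_op \<alpha> \<beta> n f k =
     k * (k - \<alpha>) * (k + (\<alpha> + \<beta> + 2 * of_nat n + 1)) * f (k - 1) + wilson_middle \<alpha> \<beta> n k * f k +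
     (k + 1) * (k + 1 + \<alpha>) * (k + 1 - (\<alpha> + \<beta> + 2 * of_nat n + 1)) * f (k + 1)"

lemma wilson_op_basis_0:
  "wilson_op \<alpha> \<beta> n (wilson_basis 0) k = (2 * k + 1) * (2 * of_nat n * (of_nat n + \<beta>))"
  unfolding wilson_op_def wilson_middle_def wilson_basis_0 by algebra

text \<open>Both shifts of the element \<open>Suc i\<close>, and the element itself, are quadratic
  multiples of the unshifted element \<open>i\<close>, so this is a polynomial identity. The second
  coefficient contains the factor of \<open>wilson_coeff_Suc\<close>, which makes neighbouring terms
  cancel.\<close>

lemma wilson_op_basis_Suc:
  "wilson_op \<alpha> \<beta> n (wilson_basis (Suc i)) k =
     (2 * k + 1) * (2 * (of_nat n - of_nat (Suc i)) * (of_nat n + \<beta> - of_nat (Suc i)) * wilson_basis (Suc i) k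
       - 2 * of_nat (Suc i) ^ 2 * (\<alpha> + of_nat (Suc i)) * (of_nat i - (\<alpha> + \<beta> + 2 * of_nat n)) * wilson_basis i k)"
  unfolding wilson_op_def wilson_middle_def wilson_basis_Suc_plus1 wilson_basis_Suc_minus1 
  unfolding wilson_basis_Suc of_nat_Suc
  by algebra

text \<open>
  On the basis the operator has the form \<open>\<phi>\<^sub>i \<mapsto> \<lambda>\<^sub>i \<phi>\<^sub>i + \<mu>\<^sub>i \<phi>\<^sub>i\<^sub>-\<^sub>1\<close> with \<open>\<lambda>\<^sub>n = 0\<close>,
  so the sum telescopes.
\<close>
lemma wilson_op_wilson:
  assumes "Re \<alpha> > - 1" "Re \<beta> > - 1" "n = 1 \<longrightarrow> \<alpha> + \<beta> + 2 * of_nat n \<noteq> 0"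
  shows "wilson_op \<alpha> \<beta> n (wilson \<alpha> \<beta> n) k = 0"
proof -
  let ?c = "wilson_coeff \<alpha> \<beta> n"
  have lin: "wilson_op \<alpha> \<beta> n (wilson \<alpha> \<beta> n) k = (\<Sum>i\<le>n. ?c i * wilson_op \<alpha> \<beta> n (wilson_basis i) k)"
    by (simp add: wilson_op_def wilson_def sum_distrib_left sum.distrib[symmetric] algebra_simps)
  have "(\<Sum>i\<le>m. ?c i * wilson_op \<alpha> \<beta> n (wilson_basis i) k) =
     (2 * k + 1) * ?c m * (2 * (of_nat n - of_nat m) * (of_nat n + \<beta> - of_nat m)) * wilson_basis m k"
    if "m \<le> n" for m
    using that
  proof (induction m)
    case 0
    show ?case by (simp add: wilson_op_basis_0 del: wilson_basis_0) (simp add: algebra_simps)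
  next
    case (Suc m)
    have "\<alpha> + \<beta> + 2 * of_nat n \<noteq> of_nat m"
      using wilson_param_neq[of \<alpha> \<beta> m n] assms Suc.prems by (cases "m = 0") auto
    note r = wilson_coeff_Suc[OF assms(1,2) _ this] 
    show ?case using Suc r
      by (simp only: sum.atMost_Suc wilson_op_basis_Suc Suc_leD Suc_le_eq) algebra
  qed
  from this[of n] lin show ?thesis by simp
qed

text \<open>The left side is what \<open>integral_product_eq_squares\<close> yields for the mixed
  moments. Since \<open>\<tau> 0 = 0\<close>, the sum on the right starts at 1, and shifting its
  index produces the parameters of the series in \<open>jacobi_A\<close>.\<close>

lemma wilson_shift_sum:
  assumes "Re \<alpha> > - 1" "Re \<beta> > - 1" "n > 0"
    and "n = 1 \<longrightarrow> \<alpha> + \<beta> + 2 * of_nat n \<noteq> 0"  "n = 1 \<longrightarrow> \<alpha> + \<beta> + 2 * of_nat n \<noteq> 1"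
  defines "s \<equiv> \<alpha> + \<beta> + 2 * of_nat n"
  defines "\<tau> \<equiv> \<lambda>i. 2 * (\<alpha> + of_nat n) * (\<alpha> + \<beta> + of_nat n) * of_nat i * wilson_coeff \<alpha> \<beta> n i / (s * (of_nat i - s))"
  shows "(k + 1) * ((k + 1 + \<alpha>) * wilson \<alpha> \<beta> n (k + 1)
            - (k + 1 + \<alpha> + 2 * (of_nat n * (\<beta> + of_nat n) / s)) * wilson \<alpha> \<beta> n k) =
         - (s + 1 + k) * (\<Sum>i\<le>n. \<tau> i * wilson_basis i k)"
proof -
  let ?c = "wilson_coeff \<alpha> \<beta> n"
  define e where "e = of_nat n * (\<beta> + of_nat n) / s"
  have neq: "s \<noteq> of_nat i" if "i \<le> n" for i
  proof -
    have "n = 1 \<longrightarrow> i = 0 \<or> i = 1" using that by auto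
    thus ?thesis unfolding s_def using wilson_param_neq[of \<alpha> \<beta> i n] assms(1-5) that by auto
  qed
  have s0: "s \<noteq> 0" using neq[of 0] by simp
  have se: "s * e = of_nat n * (\<beta> + of_nat n)" using s0 by (simp add: e_def)
  define T where "T = (\<lambda>i. (k + 1) * (?c i * ((k + 1 + \<alpha>) * wilson_basis i (k + 1)
            - (k + 1 + \<alpha> + 2 * e) * wilson_basis i k)) + (s + 1 + k) * (\<tau> i * wilson_basis i k))"
  \<comment> \<open>Closed form of the partial sums: by the ratio of consecutive coefficients
    \<open>g m\<close> also equals the multiple of the next coefficient that is needed to telescope,
    and the factor \<open>of_nat m - of_nat n\<close> makes \<open>g n\<close> vanish.\<close>
  define g where "g = (\<lambda>m. 2 * ?c m * (of_nat m - \<beta> - of_nat n) * (of_nat m - of_nat n) / (of_nat m - s))"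
  have part: "(\<Sum>i\<le>m. T i) = g m * (k + of_nat m + 1) * wilson_basis m k" if "m \<le> n" for m
    using that
  proof (induction m)
    case 0
    have "- 2 * (k + 1) * e = g 0 * (k + 1)" using s0
      by (simp add: g_def e_def wilson_coeff_def field_simps)
    thus ?case by (simp add: T_def \<tau>_def wilson_coeff_def algebra_simps)
  next
    case (Suc m)
    let ?j = "of_nat (Suc m) :: complex"
    have n1: "of_nat m - s \<noteq> 0" "?j - s \<noteq> 0" using neq[of m] neq[of "Suc m"] Suc.prems by auto
    have r: "?c (Suc m) * (?j ^ 2 * (\<alpha> + ?j) * (of_nat m - s)) = ?c m * ((of_nat m - \<beta> - of_nat n) * (of_nat m - of_nat n))"
      unfolding s_def by (rule wilson_coeff_Suc) (use assms(1,2) Suc.prems neq[of m] in \<open>auto simp: s_def\<close>)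
    have gm: "g m = 2 * ?j ^ 2 * (\<alpha> + ?j) * ?c (Suc m)"
    proof -
      have "g m * (of_nat m - s) = 2 * ?j ^ 2 * (\<alpha> + ?j) * ?c (Suc m) * (of_nat m - s)"
        using r n1(1) by (simp add: g_def) algebra
      thus ?thesis using n1(1) by simp
    qed
    have gS: "g (Suc m) = ?c (Suc m) * (2 * ?j - 2 * e) + \<tau> (Suc m)"
    proof -
      have "(g (Suc m) * (s * (?j - s))) = 2 * s * ?c (Suc m) * (?j - \<beta> - of_nat n) * (?j - of_nat n)"
        using n1(2) s0 by (simp add: g_def del: of_nat_Suc)
      moreover have "\<tau> (Suc m) * (s * (?j - s)) = 2 * (\<alpha> + of_nat n) * (\<alpha> + \<beta> + of_nat n) * ?j * ?c (Suc m)"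
        using n1(2) s0 by (simp add: \<tau>_def del: of_nat_Suc)
      moreover have "2 * s * ?c (Suc m) * (?j - \<beta> - of_nat n) * (?j - of_nat n) = 
        ?c (Suc m) * (2 * ?j - 2 * e) * (s * (?j - s)) + 2 * (\<alpha> + of_nat n) * (\<alpha> + \<beta> + of_nat n) * ?j * ?c (Suc m)"
        using se s_def by algebra
      ultimately have "g (Suc m) * (s * (?j - s)) = (?c (Suc m) * (2 * ?j - 2 * e) + \<tau> (Suc m)) * (s * (?j - s))"
        by (simp add: distrib_right del: of_nat_Suc)
      thus ?thesis using n1(2) s0 by (simp del: of_nat_Suc)
    qed
    have tau: "\<tau> (Suc m) * (?j - s) = 2 * ?j * (\<alpha> + e) * ?c (Suc m)"
    proof -
      have "\<tau> (Suc m) * (?j - s) * s = 2 * (\<alpha> + of_nat n) * (\<alpha> + \<beta> + of_nat n) * ?j * ?c (Suc m)"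
        using n1(2) s0 by (simp add: \<tau>_def del: of_nat_Suc)
      also have "\<dots> = 2 * ?j * (\<alpha> + e) * ?c (Suc m) * s"
        using se s_def by algebra
      finally show ?thesis using s0 by (simp del: of_nat_Suc)
    qed
    have IH: "(\<Sum>i\<le>m. T i) = g m * (k + of_nat m + 1) * wilson_basis m k" using Suc by simp
    have "T (Suc m) = (k + of_nat (Suc m) + 1) * g (Suc m) * wilson_basis (Suc m) k - g m * (k + of_nat m + 1) * wilson_basis m k"
      unfolding T_def wilson_basis_Suc_plus1
      using gm gS tau wilson_basis_Suc[of m k] unfolding of_nat_Suc
      by algebra
    thus ?case using IH by (simp add: algebra_simps)
  qed
  have "(\<Sum>i\<le>n. T i) = 0" using part[of n] by (simp add: g_def)
  moreover have "(\<Sum>i\<le>n. T i) = (k + 1) * ((k + 1 + \<alpha>) * wilson \<alpha> \<beta> n (k + 1) - (k + 1 + \<alpha> + 2 * e) * wilson \<alpha> \<beta> n k) +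
      (s + 1 + k) * (\<Sum>i\<le>n. \<tau> i * wilson_basis i k)"
    by (simp add: T_def wilson_def sum.distrib sum_distrib_left sum_subtractf algebra_simps)
  ultimately show ?thesis unfolding e_def by (simp add: algebra_simps)
qed

subsection \<open>Integrals against the Jacobi weight\<close>

lemma norm_of_real_powr: "0 \<le> t \<Longrightarrow> norm (complex_of_real t powr c) = t powr Re c"
  using norm_powr_real_powr[of "complex_of_real t" c] by simp

lemma norm_jacobi_weight:
  assumes "x \<in> {0..1}"
  shows "norm (jacobi_weight a b x) = x powr Re a * (1 - x) powr Re b"
proof -
  have "0 \<le> x" "0 \<le> 1 - x" using assms by auto
  thus ?thesis unfolding jacobi_weight_def norm_mult by (metis norm_of_real_powr)
qed

lemma jacobi_weight_plus_nat:
  "jacobi_weight (a + of_nat n) b x = of_real x ^ n * jacobi_weight a b x"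
\<comment> \<open>At \<open>x = 0\<close> both sides are 0, because \<open>0 powr a = 0\<close> for
  every \<open>a\<close>.\<close>
proof (cases "x = 0")
  case False
  hence "complex_of_real x powr (a + of_nat n) = of_real x powr a * of_real x ^ n"
    by (simp only: powr_add powr_complexpow of_real_eq_0_iff not_False_eq_True)
  thus ?thesis by (simp only: jacobi_weight_def mult_ac)
qed (simp add: jacobi_weight_def)

lemma integrable_jacobi_bound:
  fixes a b :: complex
  assumes "Re a > - 1" "Re b > - 1"
  shows "(\<lambda>x::real. x powr Re a * (1 - x) powr Re b) integrable_on {0..1}"
  using integrable_Beta'[of "Re a + 1" "Re b + 1"] assms by simp

text \<open>The weight is the restriction of a function holomorphic off its branch cuts, with
  logarithmic derivative a / x - b / (1 - x).\<close>

lemma has_field_derivative_jacobi: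
  assumes "x \<in> {0<..<1}" "(f has_field_derivative f') (at (of_real x))"
  shows "((\<lambda>x. f (of_real x) * jacobi_weight a b x) has_vector_derivative
     (f' + f (of_real x) * (a / of_real x - b / (1 - of_real x))) * jacobi_weight a b x) (at x)"
proof -
  define g where "g = (\<lambda>w::complex. f w * (w powr a * (1 - w) powr b))"
  have nz: "complex_of_real x \<noteq> 0" "1 - complex_of_real x \<noteq> 0"
    using assms(1) of_real_eq_iff[of x 1] by auto
  have "complex_of_real x \<notin> \<real>\<^sub>\<le>\<^sub>0" "1 - complex_of_real x \<notin> \<real>\<^sub>\<le>\<^sub>0"
    using assms(1) by (auto simp: complex_nonpos_Reals_iff)
  hence "(g has_field_derivative f' * (of_real x powr a * (1 - of_real x) powr b) +
      f (of_real x) * (a * of_real x powr (a - 1) * (1 - of_real x) powr b -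
        of_real x powr a * (b * (1 - of_real x) powr (b - 1)))) (at (of_real x))"
    unfolding g_def by (auto intro!: derivative_eq_intros assms(2) simp: algebra_simps)
  also have "f' * (of_real x powr a * (1 - of_real x) powr b) +
      f (of_real x) * (a * of_real x powr (a - 1) * (1 - of_real x) powr b -
        of_real x powr a * (b * (1 - of_real x) powr (b - 1))) = 
      (f' + f (of_real x) * (a / of_real x - b / (1 - of_real x))) * jacobi_weight a b x"
    using nz by (simp add: jacobi_weight_def powr_diff field_simps)
  finally have "((\<lambda>x. g (of_real x)) has_vector_derivative
      (f' + f (of_real x) * (a / of_real x - b / (1 - of_real x))) * jacobi_weight a b x) (at x)"
    by (rule has_vector_derivative_real_field)
  thus ?thesis by (simp add: g_def jacobi_weight_def)
qed

lemma continuous_on_jacobi_weight: "continuous_on {0<..<1} (jacobi_weight a b)"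
proof (rule continuous_at_imp_continuous_on, rule ballI)
  fix x :: real assume "x \<in> {0<..<1}"
  from has_field_derivative_jacobi[OF this DERIV_const, of 1 a b]
  show "isCont (jacobi_weight a b) x"
    by (auto dest: has_vector_derivative_continuous)
qed

lemma continuous_on_jacobi_weight_closed:
  assumes "Re a > 0" "Re b > 0"
  shows "continuous_on {0..1} (jacobi_weight a b)"
  unfolding jacobi_weight_def by (intro continuous_intros) (use assms in auto)

text \<open>The weight is continuous on the open interval only, so measurability is shown there; the
  real Beta density is the majorant.\<close>

lemma absolutely_integrable_jacobi:
  assumes "Re a > - 1" "Re b > - 1" "continuous_on {0<..<1} g" "\<And>x. x \<in> {0<..<1} \<Longrightarrow> norm (g x) \<le> C"
  shows "(\<lambda>x. g x * jacobi_weight a b x) absolutely_integrable_on {0..1}"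
  unfolding absolutely_integrable_on_Icc_iff_Ioo
proof (rule measurable_bounded_by_integrable_imp_absolutely_integrable)
  show "(\<lambda>x. g x * jacobi_weight a b x) \<in> borel_measurable (lebesgue_on {0<..<1})"
    by (intro continuous_imp_measurable_on_sets_lebesgue continuous_intros assms continuous_on_jacobi_weight) auto
  show "(\<lambda>x. C * (x powr Re a * (1 - x) powr Re b)) integrable_on {0<..<1}"
    using integrable_on_mult_right[OF integrable_jacobi_bound[OF assms(1,2)], of C]
    by (simp add: integrable_on_Icc_iff_Ioo)
  show "norm (g x * jacobi_weight a b x) \<le> C * (x powr Re a * (1 - x) powr Re b)" if "x \<in> {0<..<1}" for x
    using that assms(4)[of x] by (simp add: norm_mult norm_jacobi_weight mult_right_mono)
qed auto

lemma absolutely_integrable_jacobi_poly: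
  assumes "Re a > - 1" "Re b > - 1" "continuous_on {0..1} g"
  shows "(\<lambda>x. poly F (of_real x) * g x * jacobi_weight a b x) absolutely_integrable_on {0..1}"
proof -
  have c: "continuous_on {0..1} (\<lambda>x::real. poly F (of_real x) * g x)"
    by (intro continuous_intros assms)
  then obtain C where "\<forall>x\<in>{0..1}. norm (poly F (of_real x) * g x) \<le> C"
    using compact_continuous_image[OF c] compact_imp_bounded[of "(\<lambda>x. poly F (of_real x) * g x) ` {0..1}"]
    unfolding bounded_iff ball_simps by blast
  thus ?thesis
    by (intro absolutely_integrable_jacobi[of a b _ C] assms continuous_on_subset[OF c]) auto
qed

text \<open>The exponents stay variable because a moment is an integral with shifted
  \<open>a\<close>, for negative shifts as well.\<close>

definition jacobi_integral :: "complex \<Rightarrow> complex \<Rightarrow> complex poly \<Rightarrow> complex" where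
  "jacobi_integral a b F = integral {0..1} (\<lambda>x. poly F (of_real x) * jacobi_weight a b x)"

lemma has_integral_jacobi:
  assumes "Re a > - 1" "Re b > - 1"
  shows "((\<lambda>x. poly F (of_real x) * jacobi_weight a b x) has_integral jacobi_integral a b F) {0..1}"
  using integrable_integral[OF set_lebesgue_integral_eq_integral(1)[OF
      absolutely_integrable_jacobi_poly[OF assms, of "\<lambda>_. 1" F]]]
  by (simp add: jacobi_integral_def)

lemma jacobi_integralI:
  "((\<lambda>x. poly F (of_real x) * jacobi_weight a b x) has_integral I) {0..1} \<Longrightarrow> jacobi_integral a b F = I"
  unfolding jacobi_integral_def by (rule integral_unique)

lemma jacobi_integral_add:
  assumes "Re a > - 1" "Re b > - 1"
  shows "jacobi_integral a b (F + G) = jacobi_integral a b F + jacobi_integral a b G"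
  using has_integral_add[OF has_integral_jacobi[OF assms, of F] has_integral_jacobi[OF assms, of G]]
  by (intro jacobi_integralI) (simp add: algebra_simps)

lemma jacobi_integral_smult:
  assumes "Re a > - 1" "Re b > - 1"
  shows "jacobi_integral a b (smult c F) = c * jacobi_integral a b F"
  using has_integral_mult_right[OF has_integral_jacobi[OF assms, of F], of c]
  by (intro jacobi_integralI) (simp add: algebra_simps)

lemma jacobi_integral_0 [simp]: "jacobi_integral a b 0 = 0"
  by (simp add: jacobi_integral_def)

lemma jacobi_integral_uminus:
  assumes "Re a > - 1" "Re b > - 1"
  shows "jacobi_integral a b (- F) = - jacobi_integral a b F"
  using jacobi_integral_smult[OF assms, of "- 1" F] by simp

lemma jacobi_integral_diff:
  assumes "Re a > - 1" "Re b > - 1"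
  shows "jacobi_integral a b (F - G) = jacobi_integral a b F - jacobi_integral a b G"
  using jacobi_integral_add[OF assms, of F "- G"] jacobi_integral_uminus[OF assms, of G] by simp

lemma jacobi_integral_sum:
  assumes "Re a > - 1" "Re b > - 1"
  shows "jacobi_integral a b (\<Sum>i\<in>A. F i) = (\<Sum>i\<in>A. jacobi_integral a b (F i))"
  by (induction A rule: infinite_finite_induct) (simp_all add: jacobi_integral_add assms)

lemma jacobi_integral_plus_nat: "jacobi_integral (a + of_nat n) b F = jacobi_integral a b (monom 1 n * F)"
  unfolding jacobi_integral_def
  by (rule Henstock_Kurzweil_Integration.integral_cong)
     (simp add: jacobi_weight_plus_nat poly_monom)

text \<open>The integrand is the derivative of \<open>F\<close> times the weight with exponents
  \<open>a + 1\<close> and \<open>b + 1\<close>, which is continuous up to the endpoints. All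
  recurrences for integrals rest on this identity.\<close>

lemma jacobi_integral_by_parts:
  assumes "Re a > - 1" "Re b > - 1"
  shows "jacobi_integral a b ([:a + 1, - (a + b + 2):] * F + [:0, 1, - 1:] * pderiv F) = 0"
proof -
  let ?f = "\<lambda>x::real. poly F (of_real x) * jacobi_weight (a + 1) (b + 1) x"
  have "((\<lambda>x. poly ([:a + 1, - (a + b + 2):] * F + [:0, 1, - 1:] * pderiv F) (of_real x) * jacobi_weight a b x)
      has_integral ?f 1 - ?f 0) {0..1}"
  proof (rule fundamental_theorem_of_calculus_interior)
    show "continuous_on {0..1} ?f"
      by (intro continuous_intros continuous_on_jacobi_weight_closed) (use assms in auto)
  next
    fix x :: real assume x: "x \<in> {0<..<1}"
    have nz: "complex_of_real x \<noteq> 0" "1 - complex_of_real x \<noteq> 0"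
      using x of_real_eq_iff[of x 1] by auto
    have "jacobi_weight (a + 1) (b + 1) x = of_real x * (1 - of_real x) * jacobi_weight a b x"
      using nz by (simp add: jacobi_weight_def powr_add)
    hence "(poly (pderiv F) (of_real x) + poly F (of_real x) * ((a + 1) / of_real x - (b + 1) / (1 - of_real x))) *
        jacobi_weight (a + 1) (b + 1) x =
        (poly (pderiv F) (of_real x) + poly F (of_real x) * ((a + 1) / of_real x - (b + 1) / (1 - of_real x))) *
        (of_real x * (1 - of_real x)) * jacobi_weight a b x" by (simp add: mult_ac)
    also have "(poly (pderiv F) (of_real x) + poly F (of_real x) * ((a + 1) / of_real x - (b + 1) / (1 - of_real x))) *
        (of_real x * (1 - of_real x)) = poly ([:a + 1, - (a + b + 2):] * F + [:0, 1, - 1:] * pderiv F) (of_real x)"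
    proof -
      have "((a + 1) / of_real x - (b + 1) / (1 - of_real x)) * (of_real x * (1 - of_real x)) = 
        (a + 1) * (1 - of_real x) - (b + 1) * of_real x"
        using nz by (simp add: field_simps)
      thus ?thesis unfolding poly_add poly_mult poly_pCons poly_0 by algebra
    qed
    finally show "(?f has_vector_derivative poly ([:a + 1, - (a + b + 2):] * F + [:0, 1, - 1:] * pderiv F) (of_real x)
        * jacobi_weight a b x) (at x)"
      using has_field_derivative_jacobi[OF x poly_DERIV, of F "a + 1" "b + 1"] by simp
  qed auto
  \<comment> \<open>The boundary values vanish since a power with base 0 is 0.\<close>
  thus ?thesis using assms by (intro jacobi_integralI) (simp add: jacobi_weight_def)
qed

subsection \<open>Cauchy transforms\<close>

definition jacobi_cauchy :: "complex \<Rightarrow> complex \<Rightarrow> complex poly \<Rightarrow> complex \<Rightarrow> complex" where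
  "jacobi_cauchy a b F z = integral {0..1} (\<lambda>x. poly F (of_real x) * (1 / (of_real x - z)) * jacobi_weight a b x)"

lemma cauchy_transform_eq: "cauchy_transform a b F z = jacobi_cauchy a b F z / (2 * of_real pi * \<i>)"
  by (simp add: cauchy_transform_def jacobi_cauchy_def)

lemma continuous_on_cauchy_kernel:
  fixes z :: complex
  assumes "z \<notin> of_real ` {0..1}"
  shows "continuous_on {0..1::real} (\<lambda>x. 1 / (of_real x - z))"
  by (intro continuous_intros) (use assms in auto)

lemma has_integral_jacobi_cauchy:
  assumes "Re a > - 1" "Re b > - 1" "z \<notin> of_real ` {0..1}"
  shows "((\<lambda>x. poly F (of_real x) * (1 / (of_real x - z)) * jacobi_weight a b x) has_integral jacobi_cauchy a b F z) {0..1}"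
  using integrable_integral[OF set_lebesgue_integral_eq_integral(1)[OF
      absolutely_integrable_jacobi_poly[OF assms(1,2) continuous_on_cauchy_kernel[OF assms(3)], of F]]]
  by (simp add: jacobi_cauchy_def)

lemma jacobi_cauchyI:
  "((\<lambda>x. poly F (of_real x) * (1 / (of_real x - z)) * jacobi_weight a b x) has_integral I) {0..1} \<Longrightarrow>
     jacobi_cauchy a b F z = I"
  unfolding jacobi_cauchy_def by (rule integral_unique)

lemma jacobi_cauchy_split:
  assumes "Re a > - 1" "Re b > - 1" "z \<notin> of_real ` {0..1}"
  shows "jacobi_cauchy a b (G + [:- z, 1:] * H) z = jacobi_cauchy a b G z + jacobi_integral a b H"
proof (rule jacobi_cauchyI, rule has_integral_eq)
  show "((\<lambda>x. poly G (of_real x) * (1 / (of_real x - z)) * jacobi_weight a b x + poly H (of_real x) * jacobi_weight a b x) 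
     has_integral jacobi_cauchy a b G z + jacobi_integral a b H) {0..1}"
    by (intro has_integral_add has_integral_jacobi has_integral_jacobi_cauchy assms)
  fix x :: real assume "x \<in> {0..1}"
  hence "of_real x - z \<noteq> 0" using assms(3) by auto
  thus "poly G (of_real x) * (1 / (of_real x - z)) * jacobi_weight a b x + poly H (of_real x) * jacobi_weight a b x =
      poly (G + [:- z, 1:] * H) (of_real x) * (1 / (of_real x - z)) * jacobi_weight a b x"
    by (simp add: field_simps)
qed

lemma jacobi_cauchy_smult:
  assumes "Re a > - 1" "Re b > - 1" "z \<notin> of_real ` {0..1}"
  shows "jacobi_cauchy a b (smult c G) z = c * jacobi_cauchy a b G z"
  using has_integral_mult_right[OF has_integral_jacobi_cauchy[OF assms, of G], of c]
  by (intro jacobi_cauchyI) (simp add: mult_ac)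

lemma jacobi_cauchy_pCons:
  assumes "Re a > - 1" "Re b > - 1" "z \<notin> of_real ` {0..1}"
  shows "jacobi_cauchy a b ([:0, 1:] * F) z = jacobi_integral a b F + z * jacobi_cauchy a b F z"
proof -
  have "[:0, 1:] * F = smult z F + [:- z, 1:] * F" by simp
  thus ?thesis by (simp only: jacobi_cauchy_split[OF assms] jacobi_cauchy_smult[OF assms] add.commute)
qed

lemma jacobi_cauchy_plus_nat: "jacobi_cauchy (a + of_nat n) b F z = jacobi_cauchy a b (monom 1 n * F) z"
  unfolding jacobi_cauchy_def
  by (rule Henstock_Kurzweil_Integration.integral_cong) (simp add: jacobi_weight_plus_nat poly_monom)

text \<open>Iterates x / (x - z) = 1 + z / (x - z). Divided by \<open>z ^ n\<close> this is the
  expansion at infinity with remainder; applied to a lowered exponent it is the one at 0.\<close>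

lemma jacobi_cauchy_monom:
  assumes "Re a > - 1" "Re b > - 1" "z \<notin> of_real ` {0..1}"
  shows "jacobi_cauchy a b (monom 1 n * F) z =
     z ^ n * jacobi_cauchy a b F z + (\<Sum>l<n. z ^ (n - 1 - l) * jacobi_integral a b (monom 1 l * F))"
proof (induction n)
  case (Suc n)
  have "monom 1 (Suc n) * F = [:0, 1:] * (monom 1 n * F)"
    by (simp add: monom_Suc)
  hence "jacobi_cauchy a b (monom 1 (Suc n) * F) z = 
      jacobi_integral a b (monom 1 n * F) + z * jacobi_cauchy a b (monom 1 n * F) z"
    by (simp only: jacobi_cauchy_pCons[OF assms])
  also have "z * jacobi_cauchy a b (monom 1 n * F) z = z ^ Suc n * jacobi_cauchy a b F z +
     (\<Sum>l<n. z * z ^ (n - 1 - l) * jacobi_integral a b (monom 1 l * F))"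
    by (simp only: Suc distrib_left sum_distrib_left mult.assoc power_Suc)
  also have "(\<Sum>l<n. z * z ^ (n - 1 - l) * jacobi_integral a b (monom 1 l * F)) =
     (\<Sum>l<n. z ^ (Suc n - 1 - l) * jacobi_integral a b (monom 1 l * F))"
    by (intro sum.cong refl) (auto simp: power_Suc[symmetric] Suc_diff_Suc simp del: power_Suc)
  finally show ?case by simp
qed (simp add: one_pCons[symmetric] monom_0)

text \<open>The Cauchy transform of \<open>monom 1 n * F\<close> stays bounded in \<open>n\<close>
  because \<open>x ^ n \<le> 1\<close>, so division by \<open>z ^ n\<close> sends the remainder to
  0.\<close>

lemma jacobi_cauchy_sums:
  assumes "Re a > - 1" "Re b > - 1" "norm z > 1"
  shows "(\<lambda>l. jacobi_integral a b (monom 1 l * F) / z ^ (l + 1)) sums (- jacobi_cauchy a b F z)"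
proof -
  have z: "z \<notin> of_real ` {0..1}" and z0: "z \<noteq> 0" using assms(3) by auto
  \<comment> \<open>For \<open>x\<close> in the unit interval \<open>norm (of_real x - z)\<close> is
    at least \<open>norm z - 1\<close>.\<close>
  define B where "B = integral {0..1} (\<lambda>x. norm (poly F (of_real x) * 1 * jacobi_weight a b x) / (norm z - 1))"
  have int: "(\<lambda>x. norm (poly F (of_real x) * 1 * jacobi_weight a b x) / (norm z - 1)) integrable_on {0..1}"
    using absolutely_integrable_jacobi_poly[OF assms(1,2), of "\<lambda>_. 1" F] 
    by (intro integrable_on_divide) (auto simp: absolutely_integrable_on_def)
  have bound: "norm (jacobi_cauchy a b (monom 1 n * F) z) \<le> B" for n
    unfolding jacobi_cauchy_def B_def
  proof (rule integral_norm_bound_integral)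
    show "(\<lambda>x. poly (monom 1 n * F) (of_real x) * (1 / (of_real x - z)) * jacobi_weight a b x) integrable_on {0..1}"
      using has_integral_jacobi_cauchy[OF assms(1,2) z] by blast
    fix x :: real assume x: "x \<in> {0..1}"
    have "norm z - 1 \<le> norm (of_real x - z)"
      using norm_triangle_ineq2[of z "of_real x"] x by (simp add: norm_minus_commute)
    moreover have "x ^ n \<le> 1" using x by (simp add: power_le_one)
    ultimately have "x ^ n * (1 / norm (of_real x - z)) \<le> 1 * (1 / (norm z - 1))"
      using assms(3) x by (intro mult_mono divide_left_mono mult_pos_pos) auto
    hence "x ^ n * (1 / norm (of_real x - z)) * (norm (poly F (of_real x)) * norm (jacobi_weight a b x)) \<le>
      1 * (1 / (norm z - 1)) * (norm (poly F (of_real x)) * norm (jacobi_weight a b x))"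
      by (intro mult_right_mono) auto
    thus "norm (poly (monom 1 n * F) (of_real x) * (1 / (of_real x - z)) * jacobi_weight a b x) \<le>
       norm (poly F (of_real x) * 1 * jacobi_weight a b x) / (norm z - 1)"
      using x by (simp add: norm_mult norm_divide poly_monom norm_power mult_ac)
  qed (rule int)
  have eq: "(\<Sum>l<n. jacobi_integral a b (monom 1 l * F) / z ^ (l + 1)) =
      jacobi_cauchy a b (monom 1 n * F) z / z ^ n - jacobi_cauchy a b F z" for n
  proof -
    have "(\<Sum>l<n. jacobi_integral a b (monom 1 l * F) / z ^ (l + 1)) =
       (\<Sum>l<n. z ^ (n - 1 - l) * jacobi_integral a b (monom 1 l * F)) / z ^ n"
      unfolding sum_divide_distrib
    proof (intro sum.cong refl)
      fix l assume "l \<in> {..<n}"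
      hence "z ^ n = z ^ (n - 1 - l) * z ^ (l + 1)" by (simp add: power_add[symmetric] del: power_Suc)
      thus "jacobi_integral a b (monom 1 l * F) / z ^ (l + 1) = z ^ (n - 1 - l) * jacobi_integral a b (monom 1 l * F) / z ^ n"
        using z0 by simp
    qed
    thus ?thesis using jacobi_cauchy_monom[OF assms(1,2) z, of n F] z0 by (simp add: field_simps)
  qed
  have "(\<lambda>n. jacobi_cauchy a b (monom 1 n * F) z / z ^ n) \<longlonglongrightarrow> 0"
  proof (rule Lim_null_comparison)
    show "\<forall>\<^sub>F n in sequentially. norm (jacobi_cauchy a b (monom 1 n * F) z / z ^ n) \<le> B * inverse (norm z) ^ n"
      using bound z0 by (intro always_eventually) (auto simp: norm_divide norm_power divide_simps)
    have "(\<lambda>n. inverse (norm z) ^ n) \<longlonglongrightarrow> 0"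
      using assms(3) by (intro LIMSEQ_power_zero) (auto simp: inverse_less_1_iff)
    from tendsto_mult_right_zero[OF this] show "(\<lambda>n. B * inverse (norm z) ^ n) \<longlonglongrightarrow> 0" by simp
  qed
  from tendsto_diff[OF this tendsto_const[of "jacobi_cauchy a b F z"]]
  show ?thesis unfolding sums_def eq by simp
qed

text \<open>Apply \<open>jacobi_cauchy_monom\<close> with \<open>Suc n\<close> to the exponent
  \<open>a - of_nat (Suc n)\<close>, which is still admissible because \<open>Re a > real n\<close>;
  the sum is then reversed.\<close>

lemma jacobi_cauchy_expand_zero:
  assumes "Re a > real n" "Re b > - 1" "z \<notin> of_real ` {0..1}"
  shows "jacobi_cauchy a b F z = (\<Sum>l\<le>n. z ^ l * jacobi_integral (a - of_nat (Suc l)) b F) +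
           z ^ Suc n * jacobi_cauchy (a - of_nat (Suc n)) b F z"
proof -
  let ?a = "a - of_nat (Suc n)"
  have a: "Re ?a > - 1" using assms(1) by simp
  have "jacobi_cauchy a b F z = jacobi_cauchy (?a + of_nat (Suc n)) b F z" by simp
  also have "\<dots> = z ^ Suc n * jacobi_cauchy ?a b F z + 
      (\<Sum>l<Suc n. z ^ (Suc n - 1 - l) * jacobi_integral ?a b (monom 1 l * F))"
    unfolding jacobi_cauchy_plus_nat by (rule jacobi_cauchy_monom[OF a assms(2,3)])
  also have "(\<Sum>l<Suc n. z ^ (Suc n - 1 - l) * jacobi_integral ?a b (monom 1 l * F)) =
      (\<Sum>l\<le>n. z ^ l * jacobi_integral (a - of_nat (Suc l)) b F)"
  proof (rule sum.reindex_bij_witness[of _ "\<lambda>l. n - l" "\<lambda>l. n - l"])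
    fix l assume l: "l \<in> {..<Suc n}"
    have "a - of_nat (Suc (n - l)) = ?a + of_nat l" using l by (simp add: of_nat_diff)
    thus "z ^ (n - l) * jacobi_integral (a - of_nat (Suc (n - l))) b F =
        z ^ (Suc n - 1 - l) * jacobi_integral ?a b (monom 1 l * F)"
      by (simp only: jacobi_integral_plus_nat) simp
  qed auto
  finally show ?thesis by simp
qed

section \<open>Cauchy transforms near 0, uniformly up to the cut\<close>

lemma norm_integral_cauchy_kernel_symmetric:
  assumes "Im z \<noteq> 0" "d > 0"
  shows "(\<lambda>x. 1 / (of_real x - z)) integrable_on {Re z - d..Re z + d}" (is ?int)
    and "norm (integral {Re z - d..Re z + d} (\<lambda>x. 1 / (of_real x - z))) \<le> 2 * pi"
proof -
  let ?L = "\<lambda>x::real. Ln (of_real x - z)"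
  have Im: "Im (of_real x - z) \<noteq> 0" for x using assms(1) by simp
  have "((\<lambda>x. 1 / (of_real x - z)) has_integral ?L (Re z + d) - ?L (Re z - d)) {Re z - d..Re z + d}"
  proof (rule fundamental_theorem_of_calculus)
    fix x :: real
    have "((\<lambda>w. Ln (w - z)) has_field_derivative (1 / (of_real x - z))) (at (of_real x))"
      using Im[of x] by (auto intro!: derivative_eq_intros simp: complex_nonpos_Reals_iff field_simps)
    thus "(?L has_vector_derivative (1 / (of_real x - z))) (at x within {Re z - d..Re z + d})"
      by (intro has_vector_derivative_real_field) (auto intro: has_field_derivative_at_within)
  qed (use assms in auto)
  moreover have "norm (?L (Re z + d) - ?L (Re z - d)) \<le> 2 * pi"
  proof -
    have nz: "of_real x - z \<noteq> 0" for x using Im[of x] by auto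
    \<comment> \<open>The endpoints are equally far from \<open>z\<close>, so the real parts of the
      logarithms cancel. Only a difference of arguments remains, bounded independently of
      \<open>Im z\<close>.\<close>
    have "norm (of_real (Re z + d) - z) = norm (of_real (Re z - d) - z)" by (simp add: cmod_def)
    hence "Re (?L (Re z + d) - ?L (Re z - d)) = 0" 
      by (simp only: minus_complex.sel Re_Ln[OF nz] diff_self)
    hence "norm (?L (Re z + d) - ?L (Re z - d)) = \<bar>Im (?L (Re z + d) - ?L (Re z - d))\<bar>"
      by (simp add: cmod_eq_Im)
    also have "\<dots> \<le> 2 * pi"
      using mpi_less_Im_Ln[OF nz, of "Re z + d"] mpi_less_Im_Ln[OF nz, of "Re z - d"]
        Im_Ln_le_pi[OF nz, of "Re z + d"] Im_Ln_le_pi[OF nz, of "Re z - d"]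
      by (simp only: minus_complex.sel abs_le_iff) linarith
    finally show ?thesis .
  qed
  ultimately show ?int "norm (integral {Re z - d..Re z + d} (\<lambda>x. 1 / (of_real x - z))) \<le> 2 * pi"
    by (auto simp: integral_unique)
qed

text \<open>The distance from \<open>x\<close> to \<open>z\<close> controls both \<open>x\<close>
  and \<open>norm z\<close> in three cases: \<open>Re z \<le> 0\<close>, or \<open>Im z\<close>
  dominates \<open>Re z\<close>, or \<open>x\<close> differs from \<open>Re z\<close> by more than
  \<open>Re z / 2\<close>.\<close>

lemma cauchy_kernel_far:
  fixes x :: real and z :: complex
  assumes "x \<ge> 0" "0 < Re z \<Longrightarrow> \<bar>Im z\<bar> \<le> Re z \<Longrightarrow> x \<notin> {Re z / 2..Re z + Re z / 2}"
  shows "x \<le> 4 * norm (of_real x - z)" "norm z \<le> 4 * norm (of_real x - z)"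
proof -
  let ?n = "norm (of_real x - z)"
  have R: "\<bar>x - Re z\<bar> \<le> ?n" and I: "\<bar>Im z\<bar> \<le> ?n"
    using abs_Re_le_cmod[of "of_real x - z"] abs_Im_le_cmod[of "of_real x - z"] by auto
  have r: "norm z \<le> \<bar>Re z\<bar> + \<bar>Im z\<bar>" by (rule cmod_le)
  show "x \<le> 4 * ?n" "norm z \<le> 4 * ?n"
    using assms R I r by (auto simp: abs_if split: if_splits; linarith)+
qed

text \<open>A real power is monotone in one direction or the other, so the sum of the two end values
  is a bound that does not depend on the sign of \<open>c\<close>.\<close>

lemma powr_ratio_bound:
  fixes t c :: real
  assumes "0 < u" "u \<le> t" "t \<le> v"
  shows "t powr c \<le> u powr c + v powr c"
proof (cases "c \<ge> 0")
  case True
  thus ?thesis using powr_mono2[of c t v] assms by (simp add: add_increasing)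
next
  case False
  thus ?thesis using powr_mono2'[of c u t] assms by (simp add: add_increasing2)
qed


text \<open>The derivative of the density has size \<open>t powr (Re a - 1)\<close>, and
  \<open>t\<close> is comparable to \<open>y\<close> on the window, so \<open>L\<close> does not
  depend on \<open>y\<close>. The condition \<open>y < 1 / 4\<close> keeps the window away from the
  endpoint 1.\<close>

lemma jacobi_density_lipschitz:
  fixes a b :: complex and F :: "complex poly"
  defines "f \<equiv> \<lambda>x. poly F (of_real x) * jacobi_weight a b x"
  obtains L where "L \<ge> 0"
    and "\<And>x y. 0 < y \<Longrightarrow> y < 1 / 4 \<Longrightarrow> x \<in> {y / 2..y + y / 2} \<Longrightarrow>
           norm (f x - f y) \<le> L * y powr (Re a - 1) * \<bar>x - y\<bar>"
proof -
  have ex: "\<exists>C. \<forall>x\<in>{0..1::real}. norm (poly G (of_real x :: complex)) \<le> C" for G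
  proof -
    have "compact ((\<lambda>x. poly G (of_real x :: complex)) ` {0..1::real})"
      by (intro compact_continuous_image continuous_intros) auto
    from compact_imp_bounded[OF this] show ?thesis unfolding bounded_iff ball_simps .
  qed
  obtain C1 C2 where C: "norm (poly F (of_real x)) \<le> C1" "norm (poly (pderiv F) (of_real x)) \<le> C2" if "x \<in> {0..1}" for x :: real
    using ex[of F] ex[of "pderiv F"] by blast
  define M where "M = max C1 C2"
  \<comment> \<open>\<open>K\<close> bounds \<open>(1 - t) powr Re b\<close> for
    \<open>t \<le> 1 / 2\<close>, and \<open>D\<close> bounds the power of \<open>t / y\<close>,
    which lies between 1/2 and 3/2.\<close>
  define K where "K = (1 / 2) powr Re b + 1 powr Re b"
  define D where "D = (1 / 2) powr (Re a - 1) + (3 / 2) powr (Re a - 1)"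
  define L where "L = M * (1 + norm a + norm b) * K * D"
  have M: "norm (poly F (of_real x)) \<le> M" "norm (poly (pderiv F) (of_real x)) \<le> M" if "x \<in> {0..1}" for x :: real
    using C[OF that] by (auto simp: M_def)
  have M0: "M \<ge> 0" using order_trans[OF norm_ge_zero M(1)[of 0]] by simp
  have K0: "K \<ge> 0" and D0: "D \<ge> 0" by (auto simp: K_def D_def)
  show thesis
  proof (rule that)
    show "L \<ge> 0" unfolding L_def using M0 K0 D0 by simp
    fix x y :: real assume y: "0 < y" "y < 1 / 4" and x: "x \<in> {y / 2..y + y / 2}"
    define f' where "f' = (\<lambda>t. (poly (pderiv F) (of_real t) + poly F (of_real t) * (a / of_real t - b / (1 - of_real t))) *
       jacobi_weight a b t)"
    have "norm (f x - f y) \<le> L * y powr (Re a - 1) * norm (x - y)"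
    proof (rule differentiable_bound)
      show "convex {y / 2..y + y / 2}" by simp
      fix t assume t: "t \<in> {y / 2..y + y / 2}"
      hence t01: "t \<in> {0<..<1}" "t \<in> {0..1}" "0 < t" "t \<le> 1 / 2" using y by auto
      show "(f has_derivative (\<lambda>h. h *\<^sub>R f' t)) (at t within {y / 2..y + y / 2})"
        using has_field_derivative_jacobi[OF t01(1) poly_DERIV, of F a b]
        unfolding f'_def f_def has_vector_derivative_def by (rule has_derivative_at_withinI)
      have "norm (a / of_real t - b / (1 - of_real t)) \<le> norm a / t + norm b / (1 - t)"
      proof -
        have "norm (1 - complex_of_real t) = 1 - t" using t01 
          by (metis abs_of_nonneg diff_ge_0_iff_ge norm_of_real of_real_1 of_real_diff atLeastAtMost_iff)
        thus ?thesis using norm_triangle_ineq4[of "a / of_real t" "b / (1 - of_real t)"] t01(3)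
          by (simp add: norm_divide)
      qed
      also have "norm b / (1 - t) \<le> norm b / t" using t01 by (intro divide_left_mono) auto
      finally have "norm (poly F (of_real t) * (a / of_real t - b / (1 - of_real t))) \<le> M * (norm a / t + norm b / t)"
        unfolding norm_mult using M(1)[OF t01(2)] M0 by (intro mult_mono) auto
      moreover have "norm (poly (pderiv F) (of_real t)) \<le> M * (1 / t)"
      proof -
        have "M * 1 \<le> M * (1 / t)" using t01 M0 by (intro mult_left_mono) auto
        thus ?thesis using M(2)[OF t01(2)] by simp
      qed
      ultimately have 1: "norm (poly (pderiv F) (of_real t) + poly F (of_real t) * (a / of_real t - b / (1 - of_real t))) \<le>
          M * (1 + norm a + norm b) / t"
        using norm_triangle_mono[of "poly (pderiv F) (of_real t)" "M * (1 / t)"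
            "poly F (of_real t) * (a / of_real t - b / (1 - of_real t))" "M * (norm a / t + norm b / t)"]
        by (simp add: add_divide_distrib distrib_left)
      have 2: "norm (jacobi_weight a b t) \<le> t powr Re a * K"
        unfolding norm_jacobi_weight[OF t01(2)] K_def
        using t01 by (intro mult_left_mono powr_ratio_bound) auto
      have ratio: "t powr (Re a - 1) \<le> y powr (Re a - 1) * D"
      proof -
        have "(t / y) powr (Re a - 1) \<le> D" unfolding D_def
          using t y by (intro powr_ratio_bound) (auto simp: field_simps)
        hence "y powr (Re a - 1) * (t / y) powr (Re a - 1) \<le> y powr (Re a - 1) * D"
          by (intro mult_left_mono) auto
        thus ?thesis using y t01 by (simp add: powr_mult[symmetric])
      qed
      have "norm (f' t) \<le> M * (1 + norm a + norm b) / t * (t powr Re a * K)"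
        unfolding f'_def norm_mult by (intro mult_mono 1 2) (use M0 t01 in auto)
      also have "\<dots> = M * (1 + norm a + norm b) * K * t powr (Re a - 1)"
        using t01 by (simp add: powr_diff)
      also have "\<dots> \<le> L * y powr (Re a - 1)"
        using mult_left_mono[OF ratio, of "M * (1 + norm a + norm b) * K"] M0 K0
        by (simp add: L_def mult_ac)
      finally have n: "norm (f' t) \<le> L * y powr (Re a - 1)" .
      show "onorm (\<lambda>h. h *\<^sub>R f' t) \<le> L * y powr (Re a - 1)"
        by (rule onorm_le) (use n in \<open>simp add: mult.commute mult_left_mono\<close>)
    qed (use x y in auto)
    thus "norm (f x - f y) \<le> L * y powr (Re a - 1) * \<bar>x - y\<bar>" by simp
  qed
qed

text \<open>
  Away from \<open>x = Re z\<close> the kernel satisfies \<open>\<bar>z / (x - z)\<bar> \<le> 4 (\<bar>z\<bar> / x)\<^sup>\<delta>\<close>. For \<open>z\<close> close to the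
  cut, the value \<open>f (Re z)\<close> of the density is subtracted on an interval that is symmetric about
  \<open>Re z\<close>, over which the integral of \<open>1 / (x - z)\<close> is bounded.
\<close>
lemma jacobi_cauchy_near_zero_bound:
  fixes a b :: complex and F :: "complex poly"
  assumes a: "Re a > - 1" and b: "Re b > - 1"
  obtains C \<delta> where "\<delta> > 0"
    and "\<And>z. Im z \<noteq> 0 \<or> Re z < 0 \<Longrightarrow> norm z < 1 / 4 \<Longrightarrow>
           norm (z * jacobi_cauchy a b F z) \<le> C * norm z powr \<delta>"
proof -
  define \<rho> where "\<rho> = Re a"
  define f where "f = (\<lambda>x. poly F (of_real x) * jacobi_weight a b x)"
  \<comment> \<open>Small enough that x to the power \<rho> - \<delta> remains integrable at 0, and
    below 1 for the interpolation in the far case.\<close>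
  define \<delta> where "\<delta> = min (1 / 2) ((\<rho> + 1) / 2)"
  have d: "0 < \<delta>" "\<delta> < 1" "\<rho> - \<delta> > - 1" using a by (auto simp: \<delta>_def \<rho>_def min_def field_simps)
  obtain L where L: "L \<ge> 0" "\<And>x y. 0 < y \<Longrightarrow> y < 1 / 4 \<Longrightarrow> x \<in> {y / 2..y + y / 2} \<Longrightarrow>
           norm (f x - f y) \<le> L * y powr (\<rho> - 1) * \<bar>x - y\<bar>"
    using jacobi_density_lipschitz[of F a b] unfolding f_def \<rho>_def by blast
  have "compact ((\<lambda>x. poly F (of_real x)) ` {0..1::real})"
    by (intro compact_continuous_image continuous_intros) auto
  from compact_imp_bounded[OF this] obtain M where M: "\<And>x::real. x \<in> {0..1} \<Longrightarrow> norm (poly F (of_real x)) \<le> M"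
    unfolding bounded_iff ball_simps by blast
  have M0: "M \<ge> 0" using order_trans[OF norm_ge_zero M[of 0]] by simp
  define w where "w = (\<lambda>x::real. x powr (\<rho> - \<delta>) * (1 - x) powr Re b)"
  have w_int: "w integrable_on {0..1}"
    using integrable_jacobi_bound[of "of_real (\<rho> - \<delta>)" b] d b by (simp add: w_def)
  define K where "K = (1 / 2) powr Re b + 1 powr Re b"
  define k where "k = (1 / 2) powr (- Re b) + 1 powr (- Re b)"
  \<comment> \<open>For \<open>x\<close> in the window around \<open>y = Re z\<close> the quotient
    \<open>y / x\<close> lies between 2/3 and 2.\<close>
  define D where "D = (2 / 3) powr (\<rho> - \<delta>) + 2 powr (\<rho> - \<delta>)"
  define C1 where "C1 = max (4 * M) (2 * L * D * k)"
  have K0: "K \<ge> 0" "k \<ge> 0" "D \<ge> 0" by (auto simp: K_def k_def D_def)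
  have C10: "C1 \<ge> 0" using M0 by (auto simp: C1_def)
  have f_bound: "norm (f x) \<le> M * (x powr \<rho> * (1 - x) powr Re b)" if "x \<in> {0..1}" for x
    using M[OF that] that by (simp add: f_def norm_mult norm_jacobi_weight \<rho>_def mult_right_mono)
  show thesis
  proof (rule that)
    show "\<delta> > 0" by (rule d(1))
    fix z :: complex assume z: "Im z \<noteq> 0 \<or> Re z < 0" and r: "norm z < 1 / 4"
    define near where "near \<longleftrightarrow> 0 < Re z \<and> \<bar>Im z\<bar> \<le> Re z"
    define I where "I = (if near then {Re z / 2..Re z + Re z / 2} else {})"
    have I_eq: "I = {Re z - Re z / 2..Re z + Re z / 2}" if near
      using that by (simp add: I_def)
    have z01: "z \<notin> of_real ` {0..1}" using z by auto
    have z0: "norm z > 0" using z by auto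
    have Re_le: "Re z \<le> norm z" by (rule complex_Re_le_cmod)
    have I01: "I \<subseteq> {0..1 / 2}" using Re_le r by (auto simp: I_def near_def)
    define g where "g = (\<lambda>x::real. 1 / (of_real x - z))"
    \<comment> \<open>The subtracted part; it is 0 off the window, and the window is empty unless
      \<open>z\<close> is near the cut.\<close>
    define e where "e = (\<lambda>x. if x \<in> I then f (Re z) * g x else 0)"
    have e_int: "(e has_integral (f (Re z) * integral I g)) {0..1}"
    proof -
      have "g integrable_on I"
      proof (cases near)
        case True
        hence "Im z \<noteq> 0" "Re z / 2 > 0" using z by (auto simp: near_def)
        from norm_integral_cauchy_kernel_symmetric(1)[OF this] show ?thesis by (simp add: I_eq[OF True] g_def)
      qed (simp add: I_def integrable_on_empty)
      from has_integral_mult_right[OF integrable_integral[OF this], of "f (Re z)"]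
      show ?thesis unfolding e_def using I01 by (subst has_integral_restrict) auto
    qed
    have h_int: "((\<lambda>x. f x * g x - e x) has_integral (jacobi_cauchy a b F z - f (Re z) * integral I g)) {0..1}"
    proof (rule has_integral_diff[OF _ e_int])
      show "((\<lambda>x. f x * g x) has_integral jacobi_cauchy a b F z) {0..1}"
        using has_integral_jacobi_cauchy[OF a b z01, of F] by (simp add: f_def g_def mult_ac)
    qed
    have h_bound: "norm (z * (f x * g x - e x)) \<le> C1 * norm z powr \<delta> * w x" if x: "x \<in> {0..1}" for x
    \<comment> \<open>The majorant is needed at every point; at the endpoints the density is 0 by
      the value of \<open>powr\<close> at 0.\<close>
    proof (cases "x = 0 \<or> x = 1")
      case True
      have "f 0 = 0" "x \<in> I \<Longrightarrow> x \<noteq> 1" "x \<in> I \<Longrightarrow> x \<noteq> 0" "f 1 = 0"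
        using I01 by (auto simp: f_def jacobi_weight_def I_def near_def split: if_splits)
      hence "f x * g x - e x = 0" using True by (auto simp: e_def)
      thus ?thesis using C10 x by (simp add: w_def)
    next
      case False
      hence x01: "0 < x" "x < 1" using x by auto
      let ?n = "norm (of_real x - z)"
      have n0: "?n > 0" using z01 x by auto
      show ?thesis
      proof (cases "x \<in> I")
        case False
        hence far: "0 < Re z \<Longrightarrow> \<bar>Im z\<bar> \<le> Re z \<Longrightarrow> x \<notin> {Re z / 2..Re z + Re z / 2}"
          by (simp add: I_def near_def)
        have 1: "x \<le> 4 * ?n" "norm z \<le> 4 * ?n"
          using cauchy_kernel_far[OF less_imp_le[OF x01(1)] far] by blast+
        \<comment> \<open>Interpolation between the two far bounds, with weights \<delta> and 1 -
          \<delta>.\<close>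
        have "x powr \<delta> * norm z powr (1 - \<delta>) \<le> (4 * ?n) powr \<delta> * (4 * ?n) powr (1 - \<delta>)"
          using 1 x01 z0 d by (intro mult_mono powr_mono2) auto
        also have "\<dots> = 4 * ?n" using n0 by (simp add: powr_add[symmetric])
        finally have "norm z / ?n \<le> 4 * norm z / (x powr \<delta> * norm z powr (1 - \<delta>))"
          using n0 x01 z0 by (simp add: field_simps)
        also have "\<dots> = 4 * norm z powr \<delta> * x powr (- \<delta>)"
          using x01 z0 by (simp add: powr_diff powr_minus field_simps)
        finally have 2: "norm z / ?n \<le> 4 * norm z powr \<delta> * x powr (- \<delta>)" .
        have "norm (z * (f x * g x - e x)) = norm (f x) * (norm z / ?n)"
          using False by (simp add: e_def g_def norm_mult norm_divide)
        also have "\<dots> \<le> M * (x powr \<rho> * (1 - x) powr Re b) * (4 * norm z powr \<delta> * x powr (- \<delta>))"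
          using M0 by (intro mult_mono f_bound x 2) auto
        also have "\<dots> = 4 * M * norm z powr \<delta> * w x"
          using x01 by (simp add: w_def powr_diff powr_minus field_simps)
        also have "\<dots> \<le> C1 * norm z powr \<delta> * w x"
          by (intro mult_right_mono) (auto simp: C1_def w_def)
        finally show ?thesis .
      next
        case True
        hence nr: near and xI: "x \<in> {Re z / 2..Re z + Re z / 2}" by (auto simp: I_def split: if_splits)
        define y where "y = Re z"
        have y: "0 < y" "y \<le> norm z" "y < 1 / 4" "norm z \<le> 2 * y"
          using nr Re_le r cmod_le[of z] by (auto simp: near_def y_def)
        have xh: "x \<le> 1 / 2" using I01 True by auto
        \<comment> \<open>The Lipschitz factor \<open>\<bar>x - y\<bar>\<close> is absorbed by the
          denominator, because \<open>y\<close> is the real part of \<open>z\<close>.\<close>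
        have "\<bar>x - y\<bar> \<le> ?n" using abs_Re_le_cmod[of "of_real x - z"] by (simp add: y_def)
        hence "L * y powr (\<rho> - 1) * \<bar>x - y\<bar> / ?n \<le> L * y powr (\<rho> - 1)"
          using L(1) n0 by (simp add: divide_le_eq mult_left_mono)
        moreover have "norm (f x - f y) / ?n \<le> L * y powr (\<rho> - 1) * \<bar>x - y\<bar> / ?n"
          using L(2)[of y x] y xI n0 by (intro divide_right_mono) (auto simp: y_def)
        ultimately have 1: "norm (f x - f y) / ?n \<le> L * y powr (\<rho> - 1)" by linarith
        have "norm (z * (f x * g x - e x)) = norm z * (norm (f x - f y) / ?n)"
        proof -
          have "z * (f x * g x - e x) = z * ((f x - f y) / (of_real x - z))"
            using True by (simp add: e_def g_def y_def diff_divide_distrib)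
          thus ?thesis by (simp only: norm_mult norm_divide)
        qed
        also have "\<dots> \<le> (2 * y) * (L * y powr (\<rho> - 1))"
          using y 1 by (intro mult_mono) auto
        also have "\<dots> = 2 * L * (y powr \<delta> * y powr (\<rho> - \<delta>))"
          using y by (simp add: powr_diff)
        also have "\<dots> \<le> 2 * L * (norm z powr \<delta> * (x powr (\<rho> - \<delta>) * D))"
        proof (intro mult_left_mono mult_mono)
          show "y powr \<delta> \<le> norm z powr \<delta>" using y d by (intro powr_mono2) auto
          have "(y / x) powr (\<rho> - \<delta>) \<le> D" unfolding D_def
            using xI y x01 by (intro powr_ratio_bound) (auto simp: field_simps y_def)
          hence "x powr (\<rho> - \<delta>) * (y / x) powr (\<rho> - \<delta>) \<le> x powr (\<rho> - \<delta>) * D"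
            by (intro mult_left_mono) auto
          thus "y powr (\<rho> - \<delta>) \<le> x powr (\<rho> - \<delta>) * D" using y x01 by (simp add: powr_mult[symmetric])
        qed (use L(1) in auto)
        \<comment> \<open>Restores the factor at the endpoint 1, so that the same integrable
          majorant \<open>w\<close> serves both cases.\<close>
        also have "\<dots> \<le> 2 * L * (norm z powr \<delta> * (x powr (\<rho> - \<delta>) * D)) * (k * (1 - x) powr Re b)"
        proof -
          have "(1 - x) powr (- Re b) \<le> k" unfolding k_def
            using x01 xh by (intro powr_ratio_bound) auto
          hence "(1 - x) powr (- Re b) * (1 - x) powr Re b \<le> k * (1 - x) powr Re b"
            by (intro mult_right_mono) auto
          hence "1 \<le> k * (1 - x) powr Re b" using x01 by (simp add: powr_minus)
          from mult_left_mono[OF this, of "2 * L * (norm z powr \<delta> * (x powr (\<rho> - \<delta>) * D))"]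
          show ?thesis using L(1) K0 by simp
        qed
        also have "\<dots> = (2 * L * D * k) * norm z powr \<delta> * w x" by (simp add: w_def)
        also have "\<dots> \<le> C1 * norm z powr \<delta> * w x"
          by (intro mult_right_mono) (auto simp: C1_def w_def)
        finally show ?thesis .
      qed
    qed
    have A: "norm (z * (jacobi_cauchy a b F z - f (Re z) * integral I g)) \<le> C1 * norm z powr \<delta> * integral {0..1} w"
    proof -
      have i: "((\<lambda>x. z * (f x * g x - e x)) has_integral z * (jacobi_cauchy a b F z - f (Re z) * integral I g)) {0..1}"
        by (rule has_integral_mult_right[OF h_int])
      have "norm (integral {0..1} (\<lambda>x. z * (f x * g x - e x))) \<le> integral {0..1} (\<lambda>x. C1 * norm z powr \<delta> * w x)"
        by (rule integral_norm_bound_integral[OF _ integrable_on_mult_right[OF w_int] h_bound]) (use i in auto)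
      also have "integral {0..1} (\<lambda>x. C1 * norm z powr \<delta> * w x) = C1 * norm z powr \<delta> * integral {0..1} w"
        by (rule integral_mult_right)
      finally show ?thesis unfolding integral_unique[OF i] .
    qed
    \<comment> \<open>The subtracted part is of order \<open>y powr (1 + \<rho>)\<close>, which is
      at most \<open>y powr \<delta>\<close> since \<open>y < 1\<close> and
      \<open>\<delta> < 1 + \<rho>\<close>.\<close>
    have B: "norm (z * (f (Re z) * integral I g)) \<le> 4 * pi * M * K * norm z powr \<delta>"
    proof (cases near)
      case True
      define y where "y = Re z"
      have y: "0 < y" "y \<le> norm z" "y < 1 / 4" "norm z \<le> 2 * y" "Im z \<noteq> 0"
        using True Re_le r cmod_le[of z] z by (auto simp: near_def y_def)
      have G: "norm (integral I g) \<le> 2 * pi"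
        using norm_integral_cauchy_kernel_symmetric(2)[OF y(5), of "y / 2"] y(1) 
        by (simp add: I_eq[OF True] g_def y_def)
      have "norm (f y) \<le> M * (y powr \<rho> * K)"
      proof -
        have "(1 - y) powr Re b \<le> K" unfolding K_def using y by (intro powr_ratio_bound) auto
        hence "M * (y powr \<rho> * (1 - y) powr Re b) \<le> M * (y powr \<rho> * K)" using M0 by (intro mult_left_mono) auto
        thus ?thesis using f_bound[of y] y by simp
      qed
      hence "norm (z * (f y * integral I g)) \<le> (2 * y) * (M * (y powr \<rho> * K) * (2 * pi))"
        unfolding norm_mult using y G M0 K0 by (intro mult_mono) auto
      also have "\<dots> = 4 * pi * M * K * y powr (1 + \<rho>)" using y by (simp add: powr_add)
      also have "y powr (1 + \<rho>) \<le> norm z powr \<delta>"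
      proof -
        have "y powr (1 + \<rho>) \<le> y powr \<delta>" using y d by (intro powr_mono') auto
        also have "\<dots> \<le> norm z powr \<delta>" using y d by (intro powr_mono2) auto
        finally show ?thesis .
      qed
      finally show ?thesis using M0 K0 by (simp add: y_def mult_left_mono)
    qed (use M0 K0 in \<open>simp add: I_def\<close>)
    have "z * jacobi_cauchy a b F z = z * (jacobi_cauchy a b F z - f (Re z) * integral I g) + z * (f (Re z) * integral I g)"
      by (simp add: algebra_simps)
    also have "norm \<dots> \<le> C1 * norm z powr \<delta> * integral {0..1} w + 4 * pi * M * K * norm z powr \<delta>"
      using norm_triangle_mono[OF A B] .
    also have "\<dots> = (C1 * integral {0..1} w + 4 * pi * M * K) * norm z powr \<delta>" by (simp add: algebra_simps)
    finally show "norm (z * jacobi_cauchy a b F z) \<le> (C1 * integral {0..1} w + 4 * pi * M * K) * norm z powr \<delta>" .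
  qed
qed

text \<open>The bound depends on \<open>norm z\<close> only, which is what makes the limit uniform
  in the argument.\<close>

lemma tendsto_jacobi_cauchy_zero:
  assumes a: "Re a > - 1" and b: "Re b > - 1"
  shows "((\<lambda>z. z * jacobi_cauchy a b F z) \<longlongrightarrow> 0) (at 0 within {z. 0 < Arg2pi z \<and> Arg2pi z < 2 * pi})"
proof -
  obtain C \<delta> where d: "\<delta> > 0" and C: "\<And>z. Im z \<noteq> 0 \<or> Re z < 0 \<Longrightarrow> norm z < 1 / 4 \<Longrightarrow>
           norm (z * jacobi_cauchy a b F z) \<le> C * norm z powr \<delta>"
    using jacobi_cauchy_near_zero_bound[OF a b, of F] by blast
  show ?thesis
  proof (rule Lim_null_comparison)
    have "eventually (\<lambda>z. dist z 0 < 1 / 4) (at 0 within {z. 0 < Arg2pi z \<and> Arg2pi z < 2 * pi})"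
      by (auto simp: eventually_at intro!: exI[of _ "1 / 4"])
    moreover have "eventually (\<lambda>z. z \<in> {z. 0 < Arg2pi z \<and> Arg2pi z < 2 * pi}) (at 0 within {z. 0 < Arg2pi z \<and> Arg2pi z < 2 * pi})"
      by (auto simp: eventually_at_filter)
    ultimately show "\<forall>\<^sub>F z in at 0 within {z. 0 < Arg2pi z \<and> Arg2pi z < 2 * pi}.
       norm (z * jacobi_cauchy a b F z) \<le> C * norm z powr \<delta>"
    proof eventually_elim
      case (elim z)
      \<comment> \<open>\<open>Arg2pi\<close> is 0 on the positive axis and also at 0, so the sector
        is the complement of the nonnegative reals.\<close>
      have "Im z \<noteq> 0 \<or> Re z < 0"
      proof (rule ccontr)
        assume "\<not> ?thesis"
        hence "Arg2pi z = 0" by (auto simp: Arg2pi_eq_0 complex_is_Real_iff)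
        thus False using elim by simp
      qed
      thus ?case using C[of z] elim by simp
    qed
    have "((\<lambda>z::complex. norm z powr \<delta>) \<longlongrightarrow> 0) (at 0 within {z. 0 < Arg2pi z \<and> Arg2pi z < 2 * pi})"
      using d by (intro tendsto_zero_powrI[where b = \<delta>] tendsto_norm_zero tendsto_ident_at tendsto_const) auto
    from tendsto_mult_right_zero[OF this, of C]
    show "((\<lambda>z::complex. C * norm z powr \<delta>) \<longlongrightarrow> 0) (at 0 within {z. 0 < Arg2pi z \<and> Arg2pi z < 2 * pi})" .
  qed
qed

subsection \<open>Moments of squares\<close>

text \<open>Polynomial identities are proved by evaluation at a point, which leaves a ring identity
  for \<open>algebra\<close>.\<close>

lemmas poly_eval = poly_add poly_diff poly_minus poly_mult poly_smult poly_pCons poly_0 pderiv_mult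
  pderiv_pCons pderiv_add pderiv_diff pderiv_minus pderiv_smult pderiv_0 pderiv_1 poly_1 poly_pcompose pderiv_pcompose

text \<open>The Jacobi differential operator on the unit interval, that is, the hypergeometric
  operator without its zeroth-order term.\<close>

definition jacobi_op :: "complex \<Rightarrow> complex \<Rightarrow> complex poly \<Rightarrow> complex poly" where
  "jacobi_op a b F = [:0, 1, - 1:] * pderiv (pderiv F) + [:a + 1, - (a + b + 2):] * pderiv F"

lemma coeff_jacobi_op:
  "coeff (jacobi_op a b F) i =
     of_nat (Suc i) * (of_nat i + a + 1) * coeff F (Suc i) - of_nat i * (of_nat i + a + b + 1) * coeff F i"
proof -
  consider "i = 0" | "i = 1" | j where "i = Suc (Suc j)"
    by (metis One_nat_def not0_implies_Suc)
  thus ?thesis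
    by cases (simp_all add: jacobi_op_def mult_pCons_left coeff_pderiv algebra_simps)
qed

text \<open>Integration by parts turns each side into minus the integral of x (1 - x) F' G', which
  is symmetric in \<open>F\<close> and \<open>G\<close>.\<close>

lemma jacobi_op_symmetric:
  assumes "Re a > - 1" "Re b > - 1"
  shows "jacobi_integral a b (jacobi_op a b F * G) = jacobi_integral a b (F * jacobi_op a b G)"
proof -
  have *: "jacobi_integral a b (jacobi_op a b F * G) = - jacobi_integral a b ([:0, 1, - 1:] * (pderiv F * pderiv G))" for F G
  proof -
    have "[:a + 1, - (a + b + 2):] * (pderiv F * G) + [:0, 1, - 1:] * pderiv (pderiv F * G) =
       jacobi_op a b F * G + [:0, 1, - 1:] * (pderiv F * pderiv G)"
      by (simp only: jacobi_op_def pderiv_mult ring_distribs mult_ac add_ac)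
    hence "jacobi_integral a b (jacobi_op a b F * G + [:0, 1, - 1:] * (pderiv F * pderiv G)) = 0"
      using jacobi_integral_by_parts[OF assms, of "pderiv F * G"] by (simp only:)
    thus ?thesis by (simp only: jacobi_integral_add[OF assms] eq_neg_iff_add_eq_0)
  qed
  show ?thesis using *[of F G] *[of G F] by (simp add: mult_ac)
qed

lemma jacobi_ode_coeff:
  assumes "jacobi_op a b p + smult (of_nat n * (of_nat n + a + b + 1)) p = 0"
  shows "of_nat (Suc j) * (of_nat j + a + 1) * coeff p (Suc j) =
     (of_nat j - of_nat n) * (of_nat j + of_nat n + a + b + 1) * coeff p j"
proof -
  have "coeff (jacobi_op a b p + smult (of_nat n * (of_nat n + a + b + 1)) p) j = 0" using assms by simp
  thus ?thesis unfolding coeff_add coeff_smult coeff_jacobi_op by algebra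
qed

text \<open>The differential equation is a two-term recurrence for the coefficients, so
  \<open>p\<close> is a multiple of a terminating Gauss series.\<close>

lemma jacobi_ode_coeff_hypergeometric:
  assumes "jacobi_op a b p + smult (of_nat n * (of_nat n + a + b + 1)) p = 0"
  shows "fact j * pochhammer (a + 1) j * coeff p j =
     pochhammer (- of_nat n) j * pochhammer (a + b + of_nat n + 1) j * coeff p 0"
proof (induction j)
  case (Suc j)
  show ?case
    using Suc jacobi_ode_coeff[OF assms, of j] unfolding pochhammer_Suc fact_Suc of_nat_mult of_nat_fact by algebra
qed simp

lemma jacobi_ode_value_0:
  assumes "jacobi_op a b p + smult (of_nat n * (of_nat n + a + b + 1)) p = 0"
  shows "pochhammer (a + 1) n * coeff p n = (- 1) ^ n * pochhammer (a + b + of_nat n + 1) n * coeff p 0"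
  using jacobi_ode_coeff_hypergeometric[OF assms, of n] by (simp add: pochhammer_same)

text \<open>The substitution of 1 - x for x exchanges \<open>a\<close> and \<open>b\<close> and
  reduces the value at 1 to the value at 0.\<close>

lemma jacobi_ode_value_1:
  assumes "jacobi_op a b p + smult (of_nat n * (of_nat n + a + b + 1)) p = 0" "degree p = n"
  shows "pochhammer (b + 1) n * lead_coeff p = pochhammer (a + b + of_nat n + 1) n * poly p 1"
proof -
  define q where "q = pcompose p [:1, - 1:]"
  have "jacobi_op b a q + smult (of_nat n * (of_nat n + b + a + 1)) q =
     pcompose (jacobi_op a b p + smult (of_nat n * (of_nat n + a + b + 1)) p) [:1, - 1:]"
    by (rule poly_ext, simp only: jacobi_op_def q_def poly_eval) algebra
  hence "jacobi_op b a q + smult (of_nat n * (of_nat n + b + a + 1)) q = 0"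
    using assms(1) by simp
  note v = jacobi_ode_value_0[OF this]
  have "coeff q n = lead_coeff p * (- 1) ^ n"
    using lead_coeff_comp[of "[:1, - 1:] :: complex poly" p] degree_pcompose[of p "[:1, - 1:]"] assms(2)
    by (simp add: q_def)
  moreover have "coeff q 0 = poly p 1"
    using poly_0_coeff_0[of q] by (simp add: q_def poly_pcompose)
  ultimately have "(- 1) ^ n * (pochhammer (b + 1) n * lead_coeff p) =
      (- 1) ^ n * (pochhammer (a + b + of_nat n + 1) n * poly p 1)"
    using v by (simp add: algebra_simps)
  thus ?thesis by simp
qed

text \<open>
  Integration by parts for \<open>p\<^sup>2\<close>, \<open>p p'\<close> and \<open>x (1 - x) p'\<^sup>2\<close>, where the differential equation
  removes the second derivatives. For \<open>k = 0\<close> the term \<open>A (k - 1) = A 0\<close> has coefficient 0.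
\<close>
lemma jacobi_square_recurrence:
  fixes \<alpha> \<beta> :: complex and p :: "complex poly"
  assumes ab: "Re \<alpha> > - 1" "Re \<beta> > - 1"
    and ode: "jacobi_op \<alpha> \<beta> p + smult (of_nat n * (of_nat n + \<alpha> + \<beta> + 1)) p = 0"
  defines "A \<equiv> \<lambda>k. jacobi_integral (\<alpha> + of_nat k) \<beta> (p * p)"
  shows "of_nat k * (of_nat k ^ 2 - \<alpha> ^ 2) * A (k - 1) + wilson_middle \<alpha> \<beta> n (of_nat k) * A k +
     (of_nat k + 1) * ((of_nat k + 1) ^ 2 - (\<alpha> + \<beta> + 2 * of_nat n + 1) ^ 2) * A (Suc k) = 0"
proof -
  define lam where "lam = of_nat n * (of_nat n + \<alpha> + \<beta> + 1)"
  let ?p' = "pderiv p" and ?X = "[:0, 1:] :: complex poly" and ?Y = "[:1, - 1:] :: complex poly"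
  define J where "J = (\<lambda>k. jacobi_integral (\<alpha> + of_nat k) \<beta>)"
  have re: "Re (\<alpha> + of_nat k) > - 1" for k using ab(1) by simp
  have J_add: "J k (F + G) = J k F + J k G" and J_diff: "J k (F - G) = J k F - J k G"
    and J_smult: "J k (smult c F) = c * J k F" for k F G c
    unfolding J_def using re[of k] ab(2) 
    by (simp_all add: jacobi_integral_add jacobi_integral_diff jacobi_integral_smult)
  have J_X: "J k (?X * F) = J (Suc k) F" for k F
    using jacobi_integral_plus_nat[of "\<alpha> + of_nat k" 1 \<beta> F] by (simp add: J_def monom_altdef add_ac)
  have parts: "J k ([:\<alpha> + of_nat k + 1, - (\<alpha> + of_nat k + \<beta> + 2):] * F + [:0, 1, - 1:] * pderiv F) = 0" for k F
    unfolding J_def by (rule jacobi_integral_by_parts[OF re ab(2)])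
  have ode': "?X * ?Y * pderiv ?p' + [:\<alpha> + 1, - (\<alpha> + \<beta> + 2):] * ?p' + smult lam p = 0"
    using ode by (simp add: jacobi_op_def lam_def)
  \<comment> \<open>The auxiliary moments of p p' and p'^2; \<open>E\<close> lacks the factor x, so
    \<open>D\<close> is \<open>E\<close> shifted by one.\<close>
  define D E F where "D = (\<lambda>k. J k (?X * (?Y * (p * ?p'))))" and "E = (\<lambda>k. J k (?Y * (p * ?p')))"
    and "F = (\<lambda>k. J k (?X * (?Y * (?p' * ?p'))))"
  have D_eq: "D k = E (Suc k)" for k unfolding D_def E_def J_X ..
  have ode_at: "x * (1 - x) * poly (pderiv ?p') x + (\<alpha> + 1 - (\<alpha> + \<beta> + 2) * x) * poly ?p' x + lam * poly p x = 0" for x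
    using arg_cong[OF ode', of "\<lambda>p. poly p x"] unfolding poly_eval by algebra
  have 1: "(\<alpha> + of_nat k + 1) * A k - (\<alpha> + of_nat k + \<beta> + 2) * A (Suc k) + 2 * D k = 0" for k
  proof -
    have "[:\<alpha> + of_nat k + 1, - (\<alpha> + of_nat k + \<beta> + 2):] * (p * p) + [:0, 1, - 1:] * pderiv (p * p) =
      smult (\<alpha> + of_nat k + 1) (p * p) - smult (\<alpha> + of_nat k + \<beta> + 2) (?X * (p * p)) + smult 2 (?X * (?Y * (p * ?p')))"
      by (rule poly_ext, simp only: poly_eval) algebra
    hence "J k (smult (\<alpha> + of_nat k + 1) (p * p) - smult (\<alpha> + of_nat k + \<beta> + 2) (?X * (p * p)) + smult 2 (?X * (?Y * (p * ?p')))) = 0"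
      using parts[of k "p * p"] by (simp only:)
    moreover have "J k (?X * (p * p)) = A (Suc k)" by (simp only: J_X) (simp only: J_def A_def)
    moreover have "J k (p * p) = A k" unfolding J_def A_def ..
    ultimately show ?thesis unfolding J_add J_diff J_smult D_def by simp
  qed
  have 2: "of_nat k * E k - lam * A k + F k = 0" for k
  proof -
    have "[:\<alpha> + of_nat k + 1, - (\<alpha> + of_nat k + \<beta> + 2):] * (p * ?p') + [:0, 1, - 1:] * pderiv (p * ?p') =
      smult (of_nat k) (?Y * (p * ?p')) - smult lam (p * p) + ?X * (?Y * (?p' * ?p'))"
    proof (rule poly_ext)
      fix x
      show "poly ([:\<alpha> + of_nat k + 1, - (\<alpha> + of_nat k + \<beta> + 2):] * (p * ?p') + [:0, 1, - 1:] * pderiv (p * ?p')) x =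
        poly (smult (of_nat k) (?Y * (p * ?p')) - smult lam (p * p) + ?X * (?Y * (?p' * ?p'))) x"
        using ode_at[of x] unfolding poly_eval by algebra
    qed
    hence "J k (smult (of_nat k) (?Y * (p * ?p')) - smult lam (p * p) + ?X * (?Y * (?p' * ?p'))) = 0"
      using parts[of k "p * ?p'"] by (simp only:)
    moreover have "J k (p * p) = A k" unfolding J_def A_def ..
    ultimately show ?thesis unfolding J_add J_diff J_smult E_def F_def by simp
  qed
  have 3: "(of_nat k - \<alpha>) * F k - (of_nat k - \<alpha> - \<beta>) * F (Suc k) - 2 * lam * D k = 0" for k
  proof -
    let ?G = "?X * (?Y * (?p' * ?p'))"
    have "[:\<alpha> + of_nat k + 1, - (\<alpha> + of_nat k + \<beta> + 2):] * ?G + [:0, 1, - 1:] * pderiv ?G =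
      smult (of_nat k - \<alpha>) ?G - smult (of_nat k - \<alpha> - \<beta>) (?X * ?G) - smult (2 * lam) (?X * (?Y * (p * ?p')))"
    proof (rule poly_ext)
      fix x
      show "poly ([:\<alpha> + of_nat k + 1, - (\<alpha> + of_nat k + \<beta> + 2):] * ?G + [:0, 1, - 1:] * pderiv ?G) x =
        poly (smult (of_nat k - \<alpha>) ?G - smult (of_nat k - \<alpha> - \<beta>) (?X * ?G) - smult (2 * lam) (?X * (?Y * (p * ?p')))) x"
        using ode_at[of x] unfolding poly_eval by algebra
    qed
    hence "J k (smult (of_nat k - \<alpha>) ?G - smult (of_nat k - \<alpha> - \<beta>) (?X * ?G) - smult (2 * lam) (?X * (?Y * (p * ?p')))) = 0"
      using parts[of k ?G] by (simp only:)
    moreover have "J k (?X * ?G) = F (Suc k)" unfolding F_def by (rule J_X)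
    ultimately show ?thesis unfolding J_diff J_smult D_def F_def by simp
  qed
  \<comment> \<open>Fact 1 at \<open>k - 1\<close> expresses \<open>E k\<close>; for
    \<open>k = 0\<close> the factor \<open>of_nat k\<close> makes the statement trivial.\<close>
  have kE: "2 * (of_nat k * E k) = of_nat k * ((\<alpha> + \<beta> + of_nat k + 1) * A k - (\<alpha> + of_nat k) * A (k - 1))"
  proof (cases k)
    case (Suc j)
    show ?thesis using 1[of j] D_eq[of j] unfolding Suc of_nat_Suc diff_Suc_1 by algebra
  qed simp
  \<comment> \<open>Insert \<open>F k\<close> and \<open>F (Suc k)\<close> from 2 into 3, then
    remove \<open>E\<close> by \<open>kE\<close> and \<open>D\<close> by 1.\<close>
  note 2[of k] 2[of "Suc k"] 3[of k] 1[of k] D_eq[of k] kE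
  thus ?thesis unfolding wilson_middle_def lam_def of_nat_Suc
    by algebra
qed


section \<open>Gamma functions, and moments as polynomials in the exponent\<close>

lemma not_nonpos_Int_if_Re_pos: "Re z > 0 \<Longrightarrow> z \<notin> \<int>\<^sub>\<le>\<^sub>0"
  by (auto elim!: nonpos_Ints_cases)

lemma Gamma_nonzero_if_Re_pos: "Re z > 0 \<Longrightarrow> Gamma (z :: complex) \<noteq> 0"
  by (intro Gamma_nonzero not_nonpos_Int_if_Re_pos)

lemma Gamma_plus1_if_Re_pos: "Re z > 0 \<Longrightarrow> Gamma (z + 1 :: complex) = z * Gamma z"
  by (intro Gamma_plus1 not_nonpos_Int_if_Re_pos)

lemma Gamma_plus_nat_if_Re_pos: "Re z > 0 \<Longrightarrow> Gamma (z + of_nat n :: complex) = pochhammer z n * Gamma z"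
  using pochhammer_Gamma[OF not_nonpos_Int_if_Re_pos, of z n] Gamma_nonzero_if_Re_pos[of z] by simp

text \<open>Both sides of the Beta formula gain the nonzero factor \<open>a + 1\<close>. As an
  equivalence it also carries the formula to lower exponents.\<close>

lemma jacobi_integral_1_shift:
  assumes "Re a > - 1" "Re b > - 1"
  shows "jacobi_integral (a + 1) b 1 * Gamma (a + 1 + b + 2) = Gamma (a + 1 + 1) * Gamma (b + 1) \<longleftrightarrow>
         jacobi_integral a b 1 * Gamma (a + b + 2) = Gamma (a + 1) * Gamma (b + 1)"
proof -
  have nz: "a + 1 \<noteq> 0" using assms by (auto simp: complex_eq_iff)
  have "[:a + 1, - (a + b + 2):] * 1 + [:0, 1, - 1:] * pderiv 1 = smult (a + 1) 1 - smult (a + b + 2) (monom 1 1 * 1)"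
    by (rule poly_ext) (simp add: poly_monom algebra_simps)
  hence "jacobi_integral a b (smult (a + 1) 1 - smult (a + b + 2) (monom 1 1 * 1)) = 0"
    using jacobi_integral_by_parts[OF assms, of 1] by (simp only:)
  hence "(a + 1) * jacobi_integral a b 1 = (a + b + 2) * jacobi_integral (a + 1) b 1"
    using jacobi_integral_plus_nat[of a 1 b 1] unfolding of_nat_1
    by (simp only: jacobi_integral_diff[OF assms] jacobi_integral_smult[OF assms]) simp
  moreover have "Gamma (a + 1 + 1) = (a + 1) * Gamma (a + 1)"
    using assms by (intro Gamma_plus1_if_Re_pos) auto
  moreover have "Gamma (a + 1 + b + 2) = (a + b + 2) * Gamma (a + b + 2)"
    using Gamma_plus1_if_Re_pos[of "a + b + 2"] assms by (simp add: add_ac)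
  ultimately have *: "jacobi_integral (a + 1) b 1 * Gamma (a + 1 + b + 2) = (a + 1) * (jacobi_integral a b 1 * Gamma (a + b + 2))"
    "Gamma (a + 1 + 1) * Gamma (b + 1) = (a + 1) * (Gamma (a + 1) * Gamma (b + 1))"
    by algebra+
  show ?thesis unfolding * using nz by (simp only: mult_cancel_left simp_thms)
qed

text \<open>The numerator of the Mellin transform of \<open>F\<close> times the weight: each
  monomial contributes a Beta value, and all of them are brought to the common denominator
  \<open>Gamma (a + x + b + 2 + of_nat d)\<close>.\<close>

definition mellin_poly :: "complex \<Rightarrow> complex \<Rightarrow> nat \<Rightarrow> complex poly \<Rightarrow> complex poly" where
  "mellin_poly a b d F = smult (Gamma (b + 1))
     (\<Sum>j\<le>d. smult (coeff F j) (pochhammer [:a + 1, 1:] j * pochhammer [:a + b + 2 + of_nat j, 1:] (d - j)))"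

lemma poly_pochhammer_linear: "poly (pochhammer [:a, 1:] n) x = pochhammer (a + x) n"
  by (induction n) (simp_all add: pochhammer_Suc of_nat_poly algebra_simps)

lemma pochhammer_linear: "degree (pochhammer [:a :: complex, 1:] n) = n \<and> lead_coeff (pochhammer [:a, 1:] n) = 1"
proof (induction n)
  case (Suc n)
  have e: "pochhammer [:a, 1:] (Suc n) = pochhammer [:a, 1:] n * [:a + of_nat n, 1:]"
    by (simp add: pochhammer_Suc of_nat_poly)
  have "pochhammer [:a, 1:] n \<noteq> 0" using Suc by (metis leading_coeff_0_iff zero_neq_one)
  hence "degree (pochhammer [:a, 1:] (Suc n)) = Suc n"
    using Suc unfolding e by (subst degree_mult_eq) auto
  moreover have "lead_coeff (pochhammer [:a, 1:] (Suc n)) = 1"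
    unfolding e lead_coeff_mult using conjunct2[OF Suc] by simp
  ultimately show ?case by blast
qed auto

lemmas degree_pochhammer_linear = pochhammer_linear[THEN conjunct1]
  and lead_coeff_pochhammer_linear = pochhammer_linear[THEN conjunct2]

lemma degree_mellin_poly: "degree (mellin_poly a b d F) \<le> d"
  unfolding mellin_poly_def
proof (rule order_trans[OF degree_smult_le], rule degree_sum_le)
  fix j assume "j \<in> {..d}"
  thus "degree (smult (coeff F j) (pochhammer [:a + 1, 1:] j * pochhammer [:a + b + 2 + of_nat j, 1:] (d - j))) \<le> d"
    by (intro order_trans[OF degree_smult_le] order_trans[OF degree_mult_le]) (simp add: degree_pochhammer_linear)
qed auto

text \<open>Every product of Pochhammer polynomials is monic of degree \<open>d\<close>, so the
  coefficients of \<open>F\<close> add up to its value at 1.\<close>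

lemma coeff_mellin_poly:
  assumes "degree F \<le> d"
  shows "coeff (mellin_poly a b d F) d = Gamma (b + 1) * poly F 1"
proof -
  have "coeff (pochhammer [:a + 1, 1:] j * pochhammer [:a + b + 2 + of_nat j, 1:] (d - j)) d = 1" if "j \<le> d" for j
  proof -
    have "d = degree (pochhammer [:a + 1, 1:] j) + degree (pochhammer [:a + b + 2 + of_nat j, 1:] (d - j))"
      using that by (simp add: degree_pochhammer_linear)
    thus ?thesis using coeff_mult_degree_sum[of "pochhammer [:a + 1, 1:] j" "pochhammer [:a + b + 2 + of_nat j, 1:] (d - j)"]
      by (simp only: lead_coeff_pochhammer_linear mult_1)
  qed
  moreover have "poly F 1 = (\<Sum>j\<le>d. coeff F j)"
    unfolding poly_altdef using assms by (auto intro!: sum.mono_neutral_left dest: le_degree)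
  ultimately show ?thesis by (simp add: mellin_poly_def coeff_sum)
qed

lemma poly_mellin_poly:
  "poly (mellin_poly a b d F) x = Gamma (b + 1) *
     (\<Sum>j\<le>d. coeff F j * (pochhammer (a + x + 1) j * pochhammer (a + x + b + 2 + of_nat j) (d - j)))"
  by (simp add: mellin_poly_def poly_sum poly_pochhammer_linear add_ac)

text \<open>\<open>wilson\<close> as a formal polynomial in \<open>k\<close>, so that degrees and
  leading coefficients can be compared.\<close>

definition wilson_poly :: "complex \<Rightarrow> complex \<Rightarrow> nat \<Rightarrow> complex poly" where
  "wilson_poly \<alpha> \<beta> n = (\<Sum>i\<le>n. smult (wilson_coeff \<alpha> \<beta> n i) (\<Prod>j<i. [:of_nat j, - 1:] * [:1 + of_nat j, 1:]))"

lemma poly_wilson_poly: "poly (wilson_poly \<alpha> \<beta> n) k = wilson \<alpha> \<beta> n k"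
proof -
  have "wilson_basis i k = (\<Prod>j<i. (of_nat j - k) * (1 + of_nat j + k))" for i
    by (induction i) (simp_all add: wilson_basis_Suc algebra_simps)
  thus ?thesis by (simp add: wilson_poly_def wilson_def poly_sum poly_prod algebra_simps)
qed

lemma degree_wilson_poly: "degree (wilson_poly \<alpha> \<beta> n) \<le> 2 * n"
  and coeff_wilson_poly: "coeff (wilson_poly \<alpha> \<beta> n) (2 * n) = (- 1) ^ n * wilson_coeff \<alpha> \<beta> n n"
proof -
  define R where "R = (\<lambda>i. \<Prod>j<i. [:of_nat j, - 1:] * [:1 + of_nat j, 1 :: complex:])"
  have R: "degree (R i) = 2 * i \<and> lead_coeff (R i) = (- 1) ^ i" for i
  proof (induction i)
    case (Suc i)
    have e: "R (Suc i) = R i * ([:of_nat i, - 1:] * [:1 + of_nat i, 1:])" by (simp add: R_def)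
    have d: "degree ([:of_nat i, - 1:] * [:1 + of_nat i, 1 :: complex:]) = 2"
      by (subst degree_mult_eq) auto
    have l: "lead_coeff ([:of_nat i, - 1:] * [:1 + of_nat i, 1 :: complex:]) = - 1"
      unfolding lead_coeff_mult by simp
    have "R i \<noteq> 0" using Suc by auto
    moreover have "[:of_nat i, - 1:] * [:1 + of_nat i, 1 :: complex:] \<noteq> 0" using d by auto
    ultimately have "degree (R (Suc i)) = 2 * Suc i" using Suc d unfolding e by (subst degree_mult_eq) auto
    moreover have "lead_coeff (R (Suc i)) = (- 1) ^ Suc i" unfolding e lead_coeff_mult l using conjunct2[OF Suc] by simp
    ultimately show ?case by blast
  qed (simp add: R_def)
  have W: "wilson_poly \<alpha> \<beta> n = (\<Sum>i\<le>n. smult (wilson_coeff \<alpha> \<beta> n i) (R i))"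
    by (simp add: wilson_poly_def R_def)
  show "degree (wilson_poly \<alpha> \<beta> n) \<le> 2 * n" unfolding W
    by (intro degree_sum_le) (auto intro!: order_trans[OF degree_smult_le] simp: R)
  have "coeff (R i) (2 * n) = (if i = n then (- 1) ^ n else 0)" if "i \<le> n" for i
  proof (cases "i = n")
    case True
    thus ?thesis using R[of n] by metis
  next
    case False
    thus ?thesis using R[of i] that by (simp add: coeff_eq_0)
  qed
  hence "(\<Sum>i\<le>n. wilson_coeff \<alpha> \<beta> n i * coeff (R i) (2 * n)) =
     (\<Sum>i\<le>n. if i = n then (- 1) ^ n * wilson_coeff \<alpha> \<beta> n n else 0)"
    by (intro sum.cong) auto
  thus "coeff (wilson_poly \<alpha> \<beta> n) (2 * n) = (- 1) ^ n * wilson_coeff \<alpha> \<beta> n n"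
    by (simp add: W coeff_sum if_distrib cong: if_cong)
qed


section \<open>Monic Jacobi polynomials for complex exponents\<close>

locale jacobi_polys =
  fixes \<alpha> \<beta> :: complex and P :: "nat \<Rightarrow> complex poly"
  assumes \<alpha>: "Re \<alpha> > - 1" and \<beta>: "Re \<beta> > - 1" and P: "monic_jacobi \<alpha> \<beta> P"
begin

abbreviation J :: "complex poly \<Rightarrow> complex" where "J \<equiv> jacobi_integral \<alpha> \<beta>"

lemma degree_P [simp]: "degree (P n) = n" and coeff_P_same [simp]: "coeff (P n) n = 1"
proof -
  show "degree (P n) = n" using P by (simp add: monic_jacobi_def)
  have "degree (P n) = n \<and> lead_coeff (P n) = 1" using P unfolding monic_jacobi_def by blast
  thus "coeff (P n) n = 1" by metis
qed

lemma integral_P_P: "J (P n * P m) = (if n = m then jacobi_h \<alpha> \<beta> n else 0)"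
  using P by (intro jacobi_integralI) (simp add: monic_jacobi_def)

lemma h_nonzero: "jacobi_h \<alpha> \<beta> n \<noteq> 0"
proof -
  have "Gamma (\<alpha> + of_nat n + 1) \<noteq> 0" "Gamma (\<beta> + of_nat n + 1) \<noteq> 0" 
    "Gamma (\<alpha> + \<beta> + 2 * of_nat n + 2) \<noteq> 0"
    using \<alpha> \<beta> by (auto intro!: Gamma_nonzero_if_Re_pos)
  moreover have "Gamma (\<alpha> + \<beta> + of_nat n + 1) \<noteq> 0" "Gamma (\<alpha> + \<beta> + 2 * of_nat n + 1) \<noteq> 0" if "n \<noteq> 0"
  proof -
    have "real n \<ge> 1" using that by simp
    thus "Gamma (\<alpha> + \<beta> + of_nat n + 1) \<noteq> 0" "Gamma (\<alpha> + \<beta> + 2 * of_nat n + 1) \<noteq> 0"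
      using \<alpha> \<beta> by (auto intro!: Gamma_nonzero_if_Re_pos)
  qed
  ultimately show ?thesis by (simp add: jacobi_h_def)
qed

lemma h_times_Gamma:
  "jacobi_h \<alpha> \<beta> n * Gamma (\<alpha> + \<beta> + 2 * of_nat n + 2) * pochhammer (\<alpha> + \<beta> + of_nat n + 1) n =
     fact n * pochhammer (\<alpha> + 1) n * pochhammer (\<beta> + 1) n * Gamma (\<alpha> + 1) * Gamma (\<beta> + 1)"
proof (cases "n = 0")
  case True
  have "Gamma (\<alpha> + \<beta> + 2) \<noteq> 0" using \<alpha> \<beta> by (intro Gamma_nonzero_if_Re_pos) auto
  thus ?thesis using True by (simp add: jacobi_h_def)
next
  case False
  hence n: "real n \<ge> 1" by simp
  have nz: "Gamma (\<alpha> + \<beta> + 2 * of_nat n + 2) \<noteq> 0" "Gamma (\<alpha> + \<beta> + 2 * of_nat n + 1) \<noteq> 0"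
    using \<alpha> \<beta> n by (auto intro!: Gamma_nonzero_if_Re_pos)
  have "Gamma (\<alpha> + of_nat n + 1) = pochhammer (\<alpha> + 1) n * Gamma (\<alpha> + 1)"
    "Gamma (\<beta> + of_nat n + 1) = pochhammer (\<beta> + 1) n * Gamma (\<beta> + 1)"
    using Gamma_plus_nat_if_Re_pos[of "\<alpha> + 1" n] Gamma_plus_nat_if_Re_pos[of "\<beta> + 1" n] \<alpha> \<beta>
    by (simp_all add: add_ac)
  moreover have "Gamma (\<alpha> + \<beta> + 2 * of_nat n + 1) = 
      pochhammer (\<alpha> + \<beta> + of_nat n + 1) n * Gamma (\<alpha> + \<beta> + of_nat n + 1)"
    using Gamma_plus_nat_if_Re_pos[of "\<alpha> + \<beta> + of_nat n + 1" n] \<alpha> \<beta> n by (simp add: algebra_simps)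
  ultimately show ?thesis using nz False
    by (simp add: jacobi_h_def)
qed

lemma J_simps:
  "J (F + G) = J F + J G" "J (F - G) = J F - J G" "J (smult c F) = c * J F"
  by (simp_all add: jacobi_integral_add jacobi_integral_diff jacobi_integral_smult \<alpha> \<beta>)

text \<open>Subtracting multiples of the lower polynomials removes the top coefficients of
  \<open>G\<close> one by one. Vanishing coefficients are used instead of a degree bound so that
  \<open>m = 0\<close> means \<open>G = 0\<close>.\<close>

lemma orthogonal_lower:
  assumes "m \<le> n" "\<And>i. i \<ge> m \<Longrightarrow> coeff G i = 0"
  shows "J (P n * G) = 0"
  using assms
proof (induction m arbitrary: G)
  case 0
  hence "G = 0" by (intro poly_eqI) simp
  thus ?case by simp
next
  case (Suc m)
  define G' where "G' = G - smult (coeff G m) (P m)"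
  have "coeff G' i = 0" if "i \<ge> m" for i
    using that Suc.prems(2)[of i] by (cases "i = m") (simp_all add: G'_def coeff_eq_0)
  hence "J (P n * G') = 0" using Suc by simp
  moreover have "G = G' + smult (coeff G m) (P m)" by (simp add: G'_def)
  hence "P n * G = P n * G' + smult (coeff G m) (P n * P m)" by (metis distrib_left mult_smult_right)
  ultimately show ?case using Suc.prems(1) by (simp only: J_simps integral_P_P) simp
qed

lemma orthogonal:
  assumes "degree G \<le> n"
  shows "J (P n * G) = coeff G n * jacobi_h \<alpha> \<beta> n"
proof -
  define G' where "G' = G - smult (coeff G n) (P n)"
  have "coeff G' i = 0" if "i \<ge> n" for i
    using that assms by (cases "i = n") (simp_all add: G'_def coeff_eq_0)
  hence "J (P n * G') = 0" by (intro orthogonal_lower[of n]) auto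
  moreover have "G = G' + smult (coeff G n) (P n)" by (simp add: G'_def)
  hence "P n * G = P n * G' + smult (coeff G n) (P n * P n)" by (metis distrib_left mult_smult_right)
  ultimately show ?thesis by (simp only: J_simps integral_P_P) simp
qed

text \<open>Pairing \<open>r\<close> with \<open>P (degree r)\<close> gives its leading coefficient
  times a nonzero norm; no positivity is involved.\<close>

lemma nondegenerate:
  assumes "\<And>i. i \<ge> n \<Longrightarrow> coeff r i = 0" "\<And>F. degree F < n \<Longrightarrow> J (r * F) = 0"
  shows "r = 0"
proof (rule ccontr)
  assume "r \<noteq> 0"
  hence "coeff r (degree r) \<noteq> 0" by simp
  moreover from this have "degree r < n" using assms(1)[of "degree r"] by (cases "degree r < n") auto
  hence "J (r * P (degree r)) = 0" by (intro assms(2)) simp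
  hence "coeff r (degree r) * jacobi_h \<alpha> \<beta> (degree r) = 0"
    using orthogonal[of r "degree r"] by (simp add: mult.commute)
  ultimately show False using h_nonzero by simp
qed

text \<open>The operator does not raise degrees and the added multiple cancels the coefficient of
  degree \<open>n\<close>. By symmetry what remains is orthogonal to all lower degrees.\<close>

lemma P_ode: "jacobi_op \<alpha> \<beta> (P n) + smult (of_nat n * (of_nat n + \<alpha> + \<beta> + 1)) (P n) = 0"
proof (rule nondegenerate[of n])
  fix i assume "i \<ge> n"
  thus "coeff (jacobi_op \<alpha> \<beta> (P n) + smult (of_nat n * (of_nat n + \<alpha> + \<beta> + 1)) (P n)) i = 0"
    by (cases "i = n") (simp_all add: coeff_jacobi_op coeff_eq_0)
next
  fix F :: "complex poly" assume F: "degree F < n"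
  have "coeff (jacobi_op \<alpha> \<beta> F) i = 0" if "i \<ge> n" for i
    using that F by (simp add: coeff_jacobi_op coeff_eq_0)
  hence "J (P n * jacobi_op \<alpha> \<beta> F) = 0" by (intro orthogonal_lower[of n]) auto
  moreover have "J (P n * F) = 0" using F by (intro orthogonal_lower[of n]) (auto simp: coeff_eq_0)
  ultimately show "J ((jacobi_op \<alpha> \<beta> (P n) + smult (of_nat n * (of_nat n + \<alpha> + \<beta> + 1)) (P n)) * F) = 0"
    by (simp add: distrib_right J_simps jacobi_op_symmetric[OF \<alpha> \<beta>])
qed

text \<open>The value at \<alpha> itself is the norm of \<open>P 0 = 1\<close>, part of
  \<open>monic_jacobi\<close>; all other exponents are reached by unit shifts in both
  directions.\<close>

lemma integral_1:
  assumes "Re (\<alpha> + of_int i) > - 1"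
  shows "jacobi_integral (\<alpha> + of_int i) \<beta> 1 * Gamma (\<alpha> + of_int i + \<beta> + 2) = Gamma (\<alpha> + of_int i + 1) * Gamma (\<beta> + 1)"
proof -
  define T where "T = (\<lambda>a. jacobi_integral a \<beta> 1 * Gamma (a + \<beta> + 2) = Gamma (a + 1) * Gamma (\<beta> + 1))"
  have shift: "T (a + 1) \<longleftrightarrow> T a" if "Re a > - 1" for a
    unfolding T_def by (rule jacobi_integral_1_shift[OF that \<beta>])
  have "P 0 = 1" using degree_P[of 0] coeff_P_same[of 0]
    by (metis degree_eq_zeroE coeff_pCons_0 one_pCons)
  hence "J 1 = jacobi_h \<alpha> \<beta> 0" using integral_P_P[of 0 0] by simp
  moreover have "Gamma (\<alpha> + \<beta> + 2) \<noteq> 0" using \<alpha> \<beta> by (intro Gamma_nonzero_if_Re_pos) auto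
  ultimately have T0: "T \<alpha>" by (simp add: T_def jacobi_h_def)
  have up: "T (\<alpha> + of_nat m)" for m
  proof (induction m)
    case (Suc m)
    thus ?case using shift[of "\<alpha> + of_nat m"] \<alpha> by (simp add: add_ac)
  qed (use T0 in simp)
  have down: "Re (\<alpha> - of_nat m) > - 1 \<Longrightarrow> T (\<alpha> - of_nat m)" for m
  proof (induction m)
    case (Suc m)
    have "T (\<alpha> - of_nat m)" using Suc by simp
    moreover have "\<alpha> - of_nat m = \<alpha> - of_nat (Suc m) + 1" by simp
    ultimately have "T (\<alpha> - of_nat (Suc m) + 1)" by (simp only:)
    thus ?case using shift[OF Suc.prems] by (simp only:)
  qed (use T0 in simp)
  have "T (\<alpha> + of_int i)"
    using up[of "nat i"] down[of "nat (- i)"] assms by (cases "i \<ge> 0") simp_all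
  thus ?thesis by (simp add: T_def)
qed

lemma integral_mellin:
  assumes i: "Re (\<alpha> + of_int i) > - 1" and F: "degree F \<le> d"
  shows "jacobi_integral (\<alpha> + of_int i) \<beta> F = Gamma (\<alpha> + of_int i + 1) / Gamma (\<alpha> + of_int i + \<beta> + 2 + of_nat d) *
           poly (mellin_poly \<alpha> \<beta> d F) (of_int i)"
proof -
  define a where "a = \<alpha> + of_int i"
  have a: "Re a > - 1" using i by (simp add: a_def)
  have "jacobi_integral a \<beta> F = jacobi_integral a \<beta> (\<Sum>j\<le>d. smult (coeff F j) (monom 1 j * 1))"
    using poly_as_sum_of_monoms'[OF F] by (simp add: smult_monom)
  also have "\<dots> = (\<Sum>j\<le>d. coeff F j * jacobi_integral (a + of_nat j) \<beta> 1)"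
    by (simp only: jacobi_integral_sum[OF a \<beta>] jacobi_integral_smult[OF a \<beta>] jacobi_integral_plus_nat)
  also have "\<dots> = (\<Sum>j\<le>d. coeff F j * (Gamma (a + 1) / Gamma (a + \<beta> + 2 + of_nat d) * Gamma (\<beta> + 1) *
     (pochhammer (a + 1) j * pochhammer (a + \<beta> + 2 + of_nat j) (d - j))))"
  proof (intro sum.cong refl arg_cong2[of _ _ _ _ "(*)"])
    fix j assume j: "j \<in> {..d}"
    have nz: "Gamma (a + \<beta> + 2 + of_nat j) \<noteq> 0" "Gamma (a + \<beta> + 2 + of_nat d) \<noteq> 0"
      using a \<beta> by (auto intro!: Gamma_nonzero_if_Re_pos)
    have "Gamma (a + \<beta> + 2 + of_nat d) = pochhammer (a + \<beta> + 2 + of_nat j) (d - j) * Gamma (a + \<beta> + 2 + of_nat j)"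
      using Gamma_plus_nat_if_Re_pos[of "a + \<beta> + 2 + of_nat j" "d - j"] j a \<beta>
      by (simp add: of_nat_diff add_ac)
    moreover have "Gamma (a + of_nat j + 1) = pochhammer (a + 1) j * Gamma (a + 1)"
      using Gamma_plus_nat_if_Re_pos[of "a + 1" j] a by (simp add: add_ac)
    moreover have "jacobi_integral (a + of_nat j) \<beta> 1 * Gamma (a + of_nat j + \<beta> + 2) = Gamma (a + of_nat j + 1) * Gamma (\<beta> + 1)"
      using integral_1[of "i + int j"] a by (simp add: a_def add_ac)
    ultimately show "jacobi_integral (a + of_nat j) \<beta> 1 = Gamma (a + 1) / Gamma (a + \<beta> + 2 + of_nat d) * Gamma (\<beta> + 1) *
     (pochhammer (a + 1) j * pochhammer (a + \<beta> + 2 + of_nat j) (d - j))"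
      using nz by (simp add: divide_simps add_ac)
  qed
  also have "\<dots> = Gamma (a + 1) / Gamma (a + \<beta> + 2 + of_nat d) * poly (mellin_poly \<alpha> \<beta> d F) (of_int i)"
    unfolding poly_mellin_poly a_def[symmetric] by (simp add: sum_distrib_left mult_ac)
  finally show ?thesis by (simp add: a_def)
qed

lemma pochhammer_sum_nonzero: "pochhammer (\<alpha> + \<beta> + of_nat n + 1) n \<noteq> 0"
proof
  assume "pochhammer (\<alpha> + \<beta> + of_nat n + 1) n = 0"
  then obtain k where k: "k < n" "\<alpha> + \<beta> + of_nat n + 1 = - of_nat k"
    by (auto simp: pochhammer_eq_0_iff)
  hence "Re (\<alpha> + \<beta> + of_nat n + 1) = - real k" by simp
  moreover have "real n \<ge> 1" using k(1) by simp
  ultimately show False using \<alpha> \<beta> by simp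
qed

lemma pochhammer_nonzero: "pochhammer (\<alpha> + 1) n \<noteq> 0"
proof
  assume "pochhammer (\<alpha> + 1) n = 0"
  then obtain k where "\<alpha> + 1 = - of_nat k" by (auto simp: pochhammer_eq_0_iff)
  hence "Re (\<alpha> + 1) = - real k" by simp
  thus False using \<alpha> by simp
qed

lemma P_at_1: "pochhammer (\<beta> + 1) n = pochhammer (\<alpha> + \<beta> + of_nat n + 1) n * poly (P n) 1"
  using jacobi_ode_value_1[OF P_ode, of n] by simp

lemma wilson_0: "wilson \<alpha> \<beta> n 0 = 1"
proof -
  have "wilson_basis i 0 = (if i = 0 then 1 else 0)" for i
    by (cases i) (simp_all add: wilson_basis_def pochhammer_rec)
  hence "wilson \<alpha> \<beta> n 0 = (\<Sum>i\<le>n. if i = 0 then wilson_coeff \<alpha> \<beta> n 0 else 0)"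
    unfolding wilson_def by (intro sum.cong) auto
  also have "\<dots> = wilson_coeff \<alpha> \<beta> n 0" by simp
  finally show ?thesis by (simp add: wilson_coeff_def)
qed

lemma wilson_coeff_top:
  "(- 1) ^ n * wilson_coeff \<alpha> \<beta> n n * (fact n * pochhammer (\<alpha> + 1) n * pochhammer (\<alpha> + \<beta> + of_nat n + 1) n) =
     pochhammer (\<beta> + 1) n"
proof -
  have "pochhammer (- \<beta> - of_nat n) n = (- 1) ^ n * pochhammer (\<beta> + 1) n"
    using pochhammer_minus[of "\<beta> + of_nat n" n] by (simp add: minus_add_distrib[symmetric] algebra_simps)
  moreover have "pochhammer (- \<alpha> - \<beta> - 2 * of_nat n) n = (- 1) ^ n * pochhammer (\<alpha> + \<beta> + of_nat n + 1) n"
    using pochhammer_minus[of "\<alpha> + \<beta> + 2 * of_nat n" n] by (simp add: algebra_simps)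
  ultimately have "wilson_coeff \<alpha> \<beta> n n = (- 1) ^ n * pochhammer (\<beta> + 1) n /
      (fact n * pochhammer (\<alpha> + 1) n * pochhammer (\<alpha> + \<beta> + of_nat n + 1) n)"
    by (cases "even n") (simp_all add: wilson_coeff_def pochhammer_same power2_eq_square)
  thus ?thesis using pochhammer_sum_nonzero[of n] pochhammer_nonzero[of n] by simp
qed

lemma square_mellin_recurrence:
  "wilson_op \<alpha> \<beta> n (poly (mellin_poly \<alpha> \<beta> (2 * n) (P n * P n))) (of_nat k) = 0"
proof -
  define Q where "Q = poly (mellin_poly \<alpha> \<beta> (2 * n) (P n * P n))"
  define \<sigma> where "\<sigma> = \<alpha> + \<beta> + 2 * of_nat n + 1"
  define A where "A = (\<lambda>k. jacobi_integral (\<alpha> + of_nat k) \<beta> (P n * P n))"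
  have deg: "degree (P n * P n) \<le> 2 * n" using degree_mult_le[of "P n" "P n"] by simp
  have A: "A k = Gamma (\<alpha> + of_nat k + 1) / Gamma (\<sigma> + of_nat k + 1) * Q (of_nat k)" for k
    using integral_mellin[of "int k", OF _ deg] \<alpha> by (simp add: A_def Q_def \<sigma>_def add_ac)
  define g where "g = Gamma (\<alpha> + of_nat k + 1) / Gamma (\<sigma> + of_nat k + 1)"
  have G0: "Gamma (\<alpha> + of_nat k + 1) \<noteq> 0" "Gamma (\<sigma> + of_nat k + 1) \<noteq> 0"
    using \<alpha> \<beta> by (auto intro!: Gamma_nonzero_if_Re_pos simp: \<sigma>_def)
  hence g0: "g \<noteq> 0" by (simp add: g_def)
  have s0: "\<sigma> + of_nat k + 1 \<noteq> 0" using \<alpha> \<beta> by (auto simp: \<sigma>_def complex_eq_iff)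
  have a0: "A k = g * Q (of_nat k)" by (simp add: A g_def)
  have "Gamma (\<alpha> + of_nat (Suc k) + 1) = (\<alpha> + of_nat k + 1) * Gamma (\<alpha> + of_nat k + 1)"
    using Gamma_plus1_if_Re_pos[of "\<alpha> + of_nat k + 1"] \<alpha> by (simp add: add_ac)
  moreover have "Gamma (\<sigma> + of_nat (Suc k) + 1) = (\<sigma> + of_nat k + 1) * Gamma (\<sigma> + of_nat k + 1)"
    using Gamma_plus1_if_Re_pos[of "\<sigma> + of_nat k + 1"] \<alpha> \<beta> by (simp add: add_ac \<sigma>_def)
  ultimately have "A (Suc k) = (\<alpha> + of_nat k + 1) * g / (\<sigma> + of_nat k + 1) * Q (of_nat (Suc k))"
    unfolding A g_def by simp
  hence a1: "A (Suc k) * (\<sigma> + of_nat k + 1) = g * (\<alpha> + of_nat k + 1) * Q (of_nat k + 1)"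
    using s0 by (simp add: add_ac)
  \<comment> \<open>The factor k + \<alpha> of k^2 - \<alpha>^2 absorbs the Gamma step; at
    \<open>k = 0\<close> the prefactor hides the truncated \<open>k - 1\<close>.\<close>
  have am: "of_nat k * (of_nat k ^ 2 - \<alpha> ^ 2) * A (k - 1) = g * (of_nat k * (of_nat k - \<alpha>) * (of_nat k + \<sigma>) * Q (of_nat k - 1))"
  proof (cases k)
    case (Suc j)
    have "Gamma (\<alpha> + of_nat j + 1) \<noteq> 0" "Gamma (\<sigma> + of_nat j + 1) \<noteq> 0"
      using \<alpha> \<beta> by (auto intro!: Gamma_nonzero_if_Re_pos simp: \<sigma>_def)
    moreover have "Gamma (\<alpha> + of_nat k + 1) = (\<alpha> + of_nat k) * Gamma (\<alpha> + of_nat j + 1)"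
      using Gamma_plus1_if_Re_pos[of "\<alpha> + of_nat j + 1"] \<alpha> by (simp add: add_ac Suc)
    moreover have "Gamma (\<sigma> + of_nat k + 1) = (\<sigma> + of_nat k) * Gamma (\<sigma> + of_nat j + 1)"
      using Gamma_plus1_if_Re_pos[of "\<sigma> + of_nat j + 1"] \<alpha> \<beta> by (simp add: add_ac \<sigma>_def Suc)
    moreover have "\<sigma> + of_nat k \<noteq> 0" using \<alpha> \<beta> Suc by (auto simp: \<sigma>_def complex_eq_iff)
    ultimately have "g * (\<sigma> + of_nat k) = (\<alpha> + of_nat k) * (Gamma (\<alpha> + of_nat j + 1) / Gamma (\<sigma> + of_nat j + 1))"
      by (simp add: g_def)
    moreover have "A (k - 1) = Gamma (\<alpha> + of_nat j + 1) / Gamma (\<sigma> + of_nat j + 1) * Q (of_nat k - 1)"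
      using A[of j] by (simp add: Suc)
    ultimately have "(\<alpha> + of_nat k) * A (k - 1) = g * (\<sigma> + of_nat k) * Q (of_nat k - 1)" by simp
    thus ?thesis by algebra
  qed simp
  have "of_nat k * (of_nat k ^ 2 - \<alpha> ^ 2) * A (k - 1) + wilson_middle \<alpha> \<beta> n (of_nat k) * A k +
     (of_nat k + 1) * ((of_nat k + 1) ^ 2 - \<sigma> ^ 2) * A (Suc k) = 0"
    unfolding A_def \<sigma>_def by (rule jacobi_square_recurrence[OF \<alpha> \<beta> P_ode])
  hence "g * wilson_op \<alpha> \<beta> n Q (of_nat k) = 0"
    using am a0 a1 unfolding wilson_op_def \<sigma>_def[symmetric] by algebra
  thus ?thesis using g0 by (simp add: Q_def)
qed

text \<open>
  The recurrence determines the values at \<open>0, \<dots>, 2 n - 1\<close> from the value at 0. It need not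
  determine the next one, because the coefficient of the value at \<open>k + 1\<close> vanishes for
  \<open>k + 1 = \<alpha> + \<beta> + 2 n + 1\<close>; the leading coefficient is used instead.
\<close>
lemma mellin_poly_square:
  "mellin_poly \<alpha> \<beta> (2 * n) (P n * P n) =
     smult (jacobi_h \<alpha> \<beta> n * Gamma (\<alpha> + \<beta> + 2 * of_nat n + 2) / Gamma (\<alpha> + 1)) (wilson_poly \<alpha> \<beta> n)"
  (is "?Q = smult ?c ?S")
proof (rule poly_eqI_degree_lead_coeff[of _ "2 * n" _ "of_nat ` {..<2 * n}"])
  have deg: "degree (P n * P n) \<le> 2 * n" using degree_mult_le[of "P n" "P n"] by simp
  have G: "Gamma (\<alpha> + 1) \<noteq> 0" "Gamma (\<alpha> + \<beta> + 2 * of_nat n + 2) \<noteq> 0"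
    using \<alpha> \<beta> by (auto intro!: Gamma_nonzero_if_Re_pos)
  show "degree ?Q \<le> 2 * n" by (rule degree_mellin_poly)
  show "degree (smult ?c ?S) \<le> 2 * n" by (rule order_trans[OF degree_smult_le degree_wilson_poly])
  show "2 * n \<le> card ((of_nat :: nat \<Rightarrow> complex) ` {..<2 * n})" by (simp add: card_image)
  \<comment> \<open>The left coefficient contains the square of \<open>poly (P n) 1\<close>; after
    multiplication by \<open>?AB * ?AB\<close> everything is expressed by Pochhammer symbols through
    \<open>P_at_1\<close> and \<open>h_times_Gamma\<close>.\<close>
  show "coeff ?Q (2 * n) = coeff (smult ?c ?S) (2 * n)"
  proof -
    let ?B = "pochhammer (\<beta> + 1) n" and ?A = "pochhammer (\<alpha> + 1) n" and ?AB = "pochhammer (\<alpha> + \<beta> + of_nat n + 1) n"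
    define c where "c = ?c"
    have c: "c * ?AB = fact n * ?A * ?B * Gamma (\<beta> + 1)"
      using h_times_Gamma[of n] G by (simp add: c_def field_simps)
    have "coeff (smult c ?S) (2 * n) * (?AB * ?AB) * (fact n * ?A) =
        (c * ?AB) * ((- 1) ^ n * wilson_coeff \<alpha> \<beta> n n * (fact n * ?A * ?AB))"
      by (simp add: coeff_wilson_poly)
    also have "\<dots> = Gamma (\<beta> + 1) * ?B * ?B * (fact n * ?A)" unfolding wilson_coeff_top c by simp
    also have "\<dots> = coeff ?Q (2 * n) * (?AB * ?AB) * (fact n * ?A)"
      unfolding coeff_mellin_poly[OF deg] P_at_1[of n] by simp
    finally have "coeff ?Q (2 * n) = coeff (smult c ?S) (2 * n)"
      using pochhammer_sum_nonzero[of n] pochhammer_nonzero[of n] by (simp del: coeff_smult)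
    thus ?thesis by (simp only: c_def)
  qed
  have "poly ?Q (of_nat k) = ?c * wilson \<alpha> \<beta> n (of_nat k)" if "k < 2 * n" for k
    using that
  proof (induction k rule: less_induct)
    case (less k)
    show ?case
    proof (cases k)
      case 0
      have "jacobi_h \<alpha> \<beta> n = Gamma (\<alpha> + 1) / Gamma (\<alpha> + \<beta> + 2 + of_nat (2 * n)) * poly ?Q 0"
        using integral_mellin[of 0, OF _ deg] \<alpha> integral_P_P[of n n] by simp
      thus ?thesis using G by (simp add: 0 wilson_0 add_ac)
    next
      case (Suc j)
      have j: "poly ?Q (of_nat j) = ?c * wilson \<alpha> \<beta> n (of_nat j)" using less Suc by simp
      \<comment> \<open>Multiplied by \<open>of_nat j\<close> because for \<open>j = 0\<close> there
        is no preceding value to know.\<close>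
      have jm: "of_nat j * poly ?Q (of_nat j - 1) = of_nat j * (?c * wilson \<alpha> \<beta> n (of_nat j - 1))"
        using less.IH[of "j - 1"] less.prems Suc by (cases j) simp_all
      have n: "n > 0" using less.prems by auto
      have s1: "n = 1 \<longrightarrow> \<alpha> + \<beta> + 2 * of_nat n \<noteq> 0" using \<alpha> \<beta> by (auto simp: complex_eq_iff)
      have q: "wilson_op \<alpha> \<beta> n (poly ?Q) (of_nat j) = 0" by (rule square_mellin_recurrence)
      have w: "wilson_op \<alpha> \<beta> n (wilson \<alpha> \<beta> n) (of_nat j) = 0" by (rule wilson_op_wilson[OF \<alpha> \<beta> s1])
      have "(of_nat j + 1) * (of_nat j + 1 + \<alpha>) * (of_nat j + 1 - (\<alpha> + \<beta> + 2 * of_nat n + 1)) *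
          (poly ?Q (of_nat j + 1) - ?c * wilson \<alpha> \<beta> n (of_nat j + 1)) = 0"
        using q w j jm unfolding wilson_op_def by algebra
      moreover have "of_nat j + 1 \<noteq> (0 :: complex)" using of_nat_Suc[of j, where 'a = complex] of_nat_neq_0[of j, where 'a = complex] by (simp add: add.commute)
      moreover have "of_nat j + 1 + \<alpha> \<noteq> 0" using \<alpha> by (auto simp: complex_eq_iff)
      \<comment> \<open>Here \<open>j \<le> 2 * n - 2\<close>, which is less than the real part of
        \<alpha> + \<beta> + 2 n.\<close>
      moreover have "of_nat j + 1 - (\<alpha> + \<beta> + 2 * of_nat n + 1) \<noteq> 0"
      proof
        assume "of_nat j + 1 - (\<alpha> + \<beta> + 2 * of_nat n + 1) = 0"
        hence "real j = Re \<alpha> + Re \<beta> + 2 * real n" by (simp add: complex_eq_iff)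
        moreover have "real j \<le> 2 * real n - 2" using less.prems Suc by linarith
        ultimately show False using \<alpha> \<beta> by simp
      qed
      ultimately have "poly ?Q (of_nat j + 1) - ?c * wilson \<alpha> \<beta> n (of_nat j + 1) = 0"
        unfolding mult_eq_0_iff by blast
      thus ?thesis by (simp add: Suc add.commute)
    qed
  qed
  thus "poly ?Q z = poly (smult ?c ?S) z" if "z \<in> of_nat ` {..<2 * n}" for z
    using that by (auto simp: poly_wilson_poly)
qed

text \<open>Negative \<open>i\<close> is covered because \<open>mellin_poly_square\<close> is an
  identity of polynomials.\<close>

theorem integral_square:
  assumes "Re (\<alpha> + of_int i) > - 1"
  shows "jacobi_integral (\<alpha> + of_int i) \<beta> (P n * P n) = jacobi_h \<alpha> \<beta> n * Gamma (\<alpha> + \<beta> + 2 * of_nat n + 2) / Gamma (\<alpha> + 1) *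
     (Gamma (\<alpha> + of_int i + 1) / Gamma (\<alpha> + \<beta> + 2 * of_nat n + 2 + of_int i)) * wilson \<alpha> \<beta> n (of_int i)"
proof -
  have deg: "degree (P n * P n) \<le> 2 * n" using degree_mult_le[of "P n" "P n"] by simp
  show ?thesis unfolding integral_mellin[OF assms deg] mellin_poly_square
    by (simp add: poly_wilson_poly add_ac mult_ac)
qed

end

subsection \<open>Moments of products\<close>

lemma hypergeo_4F3_terminating:
  "hypergeo_4F3 [a, b, c, - of_nat n] [d, e, f] 1 =
     (\<Sum>i\<le>n. pochhammer a i * pochhammer b i * pochhammer c i * pochhammer (- of_nat n) i /
        (pochhammer d i * pochhammer e i * pochhammer f i * fact i))"
proof -
  have "hypergeo_4F3 [a, b, c, - of_nat n] [d, e, f] 1 = 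
    (\<Sum>i. pochhammer a i * pochhammer b i * pochhammer c i * pochhammer (- of_nat n) i /
        (pochhammer d i * pochhammer e i * pochhammer f i * fact i))"
    by (simp add: hypergeo_4F3_def eval_fps_def)
  also have "\<dots> = (\<Sum>i\<le>n. pochhammer a i * pochhammer b i * pochhammer c i * pochhammer (- of_nat n) i /
        (pochhammer d i * pochhammer e i * pochhammer f i * fact i))"
    by (rule suminf_finite) (auto simp: pochhammer_of_nat_eq_0_iff)
  finally show ?thesis .
qed

lemma wilson_eq_hypergeo:
  "hypergeo_4F3 [- of_nat l, of_nat l + 1, 1 - \<beta> - of_nat (Suc n), 1 - of_nat (Suc n)]
     [1, \<alpha> + 1, 2 - \<alpha> - \<beta> - 2 * of_nat (Suc n)] 1 = wilson \<alpha> \<beta> n (of_nat l)"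
proof -
  have "1 - of_nat (Suc n) = (- of_nat n :: complex)" "1 - \<beta> - of_nat (Suc n) = - \<beta> - of_nat n"
    "2 - \<alpha> - \<beta> - 2 * of_nat (Suc n) = - \<alpha> - \<beta> - 2 * of_nat n" by simp_all
  thus ?thesis
    by (simp only: hypergeo_4F3_terminating wilson_def wilson_coeff_def wilson_basis_def)
       (simp add: pochhammer_fact[symmetric] power2_eq_square mult_ac)
qed

lemma jacobi_B_eq_wilson:
  "jacobi_B \<alpha> \<beta> (Suc n) l =
     pochhammer (\<alpha> + 1) l / pochhammer (\<alpha> + \<beta> + 2 * of_nat n + 1) (l + 1) * wilson \<alpha> \<beta> n (of_nat l)"
proof -
  have "\<alpha> + \<beta> + 2 * of_nat (Suc n) - 1 = \<alpha> + \<beta> + 2 * of_nat n + 1" by simp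
  thus ?thesis unfolding jacobi_B_def wilson_eq_hypergeo by (simp only:)
qed

text \<open>The series of \<open>jacobi_A\<close> with \<open>l\<close> replaced by a complex
  \<open>k\<close>. \<open>fact (Suc j)\<close> is the Pochhammer symbol of the lower parameter 2,
  and the upper parameter \<open>1 - N\<close> ends the sum.\<close>

definition wilson_A :: "complex \<Rightarrow> complex \<Rightarrow> nat \<Rightarrow> complex \<Rightarrow> complex" where
  "wilson_A \<alpha> \<beta> N k = (\<Sum>j<N. pochhammer (1 - k) j * pochhammer (k + 2) j *
      (pochhammer (1 - \<beta> - of_nat N) j * pochhammer (1 - of_nat N) j /
        (fact j * fact (Suc j) * pochhammer (\<alpha> + 2) j * pochhammer (2 - \<alpha> - \<beta> - 2 * of_nat N) j)))"

lemma wilson_A_eq_hypergeo: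
  assumes "N > 0"
  shows "hypergeo_4F3 [1 - of_nat l, of_nat l + 2, 1 - \<beta> - of_nat N, 1 - of_nat N]
     [2, \<alpha> + 2, 2 - \<alpha> - \<beta> - 2 * of_nat N] 1 = wilson_A \<alpha> \<beta> N (of_nat l)"
proof -
  obtain n where n: "N = Suc n" using assms by (cases N) auto
  have "1 - of_nat N = (- of_nat n :: complex)" by (simp add: n)
  moreover have "pochhammer 2 j = (fact (Suc j) :: complex)" for j
    using pochhammer_rec[of "1 :: complex" j] by (simp add: pochhammer_fact)
  ultimately show ?thesis
    unfolding wilson_A_def
    by (simp only: hypergeo_4F3_terminating n lessThan_Suc_atMost) (simp add: mult_ac)
qed

lemma wilson_A_reflect: "wilson_A \<alpha> \<beta> N (- 1 - k) = wilson_A \<alpha> \<beta> N k"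
proof -
  have "1 - (- 1 - k) = k + 2" "- 1 - k + 2 = 1 - k" by simp_all
  thus ?thesis unfolding wilson_A_def by (simp only: mult_ac)
qed

lemma wilson_basis_Suc_shifted:
  "wilson_basis (Suc j) k = - k * (k + 1) * (pochhammer (1 - k) j * pochhammer (k + 2) j)"
  unfolding wilson_basis_def pochhammer_rec by (simp add: algebra_simps)

text \<open>Each summand of \<open>wilson_shift_sum\<close> with index \<open>Suc j\<close> splits
  off \<open>- k * (k + 1)\<close> and the first factors of its Pochhammer symbols. Then
  \<open>k + 1\<close> is cancelled, hence the condition on \<open>k\<close>.\<close>

lemma wilson_A_from_shift:
  assumes ab: "Re \<alpha> > - 1" "Re \<beta> > - 1" and N: "N > 0"
    and s1: "\<alpha> + \<beta> + 2 * of_nat N \<noteq> 1" and k: "k + 1 \<noteq> 0"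
  defines "s \<equiv> \<alpha> + \<beta> + 2 * of_nat N"
  shows "(k + 1 + \<alpha>) * wilson \<alpha> \<beta> N (k + 1) - (k + 1 + \<alpha> + 2 * (of_nat N * (\<beta> + of_nat N) / s)) * wilson \<alpha> \<beta> N k =
     2 * k * (s + 1 + k) * (of_nat N * (\<alpha> + of_nat N) * (\<beta> + of_nat N) * (\<alpha> + \<beta> + of_nat N)) /
       ((\<alpha> + 1) * s ^ 2 * (s - 1)) * wilson_A \<alpha> \<beta> N k"
proof -
  have s0: "s \<noteq> 0"
  proof
    assume "s = 0"
    hence "Re s = 0" by simp
    moreover have "real N \<ge> 1" using N by simp
    ultimately show False using ab by (simp add: s_def)
  qed
  define C where "C = 2 * (\<alpha> + of_nat N) * (\<alpha> + \<beta> + of_nat N)"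
  define \<tau> where "\<tau> = (\<lambda>i. C * of_nat i * wilson_coeff \<alpha> \<beta> N i / (s * (of_nat i - s)))"
  define K where "K = C * of_nat N * (\<beta> + of_nat N) / ((\<alpha> + 1) * s ^ 2 * (s - 1))"
  define d where "d = (\<lambda>j. pochhammer (1 - \<beta> - of_nat N) j * pochhammer (1 - of_nat N) j /
        (fact j * fact (Suc j) * pochhammer (\<alpha> + 2) j * pochhammer (2 - s) j))"
  have tau: "\<tau> (Suc j) = K * d j" if "j < N" for j
  proof -
    have 1: "pochhammer (- \<beta> - of_nat N) (Suc j) = - (\<beta> + of_nat N) * pochhammer (1 - \<beta> - of_nat N) j"
      by (simp add: pochhammer_rec add.commute[of _ 1] add_diff_eq)
    have 2: "pochhammer (- of_nat N) (Suc j) = - of_nat N * pochhammer (1 - of_nat N :: complex) j"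
      by (simp add: pochhammer_rec)
    have 3: "pochhammer (\<alpha> + 1) (Suc j) = (\<alpha> + 1) * pochhammer (\<alpha> + 2) j"
      by (simp add: pochhammer_rec add.assoc)
    have 4: "pochhammer (- s) (Suc j) * (of_nat (Suc j) - s) = s * (s - 1) * pochhammer (2 - s) j"
    proof -
      have "pochhammer (- s) (Suc (Suc j)) = pochhammer (- s) (Suc j) * (of_nat (Suc j) - s)"
        by (simp only: pochhammer_Suc[of _ "Suc j"] uminus_add_conv_diff add.commute[of "- s"])
      moreover have "pochhammer (- s) (Suc (Suc j)) = (- s) * ((1 - s) * pochhammer (2 - s) j)"
        by (simp add: pochhammer_rec algebra_simps)
      ultimately show ?thesis by (simp add: algebra_simps)
    qed
    have 5: "- \<alpha> - \<beta> - 2 * of_nat N = - s" by (simp add: s_def)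
    have frac: "(- x * A) * (- y * B) / (F * (u * U) * V) / v = (x * y * (A * B)) / (F * u * U * (V * v))"
      for x A y B F u U V v :: complex by (simp add: mult_ac)
    have "wilson_coeff \<alpha> \<beta> N (Suc j) / (of_nat (Suc j) - s) =
       ((\<beta> + of_nat N) * of_nat N * (pochhammer (1 - \<beta> - of_nat N) j * pochhammer (1 - of_nat N) j)) /
        (fact (Suc j) ^ 2 * (\<alpha> + 1) * pochhammer (\<alpha> + 2) j * (pochhammer (- s) (Suc j) * (of_nat (Suc j) - s)))"
      unfolding wilson_coeff_def 1 2 3 5 by (rule frac)
    also have "\<dots> = (\<beta> + of_nat N) * of_nat N * (pochhammer (1 - \<beta> - of_nat N) j * pochhammer (1 - of_nat N) j) /
        (fact (Suc j) ^ 2 * (\<alpha> + 1) * pochhammer (\<alpha> + 2) j * (s * (s - 1) * pochhammer (2 - s) j))"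
      unfolding 4 ..
    also have "\<dots> * (C * of_nat (Suc j) / s) = K * d j"
    proof -
      have "(fact (Suc j) ^ 2 :: complex) = fact (Suc j) * (of_nat (Suc j) * fact j)"
        by (simp add: power2_eq_square)
      moreover have "(of_nat (Suc j) :: complex) \<noteq> 0" by (rule of_nat_neq_0)
      ultimately show ?thesis
        by (simp add: K_def d_def power2_eq_square mult_ac del: fact_Suc of_nat_Suc)
    qed
    finally show ?thesis by (simp add: \<tau>_def mult_ac del: of_nat_Suc)
  qed
  have "(\<Sum>i\<le>N. \<tau> i * wilson_basis i k) = \<tau> 0 * wilson_basis 0 k + (\<Sum>j<N. \<tau> (Suc j) * wilson_basis (Suc j) k)"
    by (simp add: sum.atMost_shift)
  also have "\<tau> 0 = 0" by (simp add: \<tau>_def)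
  also have "(\<Sum>j<N. \<tau> (Suc j) * wilson_basis (Suc j) k) = - k * (k + 1) * K * wilson_A \<alpha> \<beta> N k"
    unfolding wilson_A_def sum_distrib_left
  proof (intro sum.cong refl)
    fix j assume "j \<in> {..<N}"
    hence "\<tau> (Suc j) = K * d j" using tau by simp
    thus "\<tau> (Suc j) * wilson_basis (Suc j) k = - k * (k + 1) * K * (pochhammer (1 - k) j * pochhammer (k + 2) j *
      (pochhammer (1 - \<beta> - of_nat N) j * pochhammer (1 - of_nat N) j /
        (fact j * fact (Suc j) * pochhammer (\<alpha> + 2) j * pochhammer (2 - \<alpha> - \<beta> - 2 * of_nat N) j)))"
      by (simp add: wilson_basis_Suc_shifted d_def s_def diff_diff_eq mult_ac del: fact_Suc)
  qed
  finally have S: "(\<Sum>i\<le>N. \<tau> i * wilson_basis i k) = - k * (k + 1) * K * wilson_A \<alpha> \<beta> N k" by simp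
  have "N = 1 \<longrightarrow> \<alpha> + \<beta> + 2 * of_nat N \<noteq> 0" "N = 1 \<longrightarrow> \<alpha> + \<beta> + 2 * of_nat N \<noteq> 1"
    using s0 s1 by (auto simp: s_def)
  from wilson_shift_sum[OF ab N this, of k, folded s_def]
  have "(k + 1) * ((k + 1 + \<alpha>) * wilson \<alpha> \<beta> N (k + 1) - (k + 1 + \<alpha> + 2 * (of_nat N * (\<beta> + of_nat N) / s)) * wilson \<alpha> \<beta> N k) =
      - (s + 1 + k) * (- k * (k + 1) * K * wilson_A \<alpha> \<beta> N k)"
    unfolding S[symmetric] \<tau>_def C_def .
  also have "\<dots> = (k + 1) * (k * (s + 1 + k) * K * wilson_A \<alpha> \<beta> N k)" by algebra
  finally have "(k + 1 + \<alpha>) * wilson \<alpha> \<beta> N (k + 1) - (k + 1 + \<alpha> + 2 * (of_nat N * (\<beta> + of_nat N) / s)) * wilson \<alpha> \<beta> N k =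
     k * (s + 1 + k) * K * wilson_A \<alpha> \<beta> N k"
    using k by (simp only: mult_cancel_left simp_thms)
  thus ?thesis
    by (simp only: K_def C_def times_divide_eq_right times_divide_eq_left mult_ac)
qed


section \<open>Structure relation and mixed moments\<close>

context jacobi_polys
begin

lemma sum_param_nonzero: "N > 0 \<Longrightarrow> \<alpha> + \<beta> + 2 * of_nat N \<noteq> 0"
proof
  assume "N > 0" "\<alpha> + \<beta> + 2 * of_nat N = 0"
  hence "Re (\<alpha> + \<beta> + 2 * of_nat N) = 0" "real N \<ge> 1" by simp_all
  thus False using \<alpha> \<beta> by simp
qed

lemma P_subleading:
  "(\<alpha> + \<beta> + 2 * of_nat (Suc m)) * coeff (P (Suc m)) m = - of_nat (Suc m) * (\<alpha> + of_nat (Suc m))"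
proof -
  have "of_nat (Suc m) * (of_nat m + \<alpha> + 1) * 1 =
     (of_nat m - of_nat (Suc m)) * (of_nat m + of_nat (Suc m) + \<alpha> + \<beta> + 1) * coeff (P (Suc m)) m"
    using jacobi_ode_coeff[OF P_ode[of "Suc m"], of m] unfolding coeff_P_same .
  thus ?thesis unfolding of_nat_Suc by algebra
qed

text \<open>
  The difference of both sides has degree less than \<open>N\<close> and is orthogonal to all polynomials of
  degree less than \<open>N\<close>.
\<close>
lemma structure_relation:
  fixes N :: nat
  assumes N: "N > 0"
  defines "s \<equiv> \<alpha> + \<beta> + 2 * of_nat N"
  shows "[:0, 1, - 1:] * pderiv (P N) = [:of_nat N * (\<beta> + of_nat N) / s, - of_nat N:] * P N +
     smult ((s + 1) * jacobi_h \<alpha> \<beta> N / jacobi_h \<alpha> \<beta> (N - 1)) (P (N - 1))"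
proof -
  obtain m where m: "N = Suc m" using N by (cases N) auto
  \<comment> \<open>With \<open>- of_nat N\<close> removing degree \<open>N + 1\<close>, this
    constant removes degree \<open>N\<close>; it is the subleading coefficient of \<open>P N\<close>
    plus \<open>N\<close>.\<close>
  define e where "e = of_nat N * (\<beta> + of_nat N) / s"
  define g where "g = (s + 1) * jacobi_h \<alpha> \<beta> N / jacobi_h \<alpha> \<beta> m"
  define r where "r = [:0, 1, - 1:] * pderiv (P N) - [:e, - of_nat N:] * P N - smult g (P m)"
  have s0: "s \<noteq> 0" unfolding s_def by (rule sum_param_nonzero[OF N])
  hence se: "s * e = of_nat N * (\<beta> + of_nat N)" by (simp add: e_def)
  have "r = 0"
  proof (rule nondegenerate[of N])
    fix i assume i: "i \<ge> N"
    then obtain j where j: "i = Suc j" using m by (cases i) auto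
    have c: "coeff r i = of_nat i * coeff (P N) i - of_nat j * coeff (P N) j - e * coeff (P N) i + of_nat N * coeff (P N) j"
      using i m j by (cases j) (simp_all add: r_def mult_pCons_left coeff_pderiv coeff_eq_0 algebra_simps)
    show "coeff r i = 0"
    proof (cases "i = N")
      case True
      hence "j = m" using j m by simp
      hence "coeff r i = of_nat N + coeff (P N) m - e" using c True m by (simp add: algebra_simps)
      moreover have "s * (of_nat N + coeff (P N) m - e) = 0"
        using P_subleading[of m] se unfolding m[symmetric] s_def by algebra
      ultimately show ?thesis using s0 by simp
    next
      case False
      thus ?thesis using i j unfolding c by (cases "j = N") (simp_all add: coeff_eq_0 algebra_simps)
    qed
  next
    fix F :: "complex poly" assume F: "degree F < N"
    let ?f = "coeff F m"
    have hi: "coeff F i = 0" if "i \<ge> N" for i using F that by (simp add: coeff_eq_0)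
    define G where "G = [:\<alpha> + 1, - (\<alpha> + \<beta> + 2):] * F + [:0, 1, - 1:] * pderiv F"
    have "[:\<alpha> + 1, - (\<alpha> + \<beta> + 2):] * (P N * F) + [:0, 1, - 1:] * pderiv (P N * F) =
       P N * G + [:0, 1, - 1:] * pderiv (P N) * F"
      unfolding G_def by (rule poly_ext, simp only: poly_eval) algebra
    hence 1: "J ([:0, 1, - 1:] * pderiv (P N) * F) = - J (P N * G)"
      using jacobi_integral_by_parts[OF \<alpha> \<beta>, of "P N * F"] by (simp only: J_simps) (simp add: eq_neg_iff_add_eq_0 add.commute)
    have G: "coeff G (Suc i) = (\<alpha> + 1) * coeff F (Suc i) - (\<alpha> + \<beta> + 2 + of_nat i) * coeff F i + of_nat (Suc i) * coeff F (Suc i)" for i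
      by (cases i) (simp_all add: G_def mult_pCons_left coeff_pderiv algebra_simps)
    have G_deg: "degree G \<le> N"
    proof (rule degree_le, intro allI impI)
      fix i assume "N < i"
      thus "coeff G i = 0" using hi by (cases i) (simp_all add: G)
    qed
    have 2: "J (P N * G) = - (\<alpha> + \<beta> + of_nat N + 1) * ?f * jacobi_h \<alpha> \<beta> N"
    proof -
      have "coeff G N = - (\<alpha> + \<beta> + of_nat N + 1) * ?f"
        unfolding m G using hi[of N] m by (simp add: algebra_simps)
      thus ?thesis using orthogonal[OF G_deg] by (simp only:)
    qed
    have "degree ([:e, - of_nat N:] * F) \<le> N"
      using degree_mult_le[of "[:e, - of_nat N:]" F] F m by (auto split: if_splits)
    hence 3: "J (P N * ([:e, - of_nat N:] * F)) = - of_nat N * ?f * jacobi_h \<alpha> \<beta> N"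
      using orthogonal[of "[:e, - of_nat N:] * F" N] hi[of N] by (simp add: m mult_pCons_left del: of_nat_Suc)
    have 4: "J (P m * F) = ?f * jacobi_h \<alpha> \<beta> m" using orthogonal[of F m] F m by simp
    have "r * F = [:0, 1, - 1:] * pderiv (P N) * F - P N * ([:e, - of_nat N:] * F) - smult g (P m * F)"
      unfolding r_def by (rule poly_ext, simp only: poly_eval) algebra
    hence "J (r * F) = J ([:0, 1, - 1:] * pderiv (P N) * F) - J (P N * ([:e, - of_nat N:] * F)) - g * J (P m * F)"
      by (simp only: J_simps)
    also have "\<dots> = 0"
      \<comment> \<open>The contributions \<alpha> + \<beta> + N + 1 and N add up to s + 1, which
        fixes \<open>g\<close>.\<close>
      unfolding 1 2 3 4 g_def s_def using h_nonzero[of m] by (simp add: field_simps)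
    finally show "J (r * F) = 0" .
  qed
  thus ?thesis by (simp add: r_def e_def g_def m algebra_simps)
qed

text \<open>Integration by parts for the square of \<open>P N\<close>, with its derivative replaced
  by the structure relation. At \<open>i = - 1\<close> this relation is used directly.\<close>

lemma integral_product_eq_squares:
  fixes N :: nat and i :: int
  assumes N: "N > 0" and i: "Re (\<alpha> + of_int i) > - 1"
  defines "s \<equiv> \<alpha> + \<beta> + 2 * of_nat N"
  shows "2 * (s + 1) * jacobi_h \<alpha> \<beta> N / jacobi_h \<alpha> \<beta> (N - 1) * jacobi_integral (\<alpha> + of_int i) \<beta> (P N * P (N - 1)) =
     (s + of_int i + 2) * jacobi_integral (\<alpha> + of_int (i + 1)) \<beta> (P N * P N) -
     (\<alpha> + of_int i + 1 + 2 * (of_nat N * (\<beta> + of_nat N) / s)) * jacobi_integral (\<alpha> + of_int i) \<beta> (P N * P N)"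
proof -
  define a e g where "a = \<alpha> + of_int i" and "e = of_nat N * (\<beta> + of_nat N) / s"
    and "g = (s + 1) * jacobi_h \<alpha> \<beta> N / jacobi_h \<alpha> \<beta> (N - 1)"
  let ?p = "P N" and ?q = "P (N - 1)"
  have a: "Re a > - 1" using i by (simp add: a_def)
  have st: "x * (1 - x) * poly (pderiv ?p) x = (e - of_nat N * x) * poly ?p x + g * poly ?q x" for x
    using arg_cong[OF structure_relation[OF N, folded s_def, folded e_def g_def], of "\<lambda>p. poly p x"]
    unfolding poly_eval by algebra
  have "[:a + 1, - (a + \<beta> + 2):] * (?p * ?p) + [:0, 1, - 1:] * pderiv (?p * ?p) =
      smult (a + 1 + 2 * e) (?p * ?p) - smult (s + of_int i + 2) (monom 1 1 * (?p * ?p)) + smult (2 * g) (?p * ?q)"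
  proof (rule poly_ext)
    fix x
    show "poly ([:a + 1, - (a + \<beta> + 2):] * (?p * ?p) + [:0, 1, - 1:] * pderiv (?p * ?p)) x =
      poly (smult (a + 1 + 2 * e) (?p * ?p) - smult (s + of_int i + 2) (monom 1 1 * (?p * ?p)) + smult (2 * g) (?p * ?q)) x"
      using st[of x] unfolding poly_eval poly_monom power_one_right a_def s_def by algebra
  qed
  hence "jacobi_integral a \<beta> (smult (a + 1 + 2 * e) (?p * ?p) - smult (s + of_int i + 2) (monom 1 1 * (?p * ?p)) + smult (2 * g) (?p * ?q)) = 0"
    using jacobi_integral_by_parts[OF a \<beta>, of "?p * ?p"] by (simp only:)
  moreover have "jacobi_integral a \<beta> (monom 1 1 * (?p * ?p)) = jacobi_integral (\<alpha> + of_int (i + 1)) \<beta> (?p * ?p)"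
    using jacobi_integral_plus_nat[of a 1 \<beta> "?p * ?p"] by (simp add: a_def add_ac)
  ultimately have "2 * g * jacobi_integral a \<beta> (?p * ?q) = (s + of_int i + 2) * jacobi_integral (\<alpha> + of_int (i + 1)) \<beta> (?p * ?p) -
     (a + 1 + 2 * e) * jacobi_integral a \<beta> (?p * ?p)"
    by (simp only: jacobi_integral_add[OF a \<beta>] jacobi_integral_diff[OF a \<beta>] jacobi_integral_smult[OF a \<beta>]) algebra
  moreover have "2 * g = 2 * (s + 1) * jacobi_h \<alpha> \<beta> N / jacobi_h \<alpha> \<beta> (N - 1)" by (simp add: g_def)
  ultimately show ?thesis unfolding a_def e_def by (simp only:)
qed

text \<open>The case \<open>i = - 1\<close> is set apart because \<open>wilson_A_from_shift\<close>
  cancels \<open>k + 1\<close>. It belongs to the constant term at 0, where \<open>jacobi_A\<close>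
  has its own closed form.\<close>

lemma integral_product:
  fixes N :: nat and i :: int
  assumes N: "N > 0" and s1: "\<alpha> + \<beta> + 2 * of_nat N \<noteq> 1" and i: "Re (\<alpha> + of_int i) > - 1" "i \<noteq> - 1"
  defines "s \<equiv> \<alpha> + \<beta> + 2 * of_nat N"
  shows "jacobi_integral (\<alpha> + of_int i) \<beta> (P N * P (N - 1)) = jacobi_h \<alpha> \<beta> (N - 1) * of_int i *
     (of_nat N * (\<alpha> + of_nat N) * (\<beta> + of_nat N) * (\<alpha> + \<beta> + of_nat N)) / ((\<alpha> + 1) * s ^ 2 * (s - 1)) *
     (Gamma (s + 1) / Gamma (\<alpha> + 1) * (Gamma (\<alpha> + of_int i + 1) / Gamma (s + 1 + of_int i))) * wilson_A \<alpha> \<beta> N (of_int i)"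
proof -
  define e where "e = of_nat N * (\<beta> + of_nat N) / s"
  define k where "k = (of_int i :: complex)"
  define hN h where "hN = jacobi_h \<alpha> \<beta> N" and "h = jacobi_h \<alpha> \<beta> (N - 1)"
  define b where "b = jacobi_integral (\<alpha> + of_int i) \<beta> (P N * P (N - 1))"
  define W where "W = wilson \<alpha> \<beta> N"
  define X where "X = 2 * k * (of_nat N * (\<alpha> + of_nat N) * (\<beta> + of_nat N) * (\<alpha> + \<beta> + of_nat N)) /
       ((\<alpha> + 1) * s ^ 2 * (s - 1)) * wilson_A \<alpha> \<beta> N k"
  have n1: "real N \<ge> 1" using N by simp
  have hs: "hN \<noteq> 0" "h \<noteq> 0" using h_nonzero by (auto simp: hN_def h_def)
  have k1: "k + 1 \<noteq> 0" using i(2) unfolding k_def by (metis add.commute add_diff_cancel_left' diff_0 of_int_1 of_int_add of_int_eq_0_iff)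
  have Re_k: "Re (\<alpha> + k) > - 1" using i(1) by (simp add: k_def)
  have Re_pos: "Re (\<alpha> + k + 1) > 0" "Re (s + 2 + k) > 0" "Re (s + 1 + k) > 0" "Re (s + 1) > 0"
    using Re_k \<alpha> \<beta> n1 by (auto simp: s_def)
  note G = Re_pos[THEN Gamma_plus1_if_Re_pos]
  have nz: "s + 2 + k \<noteq> 0" "s + 1 + k \<noteq> 0" "s + 1 \<noteq> 0"
    using Re_k \<alpha> \<beta> n1 by (auto simp: s_def complex_eq_iff)
  define H where "H = hN * Gamma (s + 2) / Gamma (\<alpha> + 1) * (Gamma (\<alpha> + k + 1) / Gamma (s + 2 + k))"
  have a0: "jacobi_integral (\<alpha> + of_int i) \<beta> (P N * P N) = H * W k"
    unfolding integral_square[OF i(1)] H_def hN_def s_def W_def k_def ..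
  have a1: "jacobi_integral (\<alpha> + of_int (i + 1)) \<beta> (P N * P N) = H * ((\<alpha> + k + 1) / (s + 2 + k)) * W (k + 1)"
  proof -
    have i1: "Re (\<alpha> + of_int (i + 1)) > - 1" using i(1) by simp
    have "\<alpha> + of_int (i + 1) + 1 = \<alpha> + k + 1 + 1" "s + 2 + of_int (i + 1) = s + 2 + k + 1" "of_int (i + 1) = k + 1"
      by (simp_all add: k_def)
    note eqs = this
    have "jacobi_integral (\<alpha> + of_int (i + 1)) \<beta> (P N * P N) = hN * Gamma (s + 2) / Gamma (\<alpha> + 1) *
        (Gamma (\<alpha> + of_int (i + 1) + 1) / Gamma (s + 2 + of_int (i + 1))) * W (of_int (i + 1))"
      unfolding integral_square[OF i1] hN_def W_def s_def ..
    also have "\<dots> = H * ((\<alpha> + k + 1) / (s + 2 + k)) * W (k + 1)"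
      unfolding eqs(1,2) unfolding eqs(3) G(1,2) H_def by (simp add: mult_ac)
    finally show ?thesis .
  qed
  have "2 * (s + 1) * hN / h * b = (s + k + 2) * (H * ((\<alpha> + k + 1) / (s + 2 + k)) * W (k + 1)) - (\<alpha> + k + 1 + 2 * e) * (H * W k)"
    using integral_product_eq_squares[OF N i(1)] unfolding a0 a1 b_def h_def hN_def k_def e_def s_def .
  also have "(s + k + 2) * (H * ((\<alpha> + k + 1) / (s + 2 + k)) * W (k + 1)) = H * ((\<alpha> + k + 1) * W (k + 1))"
  proof -
    have e: "s + k + 2 = s + 2 + k" by simp
    show ?thesis unfolding e using nz(1) by simp
  qed
  also have "H * ((\<alpha> + k + 1) * W (k + 1)) - (\<alpha> + k + 1 + 2 * e) * (H * W k) =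
     H * ((k + 1 + \<alpha>) * W (k + 1) - (k + 1 + \<alpha> + 2 * e) * W k)"
    by (simp add: algebra_simps)
  also have "(k + 1 + \<alpha>) * W (k + 1) - (k + 1 + \<alpha> + 2 * e) * W k = (s + 1 + k) * X"
    unfolding W_def e_def X_def wilson_A_from_shift[OF \<alpha> \<beta> N s1 k1, folded s_def]
    by (simp only: times_divide_eq_left times_divide_eq_right mult_ac)
  finally have "2 * (s + 1) * hN / h * b = H * ((s + 1 + k) * X)" .
  also have "\<dots> = (s + 1) * hN * (Gamma (s + 1) / Gamma (\<alpha> + 1) * (Gamma (\<alpha> + k + 1) / Gamma (s + 1 + k))) * X"
  proof -
    have "s + 2 = s + 1 + 1" "s + 2 + k = s + 1 + k + 1" by simp_all
    hence "H = hN * ((s + 1) * Gamma (s + 1)) / Gamma (\<alpha> + 1) * (Gamma (\<alpha> + k + 1) / ((s + 1 + k) * Gamma (s + 1 + k)))"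
      unfolding H_def by (simp only: G)
    thus ?thesis using nz(2) by simp
  qed
  finally have eq: "2 * (s + 1) * hN / h * b = (s + 1) * hN * (Gamma (s + 1) / Gamma (\<alpha> + 1) * (Gamma (\<alpha> + k + 1) / Gamma (s + 1 + k))) * X" .
  define D where "D = (s + 1) * hN"
  have "D * (2 / h * b) = D * (Gamma (s + 1) / Gamma (\<alpha> + 1) * (Gamma (\<alpha> + k + 1) / Gamma (s + 1 + k)) * X)"
    using eq unfolding D_def by (simp only: mult_ac times_divide_eq_left times_divide_eq_right)
  moreover have "D \<noteq> 0" using hs nz by (simp add: D_def)
  ultimately have "2 / h * b = Gamma (s + 1) / Gamma (\<alpha> + 1) * (Gamma (\<alpha> + k + 1) / Gamma (s + 1 + k)) * X"
    by (simp only: mult_cancel_left simp_thms)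
  moreover have "b = h * (2 / h * b) / 2" using hs by simp
  ultimately have "b = h * (Gamma (s + 1) / Gamma (\<alpha> + 1) * (Gamma (\<alpha> + k + 1) / Gamma (s + 1 + k)) * X) / 2"
    by (simp only:)
  also have "\<dots> = h * (X / 2) * (Gamma (s + 1) / Gamma (\<alpha> + 1) * (Gamma (\<alpha> + k + 1) / Gamma (s + 1 + k)))"
    by (simp add: mult_ac)
  also have "X / 2 = k * (of_nat N * (\<alpha> + of_nat N) * (\<beta> + of_nat N) * (\<alpha> + \<beta> + of_nat N)) /
       ((\<alpha> + 1) * s ^ 2 * (s - 1)) * wilson_A \<alpha> \<beta> N k"
  proof -
    have "2 * k * x / y * w / 2 = k * x / y * w" for x y w :: complex by simp
    thus ?thesis unfolding X_def .
  qed
  finally show ?thesis unfolding b_def h_def k_def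
    by (simp only: times_divide_eq_left times_divide_eq_right mult_ac)
qed

end

subsection \<open>The expansions\<close>

text \<open>Compares the Gamma factors of the reflected exponents \<open>l\<close> and
  \<open>- 1 - l\<close>; this is the origin of the Pochhammer quotients in
  \<open>jacobi_A_tilde\<close> and \<open>jacobi_B_tilde\<close>.\<close>

lemma Gamma_symmetric_ratio:
  assumes "Re (x - of_nat l) > 0"
  shows "Gamma (x + of_nat l + 1) = pochhammer (x - of_nat l) (2 * l + 1) * Gamma (x - of_nat l)"
  using Gamma_plus_nat_if_Re_pos[OF assms, of "2 * l + 1"] by (simp add: algebra_simps)

section \<open>Matrices of size two\<close>

lemma mat22_nth [simp]:
  "mat22 a b c d $ 1 $ 1 = a" "mat22 a b c d $ 1 $ 2 = b" "mat22 a b c d $ 2 $ 1 = c" "mat22 a b c d $ 2 $ 2 = d"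
  by (simp_all add: mat22_def)

lemma mat22_eqI:
  fixes A B :: "complex^2^2"
  assumes "A $ 1 $ 1 = B $ 1 $ 1" "A $ 1 $ 2 = B $ 1 $ 2" "A $ 2 $ 1 = B $ 2 $ 1" "A $ 2 $ 2 = B $ 2 $ 2"
  shows "A = B"
  using assms by (simp add: vec_eq_iff forall_2)

lemma mat22_mult: "mat22 a b c d ** mat22 a' b' c' d' = mat22 (a * a' + b * c') (a * b' + b * d') (c * a' + d * c') (c * b' + d * d')"
  by (rule mat22_eqI) (simp_all add: matrix_matrix_mult_def sum_2)

lemma mat22_1: "mat 1 = mat22 1 0 0 1"
  by (rule mat22_eqI) (simp_all add: mat_def)

text \<open>\<open>matrix_inv\<close> chooses some two-sided inverse; uniqueness identifies
  it.\<close>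

lemma matrix_inv_eqI:
  fixes A B :: "complex^'n^'n"
  assumes "A ** B = mat 1" "B ** A = mat 1"
  shows "matrix_inv A = B"
proof -
  have "A ** matrix_inv A = mat 1 \<and> matrix_inv A ** A = mat 1"
    unfolding matrix_inv_def by (rule someI[of _ B]) (simp add: assms)
  thus ?thesis by (metis assms(1) matrix_mul_assoc matrix_mul_lid matrix_mul_rid)
qed

lemma matrix_inv_mat22:
  assumes "a * d - b * c = 1"
  shows "matrix_inv (mat22 a b c d) = mat22 d (- b) (- c) a"
  by (rule matrix_inv_eqI; unfold mat22_mult mat22_1; rule mat22_eqI) (use assms in \<open>simp_all add: mult.commute\<close>)

lemma conjugate_by_diag:
  assumes "t \<noteq> 0"
  shows "matrix_inv (mat22 1 0 0 t) ** M ** mat22 1 0 0 t = mat22 (M $ 1 $ 1) (M $ 1 $ 2 * t) (M $ 2 $ 1 / t) (M $ 2 $ 2)"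
proof -
  have "matrix_inv (mat22 1 0 0 t) = mat22 1 0 0 (1 / t)"
    by (rule matrix_inv_eqI; unfold mat22_mult mat22_1) (use assms in simp_all)
  moreover obtain a b c d where "M = mat22 a b c d"
    using mat22_eqI[of M "mat22 (M $ 1 $ 1) (M $ 1 $ 2) (M $ 2 $ 1) (M $ 2 $ 2)"] mat22_nth by metis
  ultimately show ?thesis using assms by (simp add: mat22_mult)
qed

lemma sums_matrix22:
  fixes f :: "nat \<Rightarrow> complex^2^2"
  assumes "(\<lambda>l. f l $ 1 $ 1) sums a" "(\<lambda>l. f l $ 1 $ 2) sums b" "(\<lambda>l. f l $ 2 $ 1) sums c" "(\<lambda>l. f l $ 2 $ 2) sums d"
  shows "f sums mat22 a b c d"
  unfolding sums_def
proof (intro vec_tendstoI)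
  fix i j :: 2
  have "(\<lambda>l. f l $ i $ j) sums (mat22 a b c d $ i $ j)"
    using exhaust_2[of i] exhaust_2[of j] assms by auto
  thus "(\<lambda>n. sum f {..<n} $ i $ j) \<longlonglongrightarrow> mat22 a b c d $ i $ j"
    by (simp add: sums_def sum_component)
qed

lemma tendsto_mat22:
  assumes "(a \<longlongrightarrow> a') F" "(b \<longlongrightarrow> b') F" "(c \<longlongrightarrow> c') F" "(d \<longlongrightarrow> d') F"
  shows "((\<lambda>z. mat22 (a z) (b z) (c z) (d z)) \<longlongrightarrow> mat22 a' b' c' d') F"
proof (intro vec_tendstoI)
  fix i j :: 2
  show "((\<lambda>z. mat22 (a z) (b z) (c z) (d z) $ i $ j) \<longlongrightarrow> mat22 a' b' c' d' $ i $ j) F"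
    using exhaust_2[of i] exhaust_2[of j] assms by auto
qed

context jacobi_polys
begin

text \<open>Converts the norm of \<open>P N\<close> in the upper right entry into the product that
  normalises this entry in the stated series.\<close>

lemma h_step:
  assumes N: "N > 0"
  defines "s \<equiv> \<alpha> + \<beta> + 2 * of_nat N"
  shows "jacobi_h \<alpha> \<beta> N * ((s + 1) * s ^ 2 * (s - 1)) =
     of_nat N * (\<alpha> + of_nat N) * (\<beta> + of_nat N) * (\<alpha> + \<beta> + of_nat N) * jacobi_h \<alpha> \<beta> (N - 1)"
proof -
  obtain m where m: "N = Suc m" using N by (cases N) auto
  have Re: "Re s > 0" "Re (\<alpha> + of_nat N) > 0" "Re (\<beta> + of_nat N) > 0" using \<alpha> \<beta> by (auto simp: s_def m)
  have s0: "s \<noteq> 0" "s + 1 \<noteq> 0" using Re(1) by (auto simp: complex_eq_iff)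
  have G: "Gamma (s + 1) = s * Gamma s" "Gamma (s + 2) = (s + 1) * (s * Gamma s)"
    "Gamma (\<alpha> + of_nat N + 1) = (\<alpha> + of_nat N) * Gamma (\<alpha> + of_nat N)"
    "Gamma (\<beta> + of_nat N + 1) = (\<beta> + of_nat N) * Gamma (\<beta> + of_nat N)"
    using Gamma_plus1_if_Re_pos[of s] Gamma_plus1_if_Re_pos[of "s + 1"] Re
      Gamma_plus1_if_Re_pos[of "\<alpha> + of_nat N"] Gamma_plus1_if_Re_pos[of "\<beta> + of_nat N"] by (simp_all add: add.assoc)
  have Gs: "Gamma s \<noteq> 0" using Re(1) by (rule Gamma_nonzero_if_Re_pos)
  have hN: "jacobi_h \<alpha> \<beta> N * ((s + 1) * s ^ 2 * Gamma s ^ 2) = of_nat N * fact m *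
      ((\<alpha> + of_nat N) * Gamma (\<alpha> + of_nat N)) * ((\<beta> + of_nat N) * Gamma (\<beta> + of_nat N)) * Gamma (\<alpha> + \<beta> + of_nat N + 1)"
  proof -
    have "jacobi_h \<alpha> \<beta> N = of_nat N * fact m * Gamma (\<alpha> + of_nat N + 1) * Gamma (\<beta> + of_nat N + 1) *
       (Gamma (\<alpha> + \<beta> + of_nat N + 1) / Gamma (s + 1)) / Gamma (s + 2)"
      using N by (simp add: jacobi_h_def s_def m)
    thus ?thesis unfolding G using s0 Gs by (simp add: power2_eq_square)
  qed
  have hm: "jacobi_h \<alpha> \<beta> m * (\<alpha> + \<beta> + of_nat N) * Gamma s ^ 2 = (s - 1) * (fact m * Gamma (\<alpha> + of_nat N) * Gamma (\<beta> + of_nat N) * Gamma (\<alpha> + \<beta> + of_nat N + 1))"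
  \<comment> \<open>At 0 the norm has its cancelled form; both sides keep the factor \<alpha> +
    \<beta> + 1, which may be 0.\<close>
  proof (cases "m = 0")
    case True
    thus ?thesis using Gs by (simp add: jacobi_h_def s_def m power2_eq_square add_ac)
  next
    case False
    hence m1: "real m \<ge> 1" by simp
    have Re': "Re (s - 1) > 0" "Re (\<alpha> + \<beta> + of_nat N) > 0" using \<alpha> \<beta> m1 by (auto simp: s_def m)
    have G': "Gamma s = (s - 1) * Gamma (s - 1)"
      "Gamma (\<alpha> + \<beta> + of_nat N + 1) = (\<alpha> + \<beta> + of_nat N) * Gamma (\<alpha> + \<beta> + of_nat N)"
      using Re'[THEN Gamma_plus1_if_Re_pos] by simp_all
    have nz: "s - 1 \<noteq> 0" "Gamma (s - 1) \<noteq> 0"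
      using Re'(1) Gamma_nonzero_if_Re_pos by auto
    have e: "\<alpha> + of_nat m + 1 = \<alpha> + of_nat N" "\<beta> + of_nat m + 1 = \<beta> + of_nat N" "\<alpha> + \<beta> + of_nat m + 1 = \<alpha> + \<beta> + of_nat N"
      "\<alpha> + \<beta> + 2 * of_nat m + 1 = s - 1" "\<alpha> + \<beta> + 2 * of_nat m + 2 = s" by (simp_all add: m s_def)
    have "jacobi_h \<alpha> \<beta> m = fact m * Gamma (\<alpha> + of_nat N) * Gamma (\<beta> + of_nat N) * (Gamma (\<alpha> + \<beta> + of_nat N) / Gamma (s - 1)) / Gamma s"
      using False unfolding jacobi_h_def e by simp
    thus ?thesis unfolding G' using nz by (simp add: power2_eq_square)
  qed
  have "jacobi_h \<alpha> \<beta> N * ((s + 1) * s ^ 2 * (s - 1)) * Gamma s ^ 2 =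
     of_nat N * (\<alpha> + of_nat N) * (\<beta> + of_nat N) * (\<alpha> + \<beta> + of_nat N) * jacobi_h \<alpha> \<beta> m * Gamma s ^ 2"
    using hN hm by algebra
  thus ?thesis using Gs by (simp add: m)
qed

lemma moment_square:
  assumes "\<alpha> + \<beta> + 2 * of_nat n + 1 \<noteq> 0"
  shows "J (monom 1 l * (P n * P n)) = jacobi_h \<alpha> \<beta> n * (\<alpha> + \<beta> + 2 * of_nat n + 1) * jacobi_B \<alpha> \<beta> (Suc n) l"
proof -
  define \<sigma> where "\<sigma> = \<alpha> + \<beta> + 2 * of_nat n + 1"
  have Re: "Re (\<alpha> + 1) > 0" "Re (\<sigma> + 1) > 0" using \<alpha> \<beta> by (auto simp: \<sigma>_def)
  note G0 = Re[THEN Gamma_nonzero_if_Re_pos]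
  note Gl = Re[THEN Gamma_plus_nat_if_Re_pos, of l]
  have "pochhammer \<sigma> (l + 1) = \<sigma> * pochhammer (\<sigma> + 1) l" by (simp add: pochhammer_rec)
  moreover have "J (monom 1 l * (P n * P n)) = jacobi_integral (\<alpha> + of_int (int l)) \<beta> (P n * P n)"
    by (simp add: jacobi_integral_plus_nat)
  moreover have "Re (\<alpha> + of_int (int l)) > - 1" using \<alpha> by simp
  note integral_square[OF this, of n]
  moreover have "\<alpha> + \<beta> + 2 * of_nat n + 2 = \<sigma> + 1" "\<alpha> + of_int (int l) + 1 = \<alpha> + 1 + of_nat l" "of_int (int l) = (of_nat l :: complex)"
    by (simp_all add: \<sigma>_def)
  ultimately show ?thesis using assms G0 unfolding jacobi_B_eq_wilson \<sigma>_def[symmetric]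
    by (simp only: Gl) simp
qed

text \<open>\<open>wilson_reflect\<close> gives both exponents the same polynomial value, so only a
  quotient of Gamma factors remains.\<close>

lemma moment_square_negative:
  assumes "Re \<alpha> > real l" "\<alpha> + \<beta> + 2 * of_nat n + 1 \<noteq> 0"
  shows "jacobi_integral (\<alpha> - of_nat (Suc l)) \<beta> (P n * P n) =
     jacobi_h \<alpha> \<beta> n * (\<alpha> + \<beta> + 2 * of_nat n + 1) * jacobi_B_tilde \<alpha> \<beta> (Suc n) l"
proof -
  define \<sigma> where "\<sigma> = \<alpha> + \<beta> + 2 * of_nat n + 1"
  have Re: "Re (\<alpha> - of_nat l) > 0" "Re (\<sigma> - of_nat l) > 0" using assms(1) \<beta> by (auto simp: \<sigma>_def)
  note G = Re[THEN Gamma_symmetric_ratio] and G0 = Re[THEN Gamma_nonzero_if_Re_pos]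
  have pos: "Re (\<alpha> + of_nat l + 1) > 0" "Re (\<sigma> + of_nat l + 1) > 0" using \<alpha> \<beta> by (auto simp: \<sigma>_def)
  note G1 = pos[THEN Gamma_nonzero_if_Re_pos]
  have p0: "pochhammer (\<alpha> - of_nat l) (2 * l + 1) \<noteq> 0" using G(1) G1(1) by auto
  have i: "Re (\<alpha> + of_int (- 1 - int l)) > - 1" using assms(1) by simp
  have e: "of_int (- 1 - int l) = (- 1 - of_nat l :: complex)" by simp
  have i': "Re (\<alpha> + of_int (int l)) > - 1" using \<alpha> by simp
  define H where "H = jacobi_h \<alpha> \<beta> n * Gamma (\<alpha> + \<beta> + 2 * of_nat n + 2) / Gamma (\<alpha> + 1)"
  have neg: "jacobi_integral (\<alpha> - of_nat (Suc l)) \<beta> (P n * P n) = H * (Gamma (\<alpha> - of_nat l) / Gamma (\<sigma> - of_nat l)) * wilson \<alpha> \<beta> n (of_nat l)"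
  proof -
    have "\<alpha> - of_nat (Suc l) = \<alpha> + of_int (- 1 - int l)" by simp
    moreover have "\<alpha> + (- 1 - of_nat l) + 1 = \<alpha> - of_nat l" "\<alpha> + \<beta> + 2 * of_nat n + 2 + (- 1 - of_nat l) = \<sigma> - of_nat l"
      by (simp_all add: \<sigma>_def)
    ultimately show ?thesis using integral_square[OF i, of n] by (simp only: H_def e wilson_reflect)
  qed
  have pos: "J (monom 1 l * (P n * P n)) = H * (Gamma (\<alpha> + of_nat l + 1) / Gamma (\<sigma> + of_nat l + 1)) * wilson \<alpha> \<beta> n (of_nat l)"
  proof -
    have "J (monom 1 l * (P n * P n)) = jacobi_integral (\<alpha> + of_int (int l)) \<beta> (P n * P n)"
      by (simp add: jacobi_integral_plus_nat)
    moreover have "\<alpha> + \<beta> + 2 * of_nat n + 2 + of_nat l = \<sigma> + of_nat l + 1" by (simp add: \<sigma>_def)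
    ultimately show ?thesis using integral_square[OF i', of n] by (simp only: H_def of_int_of_nat_eq)
  qed
  have "jacobi_integral (\<alpha> - of_nat (Suc l)) \<beta> (P n * P n) = pochhammer (\<sigma> - of_nat l) (2 * l + 1) / pochhammer (\<alpha> - of_nat l) (2 * l + 1) *
      J (monom 1 l * (P n * P n))"
    unfolding neg pos G using G0 G1 p0 G(2) by simp
  also have "\<dots> = jacobi_h \<alpha> \<beta> n * (\<alpha> + \<beta> + 2 * of_nat n + 1) * jacobi_B_tilde \<alpha> \<beta> (Suc n) l"
  proof -
    have "\<alpha> + \<beta> + 2 * of_nat (Suc n) - 1 - of_nat l = \<sigma> - of_nat l" by (simp add: \<sigma>_def)
    thus ?thesis unfolding moment_square[OF assms(2)] jacobi_B_tilde_def by (simp only:) simp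
  qed
  finally show ?thesis .
qed


lemma moment_product:
  assumes N: "N > 0" and s1: "\<alpha> + \<beta> + 2 * of_nat N \<noteq> 1"
  shows "J (monom 1 l * (P N * P (N - 1))) = jacobi_h \<alpha> \<beta> (N - 1) * (of_nat l * jacobi_A \<alpha> \<beta> N l / (\<alpha> + \<beta> + 2 * of_nat N))"
proof (cases l)
  case 0
  thus ?thesis using integral_P_P[of N "N - 1"] N by (simp add: monom_0 one_pCons[symmetric])
next
  case (Suc j)
  define s where "s = \<alpha> + \<beta> + 2 * of_nat N"
  have s: "s \<noteq> 0" "s - 1 \<noteq> 0" using sum_param_nonzero[OF N] s1 by (auto simp: s_def)
  have Re: "Re (\<alpha> + 2) > 0" "Re (s + 1) > 0" "Re (\<alpha> + 1) > 0" using \<alpha> \<beta> N by (auto simp: s_def)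
  note G0 = Re[THEN Gamma_nonzero_if_Re_pos]
  have a1: "\<alpha> + 1 \<noteq> 0" using Re(3) by (metis less_irrefl zero_complex.sel(1))
  have Ga: "Gamma (\<alpha> + of_nat l + 1) = pochhammer (\<alpha> + 2) (l - 1) * ((\<alpha> + 1) * Gamma (\<alpha> + 1))"
    using Gamma_plus_nat_if_Re_pos[OF Re(1), of j] Gamma_plus1_if_Re_pos[OF Re(3)] by (simp add: Suc add_ac)
  have Gs: "Gamma (s + 1 + of_nat l) = pochhammer (s + 1) l * Gamma (s + 1)"
    by (rule Gamma_plus_nat_if_Re_pos[OF Re(2)])
  have ps: "pochhammer (s - 1) (Suc (Suc l)) = (s - 1) * s * pochhammer (s + 1) l"
    by (simp add: pochhammer_rec)
  have l: "l \<noteq> 0" using Suc by simp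
  have A_eq: "jacobi_A \<alpha> \<beta> N l = of_nat N * (\<alpha> + of_nat N) * (\<beta> + of_nat N) * (\<alpha> + \<beta> + of_nat N) *
      pochhammer (\<alpha> + 2) (l - 1) / ((s - 1) * s * pochhammer (s + 1) l) * wilson_A \<alpha> \<beta> N (of_nat l)"
    using l by (simp add: jacobi_A_def wilson_A_eq_hypergeo[OF N] s_def[symmetric] ps del: One_nat_def)
  have i: "Re (\<alpha> + of_int (int l)) > - 1" "int l \<noteq> - 1" using \<alpha> by auto
  have "J (monom 1 l * (P N * P (N - 1))) = jacobi_integral (\<alpha> + of_int (int l)) \<beta> (P N * P (N - 1))"
    by (simp add: jacobi_integral_plus_nat)
  also have "\<dots> = jacobi_h \<alpha> \<beta> (N - 1) * (of_nat l * jacobi_A \<alpha> \<beta> N l / s)"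
    unfolding integral_product[OF N s1 i] unfolding s_def[symmetric] of_int_of_nat_eq Ga Gs
    unfolding A_eq using s a1 G0 by (simp add: power2_eq_square mult_ac)
  finally show ?thesis by (simp add: s_def)
qed

text \<open>The sign and the factor \<open>l + 1\<close> come from the factor
  \<open>of_int i\<close> of \<open>integral_product\<close> at
  \<open>i = - 1 - int l\<close>.\<close>

lemma moment_product_negative:
  assumes N: "N > 0" and s1: "\<alpha> + \<beta> + 2 * of_nat N \<noteq> 1" and l: "Re \<alpha> > real l"
  shows "jacobi_integral (\<alpha> - of_nat (Suc l)) \<beta> (P N * P (N - 1)) =
     - (jacobi_h \<alpha> \<beta> (N - 1) * (of_nat (l + 1) * jacobi_A_tilde \<alpha> \<beta> N l / (\<alpha> + \<beta> + 2 * of_nat N)))"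
proof -
  define s where "s = \<alpha> + \<beta> + 2 * of_nat N"
  define h where "h = jacobi_h \<alpha> \<beta> (N - 1)"
  have s: "s \<noteq> 0" "s + 1 \<noteq> 0" using sum_param_nonzero[OF N] \<alpha> \<beta> N by (cases N; auto simp: s_def complex_eq_iff)+
  have i: "Re (\<alpha> + of_int (- 1 - int l)) > - 1" using l by simp
  have e: "of_int (- 1 - int l) = (- 1 - of_nat l :: complex)" by simp
  have conv: "\<alpha> - of_nat (Suc l) = \<alpha> + of_int (- 1 - int l)" by simp
  show ?thesis
  proof (cases "l = 0")
    case True
    define hN where "hN = jacobi_h \<alpha> \<beta> N"
    define c where "c = of_nat N * (\<beta> + of_nat N) / s"
    have a: "\<alpha> \<noteq> 0" "Re \<alpha> > 0" using l by auto
    have h0: "hN \<noteq> 0" "h \<noteq> 0" using h_nonzero by (auto simp: hN_def h_def)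
    have sq: "jacobi_integral (\<alpha> - 1) \<beta> (P N * P N) = hN * (s + 1) / \<alpha>"
    proof -
      have "wilson \<alpha> \<beta> N (- 1) = 1" using wilson_reflect[of \<alpha> \<beta> N 0] by (simp add: wilson_0)
      moreover have "Gamma (\<alpha> + 1) = \<alpha> * Gamma \<alpha>" "Gamma (s + 2) = (s + 1) * Gamma (s + 1)"
        using Gamma_plus1_if_Re_pos[of \<alpha>] Gamma_plus1_if_Re_pos[of "s + 1"] a(2) \<beta> by (simp_all add: s_def add_ac)
      moreover have "Gamma \<alpha> \<noteq> 0" "Gamma (s + 1) \<noteq> 0"
        using a(2) \<beta> by (auto intro!: Gamma_nonzero_if_Re_pos simp: s_def)
      moreover have "\<alpha> + - 1 + 1 = \<alpha>" "s + 2 + - 1 = s + 1" by simp_all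
      moreover have "Re (\<alpha> + of_int (- 1)) > - 1" using a(2) by simp
      note integral_square[OF this, of N]
      ultimately show ?thesis using a(1) unfolding s_def[symmetric] hN_def[symmetric] of_int_minus of_int_1
        by (simp add: add_ac)
    qed
    have sq0: "jacobi_integral \<alpha> \<beta> (P N * P N) = hN" using integral_P_P[of N N] by (simp add: hN_def)
    define b where "b = jacobi_integral (\<alpha> - 1) \<beta> (P N * P (N - 1))"
    have "Re (\<alpha> + of_int (- 1)) > - 1" using a(2) by simp
    note eq = integral_product_eq_squares[OF N this, folded s_def, folded c_def h_def hN_def]
    have "\<alpha> + of_int (- 1) = \<alpha> - 1" "s + of_int (- 1) + 2 = s + 1" "\<alpha> + of_int (- 1 + 1) = \<alpha>" "\<alpha> - 1 + 1 = \<alpha>"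
      by simp_all
    from eq[unfolded this sq sq0]
    have "2 * (s + 1) * hN / h * b = (s + 1) * hN - (\<alpha> + 2 * c) * (hN * (s + 1) / \<alpha>)"
      unfolding b_def .
    hence "b = - h * c / \<alpha>"
      using h0 a(1) s(2) by (simp add: divide_simps) algebra
    moreover have "jacobi_A_tilde \<alpha> \<beta> N l / s = c / \<alpha>"
      using True s by (simp add: jacobi_A_tilde_def jacobi_A_def s_def[symmetric] c_def)
    ultimately show ?thesis using True unfolding h_def by (simp add: s_def[symmetric] b_def)
  next
    case False
    have "real N \<ge> 1" using N by simp
    hence Re: "Re (\<alpha> - of_nat l) > 0" "Re (s - of_nat l) > 0" using l \<beta> N by (auto simp: s_def)
    note G = Re[THEN Gamma_symmetric_ratio] and G0 = Re[THEN Gamma_nonzero_if_Re_pos]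
    have Repos: "Re (\<alpha> + of_nat l + 1) > 0" "Re (s + of_nat l + 1) > 0" using \<alpha> \<beta> N by (auto simp: s_def)
    note G1 = Repos[THEN Gamma_nonzero_if_Re_pos]
    have p0: "pochhammer (\<alpha> - of_nat l) (2 * l + 1) \<noteq> 0" "pochhammer (s - of_nat l) (2 * l + 1) \<noteq> 0" using G G1 by auto
    define C where "C = (of_nat N * (\<alpha> + of_nat N) * (\<beta> + of_nat N) * (\<alpha> + \<beta> + of_nat N)) / ((\<alpha> + 1) * s ^ 2 * (s - 1)) * (Gamma (s + 1) / Gamma (\<alpha> + 1))"
    define w where "w = wilson_A \<alpha> \<beta> N (of_nat l)"
    have pos: "J (monom 1 l * (P N * P (N - 1))) = h * of_nat l * C * (Gamma (\<alpha> + of_nat l + 1) / Gamma (s + of_nat l + 1)) * w"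
    proof -
      have i: "Re (\<alpha> + of_int (int l)) > - 1" "int l \<noteq> - 1" using \<alpha> by auto
      have "s + 1 + of_nat l = s + of_nat l + 1" by simp
      note integral_product[OF N s1 i, folded s_def h_def, unfolded of_int_of_nat_eq this]
      thus ?thesis unfolding jacobi_integral_plus_nat by (simp add: C_def w_def mult_ac)
    qed
    have neg: "jacobi_integral (\<alpha> - of_nat (Suc l)) \<beta> (P N * P (N - 1)) = h * (- 1 - of_nat l) * C * (Gamma (\<alpha> - of_nat l) / Gamma (s - of_nat l)) * w"
    proof -
      have i': "- 1 - int l \<noteq> - 1" using False by simp
      have "s + 1 + (- 1 - of_nat l) = s - of_nat l" "\<alpha> + (- 1 - of_nat l) + 1 = \<alpha> - of_nat l" by simp_all
      note eqs = this
      show ?thesis unfolding conv e integral_product[OF N s1 i i', folded s_def h_def, unfolded e eqs wilson_A_reflect]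
        by (simp add: C_def w_def mult_ac)
    qed
    \<comment> \<open>The moment with exponent \<open>l\<close> supplies \<open>jacobi_A\<close>
      only with the factor \<open>l\<close>, which can be cancelled since
      \<open>l \<noteq> 0\<close>.\<close>
    define A where "A = of_nat l * jacobi_A \<alpha> \<beta> N l / s"
    have "h * A = h * of_nat l * C * (Gamma (\<alpha> + of_nat l + 1) / Gamma (s + of_nat l + 1)) * w"
      using moment_product[OF N s1, of l] pos by (simp add: A_def h_def s_def)
    also have "\<dots> = of_nat l * (h * C * (Gamma (\<alpha> - of_nat l) / Gamma (s - of_nat l)) * w) *
       (pochhammer (\<alpha> - of_nat l) (2 * l + 1) / pochhammer (s - of_nat l) (2 * l + 1))"
      unfolding G by (simp add: mult_ac)
    finally have "of_nat l * (h * (jacobi_A \<alpha> \<beta> N l / s)) = of_nat l * (h * C * (Gamma (\<alpha> - of_nat l) / Gamma (s - of_nat l)) * w *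
       (pochhammer (\<alpha> - of_nat l) (2 * l + 1) / pochhammer (s - of_nat l) (2 * l + 1)))"
      by (simp only: A_def times_divide_eq_right times_divide_eq_left mult_ac)
    moreover have "of_nat l \<noteq> (0 :: complex)" using False by simp
    ultimately have "h * (jacobi_A \<alpha> \<beta> N l / s) = h * C * (Gamma (\<alpha> - of_nat l) / Gamma (s - of_nat l)) * w *
       (pochhammer (\<alpha> - of_nat l) (2 * l + 1) / pochhammer (s - of_nat l) (2 * l + 1))"
      by (simp only: mult_cancel_left simp_thms)
    moreover have "h * (jacobi_A_tilde \<alpha> \<beta> N l / s) = h * (jacobi_A \<alpha> \<beta> N l / s) *
       (pochhammer (s - of_nat l) (2 * l + 1) / pochhammer (\<alpha> - of_nat l) (2 * l + 1))"
      by (simp add: jacobi_A_tilde_def s_def mult_ac)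
    ultimately have tilde: "h * (jacobi_A_tilde \<alpha> \<beta> N l / s) = h * C * (Gamma (\<alpha> - of_nat l) / Gamma (s - of_nat l)) * w"
      using p0 by simp
    have minus: "- (of_nat (l + 1) * x) = (- 1 - of_nat l) * x" for x :: complex by (simp add: algebra_simps)
    have "- (of_nat (l + 1) * (h * (jacobi_A_tilde \<alpha> \<beta> N l / s))) =
        (- 1 - of_nat l) * (h * C * (Gamma (\<alpha> - of_nat l) / Gamma (s - of_nat l)) * w)"
      unfolding minus tilde ..
    also have "\<dots> = h * (- 1 - of_nat l) * C * (Gamma (\<alpha> - of_nat l) / Gamma (s - of_nat l)) * w"
      by (simp only: mult_ac)
    finally have "- (of_nat (l + 1) * (h * (jacobi_A_tilde \<alpha> \<beta> N l / s))) =
        h * (- 1 - of_nat l) * C * (Gamma (\<alpha> - of_nat l) / Gamma (s - of_nat l)) * w" .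
    thus ?thesis unfolding neg h_def[symmetric] s_def[symmetric] by (simp add: mult_ac)
  qed
qed


text \<open>Replacing F(z) by F(x) under the integral costs the integral of \<open>P m\<close> times
  a difference quotient of degree at most \<open>m\<close>; orthogonality leaves only its top
  coefficient.\<close>

lemma cauchy_times_poly:
  assumes z: "z \<notin> of_real ` {0..1}" and F: "degree F \<le> Suc m"
  shows "poly F z * jacobi_cauchy \<alpha> \<beta> (P m) z = jacobi_cauchy \<alpha> \<beta> (F * P m) z - coeff F (Suc m) * jacobi_h \<alpha> \<beta> m"
proof -
  define D where "D = synthetic_div F z"
  have F_eq: "F = [:- z, 1:] * D + [:poly F z:]" unfolding D_def by (rule synthetic_div_correct'[symmetric])
  have deg: "degree D \<le> m" using F by (simp add: D_def degree_synthetic_div)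
  have "coeff F (Suc m) = coeff D m"
  proof -
    have "coeff D (Suc m) = 0" using deg by (simp add: coeff_eq_0)
    thus ?thesis by (subst F_eq) (simp add: mult_pCons_left)
  qed
  moreover have "F * P m = smult (poly F z) (P m) + [:- z, 1:] * (P m * D)"
    by (subst F_eq) (simp add: algebra_simps)
  ultimately show ?thesis
    by (simp add: jacobi_cauchy_split[OF \<alpha> \<beta> z] jacobi_cauchy_smult[OF \<alpha> \<beta> z] orthogonal[OF deg] del: mult_pCons_left)
qed

text \<open>The matrix \<open>jacobi_Y\<close> has determinant 1: both products in it give the same
  Cauchy transform, and only the one with \<open>poly (P N) z\<close> leaves the correction
  \<open>h\<close>. The inverse is therefore explicit.\<close>

lemma jacobi_R_eq:
  assumes N: "N > 0" and z: "z \<notin> of_real ` {0..1}"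
  defines "C \<equiv> \<lambda>F. jacobi_cauchy \<alpha> \<beta> F z" and "h \<equiv> jacobi_h \<alpha> \<beta> (N - 1)"
  shows "jacobi_R \<alpha> \<beta> P N z = mat22 (1 - C (P N * P (N - 1)) / h) (- C (P N * P N) / (2 * of_real pi * \<i>))
     (2 * of_real pi * \<i> / h ^ 2 * C (P (N - 1) * P (N - 1))) (C (P N * P (N - 1)) / h)"
proof -
  obtain m where m: "N = Suc m" using N by (cases N) auto
  define t where "t = 2 * of_real pi * \<i>"
  define c where "c = - t / h"
  define p q u v where "p = poly (P N) z" and "q = poly (P (N - 1)) z" and "u = C (P N) / t" and "v = C (P (N - 1)) / t"
  have t0: "t \<noteq> 0" by (simp add: t_def)
  have h0: "h \<noteq> 0" unfolding h_def by (rule h_nonzero)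
  have pp: "p * C (P N) = C (P N * P N)" and pq: "p * C (P (N - 1)) = C (P N * P (N - 1)) - h"
    and qp: "q * C (P N) = C (P N * P (N - 1))" and qq: "q * C (P (N - 1)) = C (P (N - 1) * P (N - 1))"
    using cauchy_times_poly[OF z, of "P N" N] cauchy_times_poly[OF z, of "P N" m]
      cauchy_times_poly[OF z, of "P m" N] cauchy_times_poly[OF z, of "P m" m]
    by (simp_all add: C_def h_def p_def q_def m coeff_eq_0 mult.commute)
  have det: "p * (c * v) - u * (c * q) = 1"
  proof -
    have "p * (c * v) - u * (c * q) = (p * C (P (N - 1)) - q * C (P N)) * (c / t)"
      by (simp add: u_def v_def algebra_simps)
    also have "\<dots> = 1" unfolding pq qp using t0 h0 by (simp add: c_def)
    finally show ?thesis .
  qed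
  have Y: "jacobi_Y \<alpha> \<beta> P N z = mat22 p u (c * q) (c * v)"
    by (simp add: jacobi_Y_def Let_def cauchy_transform_eq p_def q_def u_def v_def c_def t_def h_def C_def)
  have R: "jacobi_R \<alpha> \<beta> P N z = mat22 (p * (c * v)) (- (p * u)) (c * q * (c * v)) (- (c * q * u))"
    unfolding jacobi_R_def Y matrix_inv_mat22[OF det] E11_def mat22_mult by simp
  have "p * (c * v) = 1 - C (P N * P (N - 1)) / h"
  proof -
    have "p * (c * v) = (p * C (P (N - 1))) * (c / t)" by (simp add: v_def)
    also have "\<dots> = 1 - C (P N * P (N - 1)) / h" unfolding pq using t0 h0 by (simp add: c_def field_simps)
    finally show ?thesis .
  qed
  moreover have "- (p * u) = - C (P N * P N) / t" using pp by (simp add: u_def)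
  moreover have "c * q * (c * v) = t / h ^ 2 * C (P (N - 1) * P (N - 1))"
    unfolding qq[symmetric] using t0 by (simp add: c_def v_def power2_eq_square)
  moreover have "- (c * q * u) = C (P N * P (N - 1)) / h"
    unfolding qp[symmetric] using t0 by (simp add: c_def u_def)
  ultimately show ?thesis unfolding R t_def by (simp only:)
qed

end


theorem proposition4p1:
  fixes \<alpha> \<beta> :: complex and N :: nat and P :: "nat \<Rightarrow> complex poly"
  assumes "N \<ge> 1"
    and "Re \<alpha> > -1" and "Re \<beta> > -1"
    and "\<alpha> + \<beta> + 2 * of_nat N \<noteq> 1"
    and "monic_jacobi \<alpha> \<beta> P"
  shows "(\<forall>z. norm z > 1 \<longrightarrow>
            summable (R_inf_term \<alpha> \<beta> N z) \<and>
            jacobi_R \<alpha> \<beta> P N z =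
              matrix_inv (jacobi_T \<alpha> \<beta> N) ** R_inf \<alpha> \<beta> N z ** jacobi_T \<alpha> \<beta> N) \<and>
         (\<forall>n. real n < Re \<alpha> \<longrightarrow> poincare_at_zero \<alpha> \<beta> P N n)"
proof -
  interpret jacobi_polys \<alpha> \<beta> P by unfold_locales (use assms in auto)
  have N: "N > 0" using assms(1) by simp
  then obtain m where m: "N = Suc m" by (cases N) auto
  define s where "s = \<alpha> + \<beta> + 2 * of_nat N"
  define h where "h = jacobi_h \<alpha> \<beta> (N - 1)"
  define t where "t = 2 * of_real pi * \<i>"
  \<comment> \<open>Conjugation by \<open>jacobi_T\<close> multiplies the upper right entry by this
    number and divides the lower left one by it.\<close>
  define \<tau> where "\<tau> = h / t * (1 / (s * (s - 1)))"
  define Q where "Q = of_nat N * (\<alpha> + of_nat N) * (\<beta> + of_nat N) * (\<alpha> + \<beta> + of_nat N)"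
  have s: "s \<noteq> 0" "s - 1 \<noteq> 0" using sum_param_nonzero[OF N] assms(4) by (auto simp: s_def)
  have sp: "s + 1 \<noteq> 0" using \<alpha> \<beta> by (auto simp: s_def m complex_eq_iff)
  have t0: "t \<noteq> 0" by (simp add: t_def)
  have h0: "h \<noteq> 0" unfolding h_def by (rule h_nonzero)
  have \<tau>0: "\<tau> \<noteq> 0" using s t0 h0 by (simp add: \<tau>_def)
  have T: "jacobi_T \<alpha> \<beta> N = mat22 1 0 0 \<tau>"
    by (simp add: jacobi_T_def \<tau>_def h_def t_def s_def)
  have hN: "jacobi_h \<alpha> \<beta> N * (s + 1) = h * Q / (s ^ 2 * (s - 1))"
  proof -
    have "jacobi_h \<alpha> \<beta> N * (s + 1) * (s ^ 2 * (s - 1)) = h * Q"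
      using h_step[OF N, folded s_def h_def] unfolding Q_def by (simp only: mult_ac)
    moreover have "s ^ 2 * (s - 1) \<noteq> 0" using s by simp
    ultimately show ?thesis by (simp only: eq_divide_eq simp_thms if_True if_False)
  qed
  have sm: "\<alpha> + \<beta> + 2 * of_nat m + 1 = s - 1" and sN: "\<alpha> + \<beta> + 2 * of_nat N + 1 = s + 1"
    by (simp_all add: s_def m)
  have pm: "\<alpha> + \<beta> + 2 * of_nat m + 1 \<noteq> 0" and pN: "\<alpha> + \<beta> + 2 * of_nat N + 1 \<noteq> 0"
    unfolding sm sN using s sp by auto
  let ?pp = "P N * P N" and ?pq = "P N * P (N - 1)" and ?qq = "P (N - 1) * P (N - 1)"

  have infinity: "summable (R_inf_term \<alpha> \<beta> N z) \<and>
      jacobi_R \<alpha> \<beta> P N z = matrix_inv (jacobi_T \<alpha> \<beta> N) ** R_inf \<alpha> \<beta> N z ** jacobi_T \<alpha> \<beta> N"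
    if z: "norm z > 1" for z
  proof -
    define C where "C = (\<lambda>F. jacobi_cauchy \<alpha> \<beta> F z)"
    have z01: "z \<notin> of_real ` {0..1}" using z by auto
    note S = jacobi_cauchy_sums[OF \<alpha> \<beta> z]
    have S11: "(\<lambda>l. 1 / z ^ (l + 1) * (1 / s * (of_nat l * jacobi_A \<alpha> \<beta> N l))) sums (- C ?pq / h)"
    proof -
      have "jacobi_integral \<alpha> \<beta> (monom 1 l * ?pq) / z ^ (l + 1) / h = 1 / z ^ (l + 1) * (1 / s * (of_nat l * jacobi_A \<alpha> \<beta> N l))" for l
        unfolding moment_product[OF N assms(4)] using h0 by (simp add: h_def s_def)
      thus ?thesis using sums_divide[OF S[of ?pq], of h] by (simp add: C_def)
    qed
    have S12: "(\<lambda>l. 1 / z ^ (l + 1) * (1 / s * (Q * jacobi_B \<alpha> \<beta> (N + 1) l))) sums (- C ?pp / (t * \<tau>))"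
    proof -
      have "jacobi_integral \<alpha> \<beta> (monom 1 l * ?pp) / z ^ (l + 1) / (t * \<tau>) = 1 / z ^ (l + 1) * (1 / s * (Q * jacobi_B \<alpha> \<beta> (N + 1) l))" for l
        unfolding moment_square[OF pN] sN hN using s h0 t0 by (simp add: \<tau>_def power2_eq_square)
      thus ?thesis using sums_divide[OF S[of ?pp], of "t * \<tau>"] by (simp add: C_def)
    qed
    have S21: "(\<lambda>l. 1 / z ^ (l + 1) * (1 / s * (- jacobi_B \<alpha> \<beta> N l))) sums (C ?qq * t / h ^ 2 * \<tau>)"
    proof -
      have "jacobi_integral \<alpha> \<beta> (monom 1 l * ?qq) / z ^ (l + 1) * (- t / h ^ 2 * \<tau>) = 1 / z ^ (l + 1) * (1 / s * (- jacobi_B \<alpha> \<beta> N l))" for l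
        using moment_square[OF pm, of l] unfolding sm using s h0 t0 by (simp add: \<tau>_def power2_eq_square h_def m)
      thus ?thesis using sums_mult2[OF S[of ?qq], of "- t / h ^ 2 * \<tau>"] by (simp add: C_def mult_ac)
    qed
    have S22: "(\<lambda>l. 1 / z ^ (l + 1) * (1 / s * (- (of_nat l * jacobi_A \<alpha> \<beta> N l)))) sums (C ?pq / h)"
      using sums_minus[OF S11] by simp
    have sums: "R_inf_term \<alpha> \<beta> N z sums mat22 (- C ?pq / h) (- C ?pp / (t * \<tau>)) (C ?qq * t / h ^ 2 * \<tau>) (C ?pq / h)"
      by (rule sums_matrix22)
        (use S11 S12 S21 S22 in \<open>simp_all add: R_inf_term_def R_inf_coeff_def scale_mat_def s_def Q_def\<close>)
    have Rinf: "R_inf \<alpha> \<beta> N z = mat22 (1 - C ?pq / h) (- C ?pp / (t * \<tau>)) (C ?qq * t / h ^ 2 * \<tau>) (C ?pq / h)"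
      unfolding R_inf_def sums_unique[OF sums, symmetric] E11_def by (rule mat22_eqI) simp_all
    have "jacobi_R \<alpha> \<beta> P N z = matrix_inv (jacobi_T \<alpha> \<beta> N) ** R_inf \<alpha> \<beta> N z ** jacobi_T \<alpha> \<beta> N"
      unfolding T conjugate_by_diag[OF \<tau>0] Rinf jacobi_R_eq[OF N z01] using \<tau>0 t0
      by (intro mat22_eqI) (simp_all add: C_def t_def h_def)
    thus ?thesis using sums_summable[OF sums] by blast
  qed

  have zero: "poincare_at_zero \<alpha> \<beta> P N n" if n: "real n < Re \<alpha>" for n
  proof -
    let ?F = "at 0 within {z. 0 < Arg2pi z \<and> Arg2pi z < 2 * pi}"
    \<comment> \<open>The condition \<open>real n < Re \<alpha>\<close> says exactly that this
      exponent has real part above -1.\<close>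
    define a where "a = \<alpha> - of_nat (Suc n)"
    have a: "Re a > - 1" using n by (simp add: a_def)
    \<comment> \<open>One factor \<open>z\<close> of the remainder is spent on the Cauchy transform,
      which leaves \<open>z ^ n\<close> times a quantity tending to 0.\<close>
    define D where "D = (\<lambda>F z. z * jacobi_cauchy a \<beta> F z)"
    define M where "M = (\<lambda>z. mat22 (- D ?pq z / h) (- D ?pp z / t) (t / h ^ 2 * D ?qq z) (D ?pq z / h))"
    have D0: "(D F \<longlongrightarrow> 0) ?F" for F unfolding D_def by (rule tendsto_jacobi_cauchy_zero[OF a \<beta>])
    have "(M \<longlongrightarrow> mat22 (- 0 / h) (- 0 / t) (t / h ^ 2 * 0) (0 / h)) ?F"
      unfolding M_def by (intro tendsto_mat22 tendsto_intros D0 h0 t0)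
    moreover have "mat22 (- 0 / h) (- 0 / t) (t / h ^ 2 * 0) (0 / h) = 0" by (rule mat22_eqI) simp_all
    ultimately have M0: "((\<lambda>z. norm (M z)) \<longlongrightarrow> 0) ?F" using tendsto_norm_zero by metis
    have diff: "jacobi_R \<alpha> \<beta> P N z - matrix_inv (jacobi_T \<alpha> \<beta> N) ** R_zero_trunc \<alpha> \<beta> N n z ** jacobi_T \<alpha> \<beta> N =
        scale_mat (z ^ n) (M z)" if z: "0 < Arg2pi z" for z
    proof -
      have z01: "z \<notin> of_real ` {0..1}" using z Arg2pi_of_real by auto
      note Z = jacobi_cauchy_expand_zero[OF n \<beta> z01, folded a_def]
      have l: "Re \<alpha> > real l" if "l \<le> n" for l using n that by simp
      have pq: "jacobi_cauchy \<alpha> \<beta> ?pq z = - h * (\<Sum>l\<le>n. z ^ l * (1 / s * (of_nat (l + 1) * jacobi_A_tilde \<alpha> \<beta> N l))) + z ^ n * D ?pq z"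
      proof -
        have "(\<Sum>l\<le>n. z ^ l * jacobi_integral (\<alpha> - of_nat (Suc l)) \<beta> ?pq) =
           - h * (\<Sum>l\<le>n. z ^ l * (1 / s * (of_nat (l + 1) * jacobi_A_tilde \<alpha> \<beta> N l)))"
          unfolding sum_distrib_left
        proof (intro sum.cong refl)
          fix l assume "l \<in> {..n}"
          hence "Re \<alpha> > real l" using l by simp
          thus "z ^ l * jacobi_integral (\<alpha> - of_nat (Suc l)) \<beta> ?pq = - h * (z ^ l * (1 / s * (of_nat (l + 1) * jacobi_A_tilde \<alpha> \<beta> N l)))"
            unfolding moment_product_negative[OF N assms(4) \<open>Re \<alpha> > real l\<close>] by (simp add: h_def s_def)
        qed
        thus ?thesis unfolding Z[of ?pq] D_def by simp
      qed
      have pp: "jacobi_cauchy \<alpha> \<beta> ?pp z = t * \<tau> * (\<Sum>l\<le>n. z ^ l * (1 / s * (Q * jacobi_B_tilde \<alpha> \<beta> (N + 1) l))) + z ^ n * D ?pp z"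
      proof -
        have "(\<Sum>l\<le>n. z ^ l * jacobi_integral (\<alpha> - of_nat (Suc l)) \<beta> ?pp) =
           t * \<tau> * (\<Sum>l\<le>n. z ^ l * (1 / s * (Q * jacobi_B_tilde \<alpha> \<beta> (N + 1) l)))"
          unfolding sum_distrib_left
        proof (intro sum.cong refl)
          fix l assume "l \<in> {..n}"
          hence "Re \<alpha> > real l" using l by simp
          thus "z ^ l * jacobi_integral (\<alpha> - of_nat (Suc l)) \<beta> ?pp = t * \<tau> * (z ^ l * (1 / s * (Q * jacobi_B_tilde \<alpha> \<beta> (N + 1) l)))"
            unfolding moment_square_negative[OF \<open>Re \<alpha> > real l\<close> pN] sN hN using s t0
            by (simp add: \<tau>_def power2_eq_square mult_ac)
        qed
        thus ?thesis unfolding Z[of ?pp] D_def by simp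
      qed
      have qq: "jacobi_cauchy \<alpha> \<beta> ?qq z = h ^ 2 / (t * \<tau>) * (\<Sum>l\<le>n. z ^ l * (1 / s * jacobi_B_tilde \<alpha> \<beta> N l)) + z ^ n * D ?qq z"
      proof -
        have "(\<Sum>l\<le>n. z ^ l * jacobi_integral (\<alpha> - of_nat (Suc l)) \<beta> ?qq) =
           h ^ 2 / (t * \<tau>) * (\<Sum>l\<le>n. z ^ l * (1 / s * jacobi_B_tilde \<alpha> \<beta> N l))"
          unfolding sum_distrib_left
        proof (intro sum.cong refl)
          fix l assume "l \<in> {..n}"
          hence "Re \<alpha> > real l" using l by simp
          from moment_square_negative[OF this pm]
          show "z ^ l * jacobi_integral (\<alpha> - of_nat (Suc l)) \<beta> ?qq = h ^ 2 / (t * \<tau>) * (z ^ l * (1 / s * jacobi_B_tilde \<alpha> \<beta> N l))"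
            unfolding sm using s t0 h0 by (simp add: \<tau>_def power2_eq_square h_def m)
        qed
        thus ?thesis unfolding Z[of ?qq] D_def by simp
      qed
      define S1 S2 S3 where "S1 = (\<Sum>l\<le>n. z ^ l * (1 / s * (of_nat (l + 1) * jacobi_A_tilde \<alpha> \<beta> N l)))"
        and "S2 = (\<Sum>l\<le>n. z ^ l * (1 / s * (Q * jacobi_B_tilde \<alpha> \<beta> (N + 1) l)))"
        and "S3 = (\<Sum>l\<le>n. z ^ l * (1 / s * jacobi_B_tilde \<alpha> \<beta> N l))"
      have R0: "R_zero_trunc \<alpha> \<beta> N n z = mat22 (1 + S1) (- S2) S3 (- S1)"
        by (rule mat22_eqI) (simp_all add: R_zero_trunc_def R_zero_coeff_def E11_def scale_mat_def
            sum_component S1_def S2_def S3_def s_def Q_def sum_negf)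
      show ?thesis
        unfolding T conjugate_by_diag[OF \<tau>0] jacobi_R_eq[OF N z01] R0
          pp[folded S2_def] pq[folded S1_def] qq[folded S3_def]
        unfolding h_def[symmetric] t_def[symmetric] using \<tau>0 t0 h0
        by (intro mat22_eqI) (simp_all add: scale_mat_def M_def field_simps)
    qed
    have pos: "\<forall>\<^sub>F z in ?F. 0 < Arg2pi z \<and> z \<noteq> 0" by (auto simp: eventually_at_filter)
    show ?thesis unfolding poincare_at_zero_def
    proof (rule smalloI_tendsto)
      show "\<forall>\<^sub>F z in ?F. norm z ^ n \<noteq> 0" using pos by eventually_elim simp
      have "\<forall>\<^sub>F z in ?F. norm (M z) = norm (jacobi_R \<alpha> \<beta> P N z -
          matrix_inv (jacobi_T \<alpha> \<beta> N) ** R_zero_trunc \<alpha> \<beta> N n z ** jacobi_T \<alpha> \<beta> N) / norm z ^ n"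
        using pos
      proof eventually_elim
        case (elim z)
        have "norm (scale_mat c A) = norm c * norm A" for c and A :: "complex^2^2"
          by (simp add: norm_vec_def L2_set_def scale_mat_def norm_mult power_mult_distrib sum_distrib_left[symmetric]
              real_sqrt_mult real_sqrt_abs)
        thus ?case using elim by (simp add: diff norm_power)
      qed
      thus "((\<lambda>z. norm (jacobi_R \<alpha> \<beta> P N z -
          matrix_inv (jacobi_T \<alpha> \<beta> N) ** R_zero_trunc \<alpha> \<beta> N n z ** jacobi_T \<alpha> \<beta> N) / norm z ^ n) \<longlongrightarrow> 0) ?F"
        using M0 by (rule Lim_transform_eventually[rotated])
    qed
  qed
  show ?thesis using infinity zero by blast
qed

end
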